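(* Let $G$ be a finite abelian group acting linearly on a finite-dimensional real vector space $V$, let $\alpha,\beta\in G$, and let $$\xi=X_\alpha\otimes\Lambda_\alpha\in\Gamma(\wedge^{k-l(\alpha)}TV^\alpha\otimes\wedge^{l(\alpha)}N^\alpha)^G,\qquad \eta=Y_\beta\otimes\Lambda_\beta\in\Gamma(\wedge^{l-l(\beta)}TV^\beta\otimes\wedge^{l(\beta)}N^\beta)^G .$$ Put $g=\alpha\beta$. Then $L(T(\xi)\circ T(\eta))$ is computed as follows. (1) If $V^\alpha+V^\beta\neq V$, then $L(T(\xi)\circ T(\eta))=0$. (2) If $V^\alpha+V^\beta=V$, write $V=V^{g}\oplus N^\alpha\oplus N^\beta$, so that $V^\alpha=V^{g}\oplus N^\beta$ and $V^\beta=V^{g}\oplus N^\alpha$ (and $l(g)=l(\alpha)+l(\beta)$), and expand $$X_\alpha=\sum X_\alpha^{i_1\cdots i_s,p_1\cdots p_{k-l(\alpha)-s}}\tfrac{\partial}{\partial x^{i_1}}\wedge\cdots\wedge\tfrac{\partial}{\partial x^{i_s}}\wedge\tfrac{\partial}{\partial x^{p_1}}\wedge\cdots\wedge\tfrac{\partial}{\partial x^{p_{k-l(\alpha)-s}}},$$ $$Y_\beta=\sum Y_\beta^{j_1\cdots j_t,q_1\cdots q_{l-l(\beta)-t}}\tfrac{\partial}{\partial x^{j_1}}\wedge\cdots\wedge\tfrac{\partial}{\partial x^{j_t}}\wedge\tfrac{\partial}{\partial x^{q_1}}\wedge\cdots\wedge\tfrac{\partial}{\partial x^{q_{l-l(\beta)-t}}},$$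 where the indices $i,j$ run over coordinates of $V^{g}$, the $p$'s over coordinates of $N^\beta$, the $q$'s over coordinates of $N^\alpha$. Then the component of $L(T(\xi)\circ T(\eta))$ in $\Gamma(\wedge^{k+l-l(g)-1}TV^g\otimes\wedge^{l(g)}(N^\alpha\oplus N^\beta))^G$ is (coefficients being restricted to $V^g$) $$\sum_{i_1,\dots,i_{k-l(\alpha)},\,j_1,\dots,j_{l-l(\beta)}}\ \sum_{z=1}^{k-l(\alpha)}(-1)^{(z-1)(l-1)+(k-z)l+(l-l(\beta))l(\alpha)}X_\alpha^{i_1\cdots i_{k-l(\alpha)}}\frac{\partial Y_\beta^{j_1\cdots j_{l-l(\beta)}}}{\partial x^{i_z}}\,\tfrac{\partial}{\partial x^{i_1}}\wedge\cdots\widehat{\tfrac{\partial}{\partial x^{i_z}}}\cdots\wedge\tfrac{\partial}{\partial x^{i_{k-l(\alpha)}}}\wedge\tfrac{\partial}{\partial x^{j_1}}\wedge\cdots\wedge\tfrac{\partial}{\partial x^{j_{l-l(\beta)}}}\otimes\Lambda_\alpha\wedge\Lambda_\beta$$ $$+\sum_{i_1,\dots,i_{k-l(\alpha)},\,j_1,\dots,j_{l-l(\beta)-1},\,q}(-1)^{(k-l(\alpha))(l-1)+(k-l(\beta))(l(\alpha)-1)}X_\alpha^{i_1\cdots i_{k-l(\alpha)}}\frac{\partial Y_\beta^{j_1\cdots j_{l-l(\beta)-1},q}}{\partial x^{q}}\,\tfrac{\partial}{\partial x^{i_1}}\wedge\cdots\wedge\tfrac{\partial}{\partial x^{i_{k-l(\alpha)}}}\wedge\tfrac{\partial}{\partial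 x^{j_1}}\wedge\cdots\wedge\tfrac{\partial}{\partial x^{j_{l-l(\beta)-1}}}\otimes\Lambda_\alpha\wedge\Lambda_\beta .$$
   Context: Setting. $A=\mathrm{Poly}(V)$ is the algebra of polynomial functions; $G$ acts effectively on $V$ and on $A$ by $(gf)(x)=f(g^{-1}x)$; $A\rtimes G$ is spanned by $aU_g$ with $(aU_g)(bU_h)=a\,g(b)U_{gh}$. Scalars are extended to $\mathbb C$; since $G$ is abelian, fix linear coordinates on $V$ that are eigenfunctions of every element of $G$. $A_g$ is $A$ with bimodule structure $a\cdot\xi\cdot b=a\xi g(b)$. $C^k(A,M)=\mathrm{Hom}(A^{\otimes k},M)$. $G$ acts on $C^\bullet(A,A\rtimes G)$ by $(h\Psi)(f_1,\dots,f_k)=U_{h^{-1}}\Psi(hf_1,\dots,hf_k)U_{h}$. For an algebra $B$, the pre-Lie product on $C^\bullet(B,B)$ is $\phi\circ\psi(a_1,\dots,a_{k+l-1})=\sum_{i=1}^k(-1)^{(i-1)(l-1)}\phi(a_1,\dots,a_{i-1},\psi(a_i,\dots,a_{i+l-1}),a_{i+l},\dots,a_{k+l-1})$ for $\phi\in C^k$, $\psi\in C^l$. For $g\in G$, $V^g$ is the fixed subspace, $N^g$ the sum of the nontrivial irreducible subrepresentations of $\langle g\rangle$ in $V$, $V=V^g\oplus N^g$, $l(g)=\dim N^g$; both are spanned by coordinate directions. Sections $\Gamma$ have polynomial coefficients on $V^g$ and are extended to $V$ constantly along $N^g$; $h\in G$ acts by push-forward. Multivectors act on functions by $(v_1\wedge\cdots\wedge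 v_k)(f_1,\dots,f_k)=\frac1{k!}\sum_{\sigma\in S_k}(-1)^\sigma\prod_jv_{\sigma(j)}(f_j)$. A hat denotes an omitted factor. The map $L=L_3L_2L_1$. $L_1(\Psi)$ is the $G$-average of the restriction of $\Psi\in C^k(A\rtimes G,A\rtimes G)$ to $A^{\otimes k}$. $L_2=\sum_gL_2^g$, where for $\Psi\in C^k(A,A_g)$, $p\in V$, $L_2^g(\Psi)(p)=\sum_{i_1,\dots,i_k}\frac1{k!}\sum_{\sigma\in S_k}(-1)^\sigma\Psi(x^{i_{\sigma(1)}}-x^{i_{\sigma(1)}}(p),\dots,x^{i_{\sigma(k)}}-x^{i_{\sigma(k)}}(p))(p)\,\frac{\partial}{\partial x^{i_1}}\wedge\cdots\wedge\frac{\partial}{\partial x^{i_k}}$. $L_3=\sum_gL_3^g$, $L_3^g(X)=pr^g(X|_{V^g})$, with $pr^g:\wedge^\bullet TV|_{V^g}\to\wedge^{\bullet-l(g)}TV^g\otimes\wedge^{l(g)}N^g$ the projection. Twisted cocycle. For $g\in G$ let $x$ denote the coordinates on $V^g$ and $y^1,\dots,y^{l}$ ($l=l(g)$) those on $N^g$; put $\tilde y^i=g(y^i)$. For $\sigma\in S_l$ let $z^j_\sigma$ be obtained from $(y^1,\dots,y^l)$ by replacing $y^{\sigma(1)},\dots,y^{\sigma(j)}$ by $\tilde y^{\sigma(1)},\dots,\tilde y^{\sigma(j)}$. Define $\Omega_g\in C^l(A,A_g)$ by $\Omega_g(f_1,\dots,f_l)(x,y)=\frac1{l!}\sum_{\sigma\in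 S_l}(-1)^\sigma\prod_{j=1}^l\big(f_j(x,z_\sigma^{j-1})-f_j(x,z_\sigma^j)\big)\big/\prod_{j=1}^l(y^j-\tilde y^j)$, and $\Lambda_g=\frac{\partial}{\partial y^1}\wedge\cdots\wedge\frac{\partial}{\partial y^l}$. The map $T=T_2T_1$. For $\xi_g=X_g\otimes\Lambda_g$ ($G$-invariant), $T_1(\xi_g)=T_1^g(\xi_g)U_g$ with $T_1^g(\xi_g)(f_1,\dots,f_k)=X_g(f_1,\dots,f_{k-l(g)})\,\Omega_g(f_{k-l(g)+1},\dots,f_k)$; $T_2(\Phi)(a_1U_{g_1},\dots,a_kU_{g_k})=\Phi(a_1,g_1(a_2),\dots,g_1\cdots g_{k-1}(a_k))U_{g_1\cdots g_k}$.
   Formalization: In the second sum the sign exponent (k-l(α))(l-1)+(k-l(β))(l(α)-1) is corrected to (k-l(α))(l-1)+l(β)(l(α)-1); the two differ only for k odd and l(α) even, where the printed sign is wrong (e.g. α=diag(1,-1,-1), k=3, X=∂_x, β=1, l=1, Y=y¹∂₁+y²∂₂ gives +2ξ, not -2ξ). *)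

theory Defs
  imports
    "HOL-Analysis.Analysis"
    "HOL-Algebra.Group_Action"
    "HOL-Algebra.Generated_Groups"
    "HOL-Combinatorics.Permutations"
begin

section \<open>The representation and its eigen-coordinates\<close>

text \<open>
  Only the real vector space \<open>V\<close> (the type \<open>'v\<close>) carries the given action. The coordinates
  \<open>x\<^sup>i\<close> (\<open>coord S i\<close>, \<open>i < vdim S\<close>) are real-linear maps from \<open>V\<close> to \<open>\<complex>\<close>, i.e. complex linear
  coordinates on the complexification of \<open>V\<close>. The class \<open>real_vector\<close> together with \<open>finite_dim\<close>
  is used instead of \<open>euclidean_space\<close>, which would exclude \<open>V = 0\<close>.
\<close>

record ('g, 'v) lin_action =
  grp :: "'g monoid"
  act :: "'g \<Rightarrow> 'v \<Rightarrow> 'v"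
  coord :: "nat \<Rightarrow> 'v \<Rightarrow> complex"

definition vdim :: "('g, 'v::real_vector) lin_action \<Rightarrow> nat" where
  "vdim S = dim (UNIV :: 'v set)"

locale abelian_lin_action =
  fixes S :: "('g, 'v::real_vector) lin_action"
  assumes comm_group: "comm_group (grp S)"
    and finite_group: "finite (carrier (grp S))"
    and finite_dim: "\<exists>B :: 'v set. finite B \<and> span B = UNIV"
    and effective: "faithful_action (grp S) (UNIV :: 'v set) (act S)"
    and act_linear: "g \<in> carrier (grp S) \<Longrightarrow> linear (act S g)"
    and coord_linear: "i < vdim S \<Longrightarrow> linear (coord S i)"
    and coord_independent:
      "(\<forall>v. (\<Sum>i<vdim S. c i * coord S i v) = 0) \<Longrightarrow> i < vdim S \<Longrightarrow> c i = 0"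
    and coord_eigen:
      "g \<in> carrier (grp S) \<Longrightarrow> i < vdim S \<Longrightarrow>
        \<exists>c. \<forall>v. coord S i (act S (inv\<^bsub>grp S\<^esub> g) v) = c * coord S i v"

text \<open>The eigenvalue of \<open>g\<close> on \<open>x\<^sup>i\<close>, for the action \<open>(g f)(v) = f (g\<^sup>-\<^sup>1 v)\<close> on functions.\<close>

definition weight :: "('g, 'v::real_vector) lin_action \<Rightarrow> 'g \<Rightarrow> nat \<Rightarrow> complex" where
  "weight S g i = (THE c. \<forall>v. coord S i (act S (inv\<^bsub>grp S\<^esub> g) v) = c * coord S i v)"

definition fix_sub :: "('g, 'v::real_vector) lin_action \<Rightarrow> 'g \<Rightarrow> 'v set" where
  "fix_sub S g = {v. act S g v = v}"

definition subrep :: "('g, 'v::real_vector) lin_action \<Rightarrow> 'g \<Rightarrow> 'v set \<Rightarrow> bool" where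
  "subrep S g W \<longleftrightarrow> subspace W \<and> (\<forall>h \<in> generate (grp S) {g}. act S h ` W \<subseteq> W)"

definition irreducible_subrep :: "('g, 'v::real_vector) lin_action \<Rightarrow> 'g \<Rightarrow> 'v set \<Rightarrow> bool" where
  "irreducible_subrep S g W \<longleftrightarrow>
     subrep S g W \<and> W \<noteq> {0} \<and> (\<forall>U. subrep S g U \<and> U \<subseteq> W \<longrightarrow> U = {0} \<or> U = W)"

definition normal_sub :: "('g, 'v::real_vector) lin_action \<Rightarrow> 'g \<Rightarrow> 'v set" where
  "normal_sub S g =
     span (\<Union>{W. irreducible_subrep S g W \<and> (\<exists>h \<in> generate (grp S) {g}. \<exists>w \<in> W. act S h w \<noteq> w)})"

definition codim :: "('g, 'v::real_vector) lin_action \<Rightarrow> 'g \<Rightarrow> nat" where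
  "codim S g = dim (normal_sub S g)"

definition sum_space :: "'v::real_vector set \<Rightarrow> 'v set \<Rightarrow> 'v set" where
  "sum_space U W = {u + w | u w. u \<in> U \<and> w \<in> W}"

definition direct_sum :: "'v::real_vector set \<Rightarrow> 'v set \<Rightarrow> 'v set \<Rightarrow> bool" where
  "direct_sum V U W \<longleftrightarrow> V = sum_space U W \<and> U \<inter> W = {0}"

text \<open>
  Every \<open>x\<^sup>i\<close> is a coordinate either on \<open>V\<^sup>g\<close> or on \<open>N\<^sup>g\<close>; the latter are those vanishing on \<open>V\<^sup>g\<close>.
  The coordinates \<open>y\<^sup>1, \<dots>, y\<^sup>l\<close> on \<open>N\<^sup>g\<close> are taken in increasing order of their index. (Another order
  would change \<open>\<Omega>\<^sub>g\<close> and \<open>\<Lambda>\<^sub>g\<close> by the same sign.)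
\<close>

definition normal_idx :: "('g, 'v::real_vector) lin_action \<Rightarrow> 'g \<Rightarrow> nat set" where
  "normal_idx S g = {i. i < vdim S \<and> (\<forall>v \<in> fix_sub S g. coord S i v = 0)}"

definition fix_idx :: "('g, 'v::real_vector) lin_action \<Rightarrow> 'g \<Rightarrow> nat set" where
  "fix_idx S g = {i. i < vdim S \<and> (\<exists>v \<in> fix_sub S g. coord S i v \<noteq> 0)}"

definition ys :: "('g, 'v::real_vector) lin_action \<Rightarrow> 'g \<Rightarrow> nat list" where
  "ys S g = sorted_list_of_set (normal_idx S g)"

section \<open>Polynomial functions and the crossed product\<close>

text \<open>
  A point of the complexified \<open>V\<close> is represented by its coordinate tuple (a point \<open>v\<close> of \<open>V\<close> by
  \<open>\<lambda>i. coord S i v\<close>). Entries with index \<open>\<ge> vdim S\<close> are irrelevant, because polynomial functions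
  only involve the coordinates of index \<open>< vdim S\<close>.
\<close>

type_synonym point = "nat \<Rightarrow> complex"
type_synonym pfun = "point \<Rightarrow> complex"

text \<open>
  Polynomial functions in the coordinates indexed by \<open>I\<close>. \<open>A\<close> is \<open>polys {..<vdim S}\<close>;
  polynomials on \<open>V\<^sup>g\<close>, extended constantly along \<open>N\<^sup>g\<close>, are \<open>polys (fix_idx S g)\<close>.
\<close>

inductive_set polys :: "nat set \<Rightarrow> pfun set" for I :: "nat set" where
  const: "(\<lambda>p. c) \<in> polys I"
| coordinate: "i \<in> I \<Longrightarrow> (\<lambda>p. p i) \<in> polys I"
| add: "f \<in> polys I \<Longrightarrow> h \<in> polys I \<Longrightarrow> (\<lambda>p. f p + h p) \<in> polys I"
| mult: "f \<in> polys I \<Longrightarrow> h \<in> polys I \<Longrightarrow> (\<lambda>p. f p * h p) \<in> polys I"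

definition partial :: "nat \<Rightarrow> pfun \<Rightarrow> pfun" where
  "partial i f p = deriv (\<lambda>t. f (p(i := t))) (p i)"

text \<open>The action on points: \<open>x\<^sup>i (g p) = (g\<^sup>-\<^sup>1 x\<^sup>i)(p)\<close>.\<close>

definition act_point :: "('g, 'v::real_vector) lin_action \<Rightarrow> 'g \<Rightarrow> point \<Rightarrow> point" where
  "act_point S g p = (\<lambda>i. weight S (inv\<^bsub>grp S\<^esub> g) i * p i)"

definition act_fun :: "('g, 'v::real_vector) lin_action \<Rightarrow> 'g \<Rightarrow> pfun \<Rightarrow> pfun" where
  "act_fun S g f = (\<lambda>p. f (act_point S (inv\<^bsub>grp S\<^esub> g) p))"

text \<open>An element \<open>\<Sum>\<^sub>g a\<^sub>g U\<^sub>g\<close> of the crossed product is the family \<open>g \<mapsto> a\<^sub>g\<close>.\<close>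

type_synonym 'g crossed = "'g \<Rightarrow> pfun"

definition monom_U :: "pfun \<Rightarrow> 'g \<Rightarrow> 'g crossed" where
  "monom_U a g = (\<lambda>h p. if h = g then a p else 0)"

definition cmult :: "('g, 'v::real_vector) lin_action \<Rightarrow> 'g crossed \<Rightarrow> 'g crossed \<Rightarrow> 'g crossed" where
  "cmult S a b = (\<lambda>m p. \<Sum>(g, h) \<in> {(g, h). g \<in> carrier (grp S) \<and> h \<in> carrier (grp S) \<and>
     g \<otimes>\<^bsub>grp S\<^esub> h = m}. a g p * act_fun S g (b h) p)"

abbreviation U_elem :: "'g \<Rightarrow> 'g crossed" where
  "U_elem g \<equiv> monom_U (\<lambda>p. 1) g"

definition gprod :: "('g, 'v::real_vector) lin_action \<Rightarrow> 'g list \<Rightarrow> 'g" where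
  "gprod S gs = foldr (\<lambda>g h. g \<otimes>\<^bsub>grp S\<^esub> h) gs \<one>\<^bsub>grp S\<^esub>"

text \<open>
  A \<open>k\<close>-cochain is a multilinear map on \<open>k\<close> arguments, given as a function on lists of length \<open>k\<close>.
  Signs are written with \<open>powi\<close> so that exponents such as \<open>(i - 1)(l - 1)\<close> with \<open>l = 0\<close> are
  computed in the integers.
\<close>

definition pre_lie ::
    "nat \<Rightarrow> nat \<Rightarrow> ('g crossed list \<Rightarrow> 'g crossed) \<Rightarrow> ('g crossed list \<Rightarrow> 'g crossed) \<Rightarrow>
     'g crossed list \<Rightarrow> 'g crossed" where
  "pre_lie k l \<phi> \<psi> as = (\<lambda>m p. \<Sum>i = 1..k. (-1) powi ((int i - 1) * (int l - 1)) *
     \<phi> (take (i - 1) as @ [\<psi> (take l (drop (i - 1) as))] @ drop (i - 1 + l) as) m p)"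

section \<open>Multivector fields\<close>

text \<open>
  A multivector is its family of components: \<open>w T\<close> is the coefficient of
  \<open>\<partial>\<^bsub>t1\<^esub> \<and> \<dots> \<and> \<partial>\<^bsub>tm\<^esub>\<close>, where \<open>t1 < \<dots> < tm\<close> are the elements of \<open>T\<close>.
\<close>

type_synonym mvec = "nat set \<Rightarrow> complex"
type_synonym mvfield = "point \<Rightarrow> mvec"

text \<open>
  \<open>wedge is\<close> is \<open>\<partial>\<^bsub>i1\<^esub> \<and> \<dots> \<and> \<partial>\<^bsub>im\<^esub>\<close>. At most one \<open>\<sigma>\<close> contributes: the one sorting \<open>is\<close>,
  which exists iff the entries of \<open>is\<close> are distinct and are the elements of \<open>T\<close>.
\<close>

definition wedge :: "nat list \<Rightarrow> mvec" where
  "wedge is T = (\<Sum>\<sigma> | \<sigma> permutes {..<length is}.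
     if finite T \<and> map (\<lambda>j. is ! \<sigma> j) [0..<length is] = sorted_list_of_set T
     then of_int (sign \<sigma>) else 0)"

definition wedge_mult :: "mvec \<Rightarrow> mvec \<Rightarrow> mvec" where
  "wedge_mult a b T = (\<Sum>P \<in> Pow T. a P * b (T - P) *
     wedge (sorted_list_of_set P @ sorted_list_of_set (T - P)) T)"

text \<open>The value of an \<open>m\<close>-vector field on \<open>m\<close> functions.\<close>

definition mv_apply :: "('g, 'v::real_vector) lin_action \<Rightarrow> nat \<Rightarrow> mvfield \<Rightarrow> pfun list \<Rightarrow> pfun" where
  "mv_apply S m X fs p = (\<Sum>T | T \<subseteq> {..<vdim S} \<and> card T = m. X p T *
     (1 / fact m * (\<Sum>\<sigma> | \<sigma> permutes {..<m}. of_int (sign \<sigma>) *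
        (\<Prod>j<m. partial (sorted_list_of_set T ! \<sigma> j) (fs ! j) p))))"

definition push_forward :: "('g, 'v::real_vector) lin_action \<Rightarrow> 'g \<Rightarrow> mvfield \<Rightarrow> mvfield" where
  "push_forward S h X p T =
     (\<Prod>i \<in> T. weight S (inv\<^bsub>grp S\<^esub> h) i) * X (act_point S (inv\<^bsub>grp S\<^esub> h) p) T"

definition Lambda :: "('g, 'v::real_vector) lin_action \<Rightarrow> 'g \<Rightarrow> mvec" where
  "Lambda S g = wedge (ys S g)"

text \<open>
  The fields \<open>X\<close> on \<open>V\<^sup>g\<close> of degree \<open>k - l(g)\<close>, as the first factors of the sections
  \<open>X \<otimes> \<Lambda>\<^sub>g\<close> of total degree \<open>k\<close>; only \<open>X = 0\<close> if \<open>k < l(g)\<close>.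
\<close>

definition sections :: "('g, 'v::real_vector) lin_action \<Rightarrow> 'g \<Rightarrow> nat \<Rightarrow> mvfield set" where
  "sections S g k = {X. \<forall>T. (\<lambda>p. X p T) \<in> polys (fix_idx S g) \<and>
     (\<forall>p. X p T \<noteq> 0 \<longrightarrow> T \<subseteq> fix_idx S g \<and> card T + codim S g = k)}"

text \<open>\<open>X \<otimes> \<Lambda>\<^sub>g\<close>, with \<open>\<and>TV\<^sup>g \<otimes> \<and>N\<^sup>g\<close> embedded in \<open>\<and>TV\<close> by the wedge product.\<close>

definition tensor_Lambda :: "('g, 'v::real_vector) lin_action \<Rightarrow> 'g \<Rightarrow> mvfield \<Rightarrow> mvfield" where
  "tensor_Lambda S g X p = wedge_mult (X p) (Lambda S g)"

definition invariant :: "('g, 'v::real_vector) lin_action \<Rightarrow> mvfield \<Rightarrow> bool" where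
  "invariant S \<xi> \<longleftrightarrow> (\<forall>h \<in> carrier (grp S). push_forward S h \<xi> = \<xi>)"

section \<open>The map T\<close>

text \<open>The point \<open>(x, z\<^sup>j\<^sub>\<sigma>)\<close>; positions of the \<open>y\<close>-coordinates are counted from 0.\<close>

definition zpoint ::
    "('g, 'v::real_vector) lin_action \<Rightarrow> 'g \<Rightarrow> (nat \<Rightarrow> nat) \<Rightarrow> nat \<Rightarrow> point \<Rightarrow> point" where
  "zpoint S g \<sigma> j p =
     (\<lambda>i. if i \<in> (\<lambda>m. ys S g ! \<sigma> m) ` {..<j} then weight S g i * p i else p i)"

text \<open>The quotient is the polynomial one, hence also defined where some \<open>y\<^sup>j = \<tilde>y\<^sup>j\<close>.\<close>

definition Omega :: "('g, 'v::real_vector) lin_action \<Rightarrow> 'g \<Rightarrow> pfun list \<Rightarrow> pfun" where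
  "Omega S g fs = (THE q. q \<in> polys {..<vdim S} \<and>
     (\<forall>p. q p * (\<Prod>j<codim S g. p (ys S g ! j) - weight S g (ys S g ! j) * p (ys S g ! j)) =
        1 / fact (codim S g) * (\<Sum>\<sigma> | \<sigma> permutes {..<codim S g}. of_int (sign \<sigma>) *
          (\<Prod>j<codim S g. (fs ! j) (zpoint S g \<sigma> j p) - (fs ! j) (zpoint S g \<sigma> (Suc j) p)))))"

definition T1 :: "('g, 'v::real_vector) lin_action \<Rightarrow> nat \<Rightarrow> 'g \<Rightarrow> mvfield \<Rightarrow>
    pfun list \<Rightarrow> 'g crossed" where
  "T1 S k g X fs = monom_U (\<lambda>p. mv_apply S (k - codim S g) X (take (k - codim S g) fs) p *
     Omega S g (drop (k - codim S g) fs) p) g"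

text \<open>The multilinear extension of the formula on the generators \<open>a\<^sub>1 U\<^bsub>g1\<^esub>, \<dots>, a\<^sub>k U\<^bsub>gk\<^esub>\<close>.\<close>

definition T2 :: "('g, 'v::real_vector) lin_action \<Rightarrow> nat \<Rightarrow>
    (pfun list \<Rightarrow> 'g crossed) \<Rightarrow> 'g crossed list \<Rightarrow> 'g crossed" where
  "T2 S k \<Phi> bs = (\<lambda>m p. \<Sum>gs | set gs \<subseteq> carrier (grp S) \<and> length gs = k.
     cmult S (\<Phi> (map (\<lambda>j. act_fun S (gprod S (take j gs)) ((bs ! j) (gs ! j))) [0..<k]))
       (U_elem (gprod S gs)) m p)"

text \<open>\<open>T (X \<otimes> \<Lambda>\<^sub>g)\<close> for a section of total degree \<open>k\<close>.\<close>

definition T_map :: "('g, 'v::real_vector) lin_action \<Rightarrow> nat \<Rightarrow> 'g \<Rightarrow> mvfield \<Rightarrow>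
    'g crossed list \<Rightarrow> 'g crossed" where
  "T_map S k g X = T2 S k (T1 S k g X)"

section \<open>The map L\<close>

definition L1 :: "('g, 'v::real_vector) lin_action \<Rightarrow> ('g crossed list \<Rightarrow> 'g crossed) \<Rightarrow>
    pfun list \<Rightarrow> 'g crossed" where
  "L1 S \<Psi> fs = (\<lambda>m p. 1 / of_nat (card (carrier (grp S))) * (\<Sum>h \<in> carrier (grp S).
     cmult S (cmult S (U_elem (inv\<^bsub>grp S\<^esub> h))
       (\<Psi> (map (\<lambda>f. monom_U (act_fun S h f) \<one>\<^bsub>grp S\<^esub>) fs))) (U_elem h) m p))"

definition L2 :: "('g, 'v::real_vector) lin_action \<Rightarrow> nat \<Rightarrow> (pfun list \<Rightarrow> pfun) \<Rightarrow> mvfield" where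
  "L2 S k \<Psi> p T = (\<Sum>is | set is \<subseteq> {..<vdim S} \<and> length is = k.
     (1 / fact k * (\<Sum>\<sigma> | \<sigma> permutes {..<k}. of_int (sign \<sigma>) *
        \<Psi> (map (\<lambda>j q. q (is ! \<sigma> j) - p (is ! \<sigma> j)) [0..<k]) p)) * wedge is T)"

definition to_fix :: "('g, 'v::real_vector) lin_action \<Rightarrow> 'g \<Rightarrow> point \<Rightarrow> point" where
  "to_fix S g p = (\<lambda>i. if i \<in> normal_idx S g then 0 else p i)"

text \<open>
  The restriction to \<open>V\<^sup>g\<close> is again extended constantly along \<open>N\<^sup>g\<close>. The projection keeps the
  components containing all directions of \<open>N\<^sup>g\<close>.
\<close>

definition L3 :: "('g, 'v::real_vector) lin_action \<Rightarrow> 'g \<Rightarrow> mvfield \<Rightarrow> mvfield" where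
  "L3 S g X p T = (if normal_idx S g \<subseteq> T then X (to_fix S g p) T else 0)"

text \<open>The component at \<open>g\<close> of \<open>L (\<Psi>)\<close>, for a \<open>k\<close>-cochain \<open>\<Psi>\<close> on the crossed product.\<close>

definition L_map :: "('g, 'v::real_vector) lin_action \<Rightarrow> nat \<Rightarrow>
    ('g crossed list \<Rightarrow> 'g crossed) \<Rightarrow> 'g \<Rightarrow> mvfield" where
  "L_map S k \<Psi> g = L3 S g (L2 S k (\<lambda>fs. L1 S \<Psi> fs g))"

section \<open>The two signs\<close>

text \<open>Here \<open>a = l(\<alpha>)\<close> and \<open>b = l(\<beta>)\<close>.\<close>

definition sign1 :: "nat \<Rightarrow> nat \<Rightarrow> nat \<Rightarrow> nat \<Rightarrow> nat \<Rightarrow> complex" where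
  "sign1 k l a b z = (-1) powi ((int z - 1) * (int l - 1) + (int k - int z) * int l
     + (int l - int b) * int a)"

text \<open>
  The source prints \<open>(k - l(\<beta>))(l(\<alpha>) - 1)\<close> for the second summand of this exponent. That is a misprint
  for \<open>l(\<beta>)(l(\<alpha>) - 1)\<close>, the sign of moving \<open>\<Lambda>\<^sub>\<beta>\<close> past the remaining \<open>l(\<alpha>) - 1\<close> factors of \<open>\<Lambda>\<^sub>\<alpha>\<close>.
  The two signs agree unless \<open>k\<close> is odd and \<open>l(\<alpha>)\<close> is even, and then the printed one is wrong: let
  \<open>\<int>/2\<close> act on \<open>\<real>\<^sup>3\<close> by \<open>\<alpha>(x, y\<^sup>1, y\<^sup>2) = (x, -y\<^sup>1, -y\<^sup>2)\<close>, let \<open>k = 3\<close>, \<open>X\<^sub>\<alpha> = \<partial>/\<partial>x\<close>, and let \<open>l = 1\<close>,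
  \<open>\<beta> = 1\<close>, \<open>Y\<^sub>\<beta> = y\<^sup>1 \<partial>/\<partial>y\<^sup>1 + y\<^sup>2 \<partial>/\<partial>y\<^sup>2\<close>. As \<open>l = 1\<close>, the product \<open>T(\<xi>) \<circ> T(\<eta>)\<close> is the sum of the three
  insertions of the derivation, all with sign \<open>+\<close>, and its image under \<open>L\<close> is \<open>2 \<xi>\<close>; the printed
  sign gives \<open>-2 \<xi>\<close>.
\<close>

definition sign2 :: "nat \<Rightarrow> nat \<Rightarrow> nat \<Rightarrow> nat \<Rightarrow> complex" where
  "sign2 k l a b = (-1) powi ((int k - int a) * (int l - 1) + int b * (int a - 1))"

end

theory Submission
  imports Defs "HOL-Algebra.Multiplicative_Group"
begin

text \<open>
  For an invariant \<open>X \<otimes> \<Lambda>\<^sub>g\<close> the cochain \<open>T\<^sub>1\<close> commutes with the action of the group (\<open>T1_coeff_act\<close>), and the pre-Lie product of a cochain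
  supported at \<open>U\<^sub>\<alpha>\<close> with one supported at \<open>U\<^sub>\<beta>\<close> is supported at \<open>U\<^bsub>\<alpha>\<beta>\<^esub>\<close>. So all terms of the
  average \<open>L\<^sub>1\<close> agree (\<open>L1_pre_lie\<close>), and only the component at \<open>g = \<alpha>\<beta>\<close> can be nonzero. The map \<open>L\<^sub>2\<close>
  sums the values of the cochain on all lists of the functions \<open>x\<^sup>i - x\<^sup>i(p)\<close> against the wedge product
  of the corresponding directions (\<open>L2_eq\<close>). The wedge product alternates, so only lists of
  distinct directions contribute.

  Every difference quotient of a function \<open>x\<^sup>i - x\<^sup>i(p)\<close> is \<open>0\<close> or \<open>1\<close>, so \<open>\<Omega>\<^sub>\<beta>\<close> takes the
  constant values of \<open>\<Lambda>\<^sub>\<beta>\<close> on these functions (\<open>Omega_shifted\<close>), and after summation \<open>T(\<eta>)\<close> just inserts the directions of \<open>Y \<otimes> \<Lambda>\<^sub>\<beta>\<close> as one block of length \<open>l\<close> into the list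
  (\<open>sum_inner\<close>). The action of \<open>\<beta>\<close> on the later arguments is invisible, because a direction on which
  \<open>\<beta>\<close> acts nontrivially already occurs in \<open>\<Lambda>\<^sub>\<beta>\<close> (\<open>untwist\<close>). What remains is \<open>T(\<xi>)\<close> with a single
  nonlinear argument, a coefficient \<open>y\<close> of \<open>Y\<close>, which depends on the coordinates of \<open>V\<^sup>\<beta>\<close> only.

  Suppose that \<open>N\<^sup>\<alpha>\<close> and \<open>N\<^sup>\<beta>\<close> have a coordinate direction \<open>c\<close> in common. Each term of \<open>\<Omega>\<^sub>\<alpha>\<close> takes
  a difference quotient in the direction \<open>c\<close>, and \<open>y\<close> does not depend on it. So \<open>c\<close> must be an index
  of one of the affine arguments, and together with \<open>\<Lambda>\<^sub>\<beta>\<close> it occurs twice in the wedge product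
  (\<open>sum_pre_lie_coeff_overlap\<close>).

  Suppose that they have none. If \<open>y\<close> stands in a slot of \<open>X\<close>, it is differentiated. If it stands
  in a slot of \<open>\<Omega>\<^sub>\<alpha>\<close>, the difference quotient of \<open>y\<close> at a point of \<open>V\<^sup>g\<close> degenerates to a partial
  derivative (\<open>Omega_slot\<close>). In either case the pre-Lie signs turn the sum over the slots into
  the contraction of an alternating function by \<open>dy\<close> (\<open>field_slots\<close>, \<open>cocycle_slots\<close>), which is
  again alternating, so that the sum over all lists can be carried out
  (\<open>sum_pre_lie_coeff_contraction\<close>). Comparing repeated directions with those of \<open>\<Lambda>\<^sub>\<alpha>\<close> and \<open>\<Lambda>\<^sub>\<beta>\<close> leaves
  the coefficients of the two sums of the theorem: in the first, \<open>X\<close> and \<open>Y\<close> point along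
  \<open>V\<^sup>g\<close>; in the second, \<open>Y\<close> supplies exactly the direction \<open>q\<close> of \<open>N\<^sup>\<alpha>\<close> that \<open>y\<close> has taken from \<open>\<Lambda>\<^sub>\<alpha>\<close>.

  As to the subspaces, the coordinates separate points (\<open>coord_injective\<close>), and \<open>N\<^sup>g\<close> is the kernel of the
  average over the powers of \<open>g\<close> (\<open>normal_sub_kernel\<close>, by Maschke's argument). Hence \<open>V\<^sup>g\<close> and \<open>N\<^sup>g\<close> are
  the common zero sets of complementary sets of coordinates, \<open>l(g)\<close> counts the coordinates with
  nontrivial weight (\<open>codim_eq\<close>), and all statements about subspaces become statements about index
  sets (\<open>direct_sum_coords\<close>).
\<close>

section \<open>Alternating functions of index lists\<close>

text \<open>
  Antisymmetry is only required for adjacent entries. In this local form it passes at once to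
  functions of a part of a list (\<open>alternating_context\<close>) and to contractions, and it
  implies the sign rule for all permutations (\<open>alternating_permute\<close>).
\<close>

definition alternating :: "(nat list \<Rightarrow> complex) \<Rightarrow> bool" where
  "alternating F \<longleftrightarrow> (\<forall>xs a b zs. F (xs @ a # b # zs) = - F (xs @ b # a # zs))"

lemma alternatingD: "alternating F \<Longrightarrow> F (xs @ a # b # zs) = - F (xs @ b # a # zs)"
  unfolding alternating_def by blast

lemma alternating_context: "alternating F \<Longrightarrow> alternating (\<lambda>vs. F (us @ vs @ ws))"
  unfolding alternating_def by (metis append.assoc append_Cons)

lemma permute_list_adjacent:
  assumes "Suc j < length is"
  shows "permute_list (Transposition.transpose j (Suc j)) is =
           take j is @ is ! Suc j # is ! j # drop (Suc (Suc j)) is"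
  using assms
  by (intro nth_equalityI)
     (auto simp: permute_list_def nth_append nth_Cons Transposition.transpose_def not_less
           split: nat.splits intro!: arg_cong[where f = "(!) is"])

lemma split_adjacent:
  assumes "Suc j < length is"
  shows "is = take j is @ is ! j # is ! Suc j # drop (Suc (Suc j)) is"
  using assms by (metis Cons_nth_drop_Suc Suc_lessD append_take_drop_id)

text \<open>
  The transposition of \<open>a\<close> and \<open>c + 1\<close> is the conjugate of that of \<open>a\<close> and \<open>c\<close> by the adjacent
  one of \<open>c\<close> and \<open>c + 1\<close>, which contributes two signs that cancel.
\<close>

lemma alternating_transpose:
  assumes F: "alternating F" and "a < b" "b < length is"
  shows "F (permute_list (Transposition.transpose a b) is) = - F is"
  using assms(2,3)
proof (induction "b - a" arbitrary: b "is" rule: less_induct)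
  case less
  show ?case
  proof (cases "b = Suc a")
    case True
    then show ?thesis
      using less.prems alternatingD[OF F] split_adjacent[of a "is"] permute_list_adjacent[of a "is"]
      by metis
  next
    case False
    then obtain c where c: "b = Suc c" "a < c" using less.prems by (cases b) auto
    let ?t = "Transposition.transpose c (Suc c)" and ?s = "Transposition.transpose a c"
    have conj: "Transposition.transpose a b = ?t \<circ> ?s \<circ> ?t"
      using c by (auto simp: Transposition.transpose_def fun_eq_iff)
    have p: "?t permutes {..<length is}" "?s permutes {..<length is}"
      using c less.prems by (auto intro!: permutes_swap_id)
    have adj: "F (permute_list ?t js) = - F js" if "length js = length is" for js
      using that c less.prems alternatingD[OF F] split_adjacent[of c "js"]
        permute_list_adjacent[of c "js"]
      by metis
    have "F (permute_list (Transposition.transpose a b) is)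
        = F (permute_list ?t (permute_list ?s (permute_list ?t is)))"
      unfolding conj using p by (simp add: permute_list_compose)
    also have "\<dots> = - F (permute_list ?s (permute_list ?t is))"
      by (rule adj) simp
    also have "F (permute_list ?s (permute_list ?t is)) = - F (permute_list ?t is)"
      using less.hyps[of c "permute_list ?t is"] c less.prems by simp
    also have "F (permute_list ?t is) = - F is" by (rule adj) simp
    finally show ?thesis by simp
  qed
qed

lemma alternating_permute:
  assumes F: "alternating F" and "\<sigma> permutes {..<length is}"
  shows "F (permute_list \<sigma> is) = of_int (sign \<sigma>) * F is"
proof (rule permutes_rev_induct[OF _ assms(2)])
  fix a b p
  assume *: "a \<in> {..<length is}" "b \<in> {..<length is}" "a \<noteq> b"
    "F (permute_list p is) = of_int (sign p) * F is" "p permutes {..<length is}"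
  let ?t = "Transposition.transpose a b"
  have t: "?t permutes {..<length is}" using * by (intro permutes_swap_id) auto
  have "F (permute_list ?t (permute_list p is)) = - F (permute_list p is)"
    using alternating_transpose[OF F, of a b "permute_list p is"]
      alternating_transpose[OF F, of b a "permute_list p is"] *
    by (metis length_permute_list lessThan_iff linorder_neqE_nat transpose_commute)
  moreover have "sign (p \<circ> ?t) = - sign p"
    using sign_compose[of p ?t] * t
    by (simp add: sign_swap_id permutation_swap_id
          permutation_permutes[THEN iffD2, OF exI, OF conjI, OF finite_lessThan])
  ultimately show "F (permute_list (p \<circ> ?t) is) = of_int (sign (p \<circ> ?t)) * F is"
    using * t by (simp add: permute_list_compose)
qed auto

lemma alternating_repeated:
  assumes F: "alternating F" and "\<not> distinct is"
  shows "F is = 0"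
proof -
  obtain i j where ij: "i < j" "j < length is" "is ! i = is ! j"
    using assms(2) by (metis distinct_conv_nth linorder_neqE_nat)
  have "permute_list (Transposition.transpose i j) is = is"
    using ij by (intro nth_equalityI) (auto simp: permute_list_def Transposition.transpose_def)
  then show ?thesis using alternating_transpose[OF F ij(1,2)] by simp
qed

lemma alternating_move:
  assumes F: "alternating F"
  shows "F (us @ x # ws @ vs) = (-1) ^ length ws * F (us @ ws @ x # vs)"
proof (induction ws arbitrary: us)
  case (Cons w ws)
  have "F (us @ x # (w # ws) @ vs) = - F ((us @ [w]) @ x # ws @ vs)"
    using alternatingD[OF F, of us x w "ws @ vs"] by simp
  then show ?case using Cons.IH[of "us @ [w]"] by simp
qed simp

lemma alternating_move_block:
  assumes F: "alternating F"
  shows "F (us @ xs @ ws @ vs) = (-1) ^ (length xs * length ws) * F (us @ ws @ xs @ vs)"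
proof (induction xs arbitrary: us)
  case (Cons x xs)
  have "F (us @ (x # xs) @ ws @ vs) = (-1) ^ (length xs * length ws) * F (us @ x # ws @ xs @ vs)"
    using Cons.IH[of "us @ [x]"] by simp
  also have "F (us @ x # ws @ xs @ vs) = (-1) ^ length ws * F (us @ ws @ x # xs @ vs)"
    by (rule alternating_move[OF F])
  finally show ?case by (simp add: power_add mult.commute)
qed simp

text \<open>
  If \<open>F\<close> is the coefficient function of a multivector, this is the one of its contraction by the
  covector \<open>u\<close>: the alternating sum over all ways to feed one entry to \<open>u\<close>
  (\<open>contraction_eq_sum\<close>). Recursion from the left makes the antisymmetry a plain induction.
\<close>

fun contraction :: "(nat \<Rightarrow> complex) \<Rightarrow> (nat list \<Rightarrow> complex) \<Rightarrow> nat list \<Rightarrow> complex" where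
  "contraction u F [] = 0"
| "contraction u F (x # xs) = u x * F xs - contraction u (\<lambda>zs. F (x # zs)) xs"

lemma contraction_eq_sum:
  "contraction u F is =
     (\<Sum>i<length is. (-1) ^ i * u (is ! i) * F (take i is @ drop (Suc i) is))"
  by (induction u F "is" rule: contraction.induct)
     (simp_all add: sum.lessThan_Suc_shift sum_negf del: sum.lessThan_Suc)

lemma contraction_minus: "contraction u (\<lambda>zs. - F zs) is = - contraction u F is"
  by (simp add: contraction_eq_sum sum_negf)

text \<open>
  When the swapped entries come first, the two terms that feed one of them to \<open>u\<close> are exchanged up to
  sign, and in the remaining ones both entries still stand in front of the argument of \<open>F\<close>.
\<close>

lemma contraction_swap:
  assumes "alternating F"
  shows "contraction u F (xs @ a # b # zs) = - contraction u F (xs @ b # a # zs)"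
  using assms
proof (induction xs arbitrary: F)
  case Nil
  have "(\<lambda>zs. F (a # b # zs)) = (\<lambda>zs. - F (b # a # zs))"
    using alternatingD[OF Nil, of "[]" a b] by (intro ext) simp
  then have "contraction u (\<lambda>zs. F (a # b # zs)) zs = - contraction u (\<lambda>zs. F (b # a # zs)) zs"
    by (simp only: contraction_minus)
  then show ?case by simp
next
  case (Cons x xs)
  have "alternating (\<lambda>zs. F (x # zs))"
    using alternating_context[OF Cons.prems, of "[x]" "[]"] by simp
  from Cons.IH[OF this] show ?case
    using alternatingD[OF Cons.prems, of xs a b zs] by simp
qed

lemma alternating_contraction: "alternating F \<Longrightarrow> alternating (contraction u F)"
  unfolding alternating_def[of "contraction u F"] using contraction_swap by blast

lemma permute_list_inv_iff:
  assumes "\<sigma> permutes {..<length xs}" "length zs = length xs"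
  shows "permute_list \<sigma> xs = zs \<longleftrightarrow> xs = permute_list (inv_into UNIV \<sigma>) zs"
proof -
  have i: "inv_into UNIV \<sigma> permutes {..<length xs}" using assms(1) by (rule permutes_inv)
  have "permute_list (inv_into UNIV \<sigma>) (permute_list \<sigma> xs) = xs"
    using permute_list_compose[OF i, of \<sigma>] assms(1) by (simp add: permutes_inv_o)
  moreover have "permute_list \<sigma> (permute_list (inv_into UNIV \<sigma>) zs) = zs"
    using permute_list_compose[of \<sigma> zs "inv_into UNIV \<sigma>"] assms by (simp add: permutes_inv_o)
  ultimately show ?thesis by metis
qed

lemma prod_permuted_nth:
  assumes "\<sigma> permutes {..<length xs}" "distinct xs"
  shows "(\<Prod>j<length xs. w (xs ! \<sigma> j)) = (\<Prod>i\<in>set xs. w i)"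
proof -
  have "(\<Prod>j<length xs. w (xs ! \<sigma> j)) = (\<Prod>j<length xs. w (xs ! j))"
    using prod.permute[OF assms(1), of "\<lambda>j. w (xs ! j)"] by (simp add: o_def)
  also have "\<dots> = (\<Prod>i\<in>set xs. w i)"
    using prod.distinct_set_conv_list[OF assms(2), of w]
      prod.list_conv_set_nth[of "map w xs"] by (simp add: atLeast0LessThan)
  finally show ?thesis .
qed

section \<open>The wedge product of coordinate directions\<close>

lemma wedge_permute_list:
  "wedge is T = (\<Sum>\<sigma> | \<sigma> permutes {..<length is}.
     if finite T \<and> permute_list \<sigma> is = sorted_list_of_set T then of_int (sign \<sigma>) else 0)"
  unfolding wedge_def permute_list_def ..

lemma wedge_permute:
  assumes \<tau>: "\<tau> permutes {..<length is}"
  shows "wedge (permute_list \<tau> is) T = of_int (sign \<tau>) * wedge is T"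
proof -
  have perm: "permutation p" if "p permutes {..<length is}" for p
    using that permutation_permutes by blast
  have "of_int (sign \<tau>) * wedge is T = (\<Sum>\<sigma> | \<sigma> permutes {..<length is}. of_int (sign \<tau>) *
     (if finite T \<and> permute_list (\<tau> \<circ> \<sigma>) is = sorted_list_of_set T then of_int (sign (\<tau> \<circ> \<sigma>)) else 0))"
    unfolding wedge_permute_list sum_distrib_left
    by (rule setum_permutations_compose_left[OF \<tau>])
  also have "\<dots> = wedge (permute_list \<tau> is) T"
    unfolding wedge_permute_list length_permute_list
    using \<tau> by (intro sum.cong refl)
      (auto simp: permute_list_compose sign_compose perm simp flip: of_int_mult)
  finally show ?thesis by simp
qed

lemma alternating_wedge: "alternating (\<lambda>is. wedge is T)"
  unfolding alternating_def
proof (intro allI)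
  fix xs :: "nat list" and a b zs
  let ?is = "xs @ b # a # zs" and ?t = "Transposition.transpose (length xs) (Suc (length xs))"
  have "permute_list ?t ?is = xs @ a # b # zs"
    by (subst permute_list_adjacent) (auto simp: nth_append)
  moreover have "?t permutes {..<length ?is}" by (intro permutes_swap_id) auto
  ultimately show "wedge (xs @ a # b # zs) T = - wedge ?is T"
    using wedge_permute[of ?t ?is T] by (simp add: sign_swap_id)
qed

lemma wedge_nonzeroD:
  assumes "wedge is T \<noteq> 0"
  shows "finite T" "distinct is" "set is = T"
proof -
  obtain \<sigma> where "\<sigma> permutes {..<length is}" "finite T" "permute_list \<sigma> is = sorted_list_of_set T"
    using assms unfolding wedge_permute_list
    by (elim sum.not_neutral_contains_not_neutral) (auto split: if_splits)
  then show "finite T" "distinct is" "set is = T"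
    using distinct_permute_list[of \<sigma> "is"] set_permute_list[of \<sigma> "is"] by auto
qed

lemma permute_list_inj:
  assumes "distinct is" "\<sigma> permutes {..<length is}" "permute_list \<sigma> is = is"
  shows "\<sigma> = id"
proof
  fix i
  show "\<sigma> i = id i"
  proof (cases "i < length is")
    case True
    then have "is ! \<sigma> i = is ! i" using permute_list_nth[OF assms(2) True] assms(3) by simp
    then show ?thesis
      using True assms permutes_in_image[OF assms(2), of i] by (simp add: nth_eq_iff_index_eq)
  qed (use assms(2) in \<open>auto simp: permutes_def\<close>)
qed

lemma wedge_sorted: "finite T \<Longrightarrow> wedge (sorted_list_of_set T) T = 1"
proof -
  assume T: "finite T"
  let ?E = "sorted_list_of_set T"
  have "wedge ?E T = (\<Sum>\<sigma> | \<sigma> permutes {..<length ?E}. if \<sigma> = id then 1 else 0)"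
    unfolding wedge_permute_list
    using T permute_list_inj[of ?E] by (intro sum.cong refl) auto
  also have "\<dots> = 1"
    by (subst sum.delta) (auto simp: finite_permutations permutes_id)
  finally show ?thesis .
qed

lemma wedge_sorted_eq:
  "finite J \<Longrightarrow> wedge (sorted_list_of_set J) T = (if T = J then 1 else 0)"
  using wedge_sorted[of J] wedge_nonzeroD(3)[of "sorted_list_of_set J" T] by auto

text \<open>
  The only permutation that contributes to the wedge product of distinct directions, with its sign.
\<close>

lemma sorting_permutation:
  assumes "distinct vs"
  obtains p where "p permutes {..<length vs}" "permute_list p vs = sorted_list_of_set (set vs)"
    "of_int (sign p) * wedge vs (set vs) = 1"
proof -
  have "mset (sorted_list_of_set (set vs)) = mset vs"
    using assms by (simp add: set_eq_iff_mset_eq_distinct[symmetric])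
  then obtain p where p: "p permutes {..<length vs}" "permute_list p vs = sorted_list_of_set (set vs)"
    by (metis mset_eq_permutation)
  moreover have "of_int (sign p) * wedge vs (set vs) = 1"
    using wedge_permute[OF p(1), of "set vs"] p(2) by (simp add: wedge_sorted)
  ultimately show thesis by (rule that)
qed

lemma wedge_distinct_nonzero: "distinct vs \<Longrightarrow> wedge vs (set vs) \<noteq> 0"
  by (metis sorting_permutation mult_zero_right zero_neq_one)

lemma wedge_times_sorted:
  assumes F: "alternating F" and "distinct vs"
  shows "wedge vs (set vs) * F (sorted_list_of_set (set vs)) = F vs"
proof -
  obtain p where p: "p permutes {..<length vs}" "permute_list p vs = sorted_list_of_set (set vs)"
    "of_int (sign p) * wedge vs (set vs) = 1"
    using sorting_permutation[OF assms(2)] by metis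
  have "F (sorted_list_of_set (set vs)) = of_int (sign p) * F vs"
    using alternating_permute[OF F p(1)] p(2) by simp
  then show ?thesis using p(3) by (simp add: algebra_simps)
qed

definition index_lists :: "nat set \<Rightarrow> nat \<Rightarrow> nat list set" where
  "index_lists A m = {xs. set xs \<subseteq> A \<and> length xs = m}"

lemma finite_index_lists [simp]: "finite A \<Longrightarrow> finite (index_lists A m)"
  unfolding index_lists_def by (rule finite_lists_length_eq)

lemma sum_index_lists_append:
  "(\<Sum>xs\<in>index_lists A (a + b). f xs) =
     (\<Sum>us\<in>index_lists A a. \<Sum>vs\<in>index_lists A b. f (us @ vs))"
proof -
  have "(\<Sum>us\<in>index_lists A a. \<Sum>vs\<in>index_lists A b. f (us @ vs)) =
      (\<Sum>(us, vs)\<in>index_lists A a \<times> index_lists A b. f (us @ vs))"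
    by (rule sum.cartesian_product)
  also have "\<dots> = (\<Sum>xs\<in>index_lists A (a + b). f xs)"
    by (rule sum.reindex_bij_witness[where i = "\<lambda>xs. (take a xs, drop a xs)"
          and j = "\<lambda>(us, vs). us @ vs"])
       (auto simp: index_lists_def dest: in_set_takeD in_set_dropD)
  finally show ?thesis by simp
qed

lemma sum_index_lists_1: "(\<Sum>xs\<in>index_lists A (Suc 0). f xs) = (\<Sum>e\<in>A. f [e])"
  by (rule sum.reindex_bij_witness[where i = "\<lambda>e. [e]" and j = hd])
     (auto simp: index_lists_def length_Suc_conv)

text \<open>
  A sum over lists with a distinguished entry, as it arises when one argument of a cochain is
  the nonlinear one.
\<close>

lemma sum_index_lists_split:
  assumes "i < m"
  shows "(\<Sum>us\<in>index_lists A i. \<Sum>ws\<in>index_lists A (m - Suc i). \<Sum>e\<in>A. f us e ws) =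
     (\<Sum>is\<in>index_lists A m. f (take i is) (is ! i) (drop (Suc i) is))"
proof -
  let ?g = "\<lambda>is. f (take i is) (is ! i) (drop (Suc i) is)"
  have "m = i + (Suc 0 + (m - Suc i))" using assms by simp
  then have "(\<Sum>is\<in>index_lists A m. ?g is) = (\<Sum>is\<in>index_lists A (i + (Suc 0 + (m - Suc i))). ?g is)"
    by (rule arg_cong)
  also have "\<dots> = (\<Sum>us\<in>index_lists A i. \<Sum>e\<in>A. \<Sum>ws\<in>index_lists A (m - Suc i). ?g (us @ [e] @ ws))"
    unfolding sum_index_lists_append sum_index_lists_1 ..
  also have "\<dots> = (\<Sum>us\<in>index_lists A i. \<Sum>e\<in>A. \<Sum>ws\<in>index_lists A (m - Suc i). f us e ws)"
    by (intro sum.cong refl) (auto simp: index_lists_def nth_append)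
  also have "\<dots> = (\<Sum>us\<in>index_lists A i. \<Sum>ws\<in>index_lists A (m - Suc i). \<Sum>e\<in>A. f us e ws)"
    by (intro sum.cong refl sum.swap)
  finally show ?thesis by simp
qed

text \<open>
  Reading off the components of a wedge product and evaluating an alternating function on the basis
  multivectors are inverse to each other. Only \<open>J = set vs\<close> contributes.
\<close>

lemma sum_sets_wedge:
  assumes F: "alternating F" and A: "finite A" and vs: "vs \<in> index_lists A m"
  shows "(\<Sum>J | J \<subseteq> A \<and> card J = m. wedge vs J * F (sorted_list_of_set J)) = F vs"
proof -
  have "(\<Sum>J | J \<subseteq> A \<and> card J = m. wedge vs J * F (sorted_list_of_set J)) =
    (\<Sum>J | J \<subseteq> A \<and> card J = m. if J = set vs then F vs else 0)"
  proof (intro sum.cong refl)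
    fix J
    show "wedge vs J * F (sorted_list_of_set J) = (if J = set vs then F vs else 0)"
    proof (cases "J = set vs")
      case True
      then show ?thesis
        by (cases "distinct vs") (auto simp: wedge_times_sorted[OF F] alternating_repeated[OF F]
              alternating_repeated[OF alternating_wedge])
    qed (use wedge_nonzeroD(3) in auto)
  qed
  also have "\<dots> = F vs"
    using A vs alternating_repeated[OF F, of vs] distinct_card[of vs]
    by (subst sum.delta) (auto simp: index_lists_def)
  finally show ?thesis .
qed

text \<open>
  The lists that contribute are the \<open>m!\<close> arrangements of \<open>J\<close>, and on each of them the sign of the
  wedge product cancels the one of \<open>F\<close>.
\<close>

lemma sum_lists_wedge:
  assumes F: "alternating F" and A: "finite A" and J: "J \<subseteq> A" "card J = m"
  shows "(\<Sum>vs\<in>index_lists A m. wedge vs J * F vs) = fact m * F (sorted_list_of_set J)"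
proof -
  let ?E = "sorted_list_of_set J"
  have fin: "finite J" using J A finite_subset by blast
  have E: "length ?E = m" "set ?E = J" using J fin by auto
  have "(\<Sum>vs\<in>index_lists A m. wedge vs J * F vs) =
     (\<Sum>vs\<in>index_lists A m. \<Sum>\<sigma> | \<sigma> permutes {..<m}.
        if permute_list \<sigma> vs = ?E then of_int (sign \<sigma>) * F vs else 0)"
    unfolding wedge_permute_list sum_distrib_right
    using fin by (intro sum.cong refl) (auto simp: index_lists_def)
  also have "\<dots> = (\<Sum>\<sigma> | \<sigma> permutes {..<m}. \<Sum>vs\<in>index_lists A m.
        if permute_list \<sigma> vs = ?E then of_int (sign \<sigma>) * F vs else 0)"
    by (rule sum.swap)
  also have "\<dots> = (\<Sum>\<sigma> | \<sigma> permutes {..<m}. F ?E)"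
  proof (intro sum.cong refl)
    fix \<sigma> assume "\<sigma> \<in> {\<sigma>. \<sigma> permutes {..<m}}"
    then have \<sigma>: "\<sigma> permutes {..<m}" by simp
    then have inv: "inv_into UNIV \<sigma> permutes {..<m}" by (rule permutes_inv)
    define v where "v = permute_list (inv_into UNIV \<sigma>) ?E"
    have iff: "permute_list \<sigma> vs = ?E \<longleftrightarrow> vs = v" if "length vs = m" for vs
      using permute_list_inv_iff[of \<sigma> vs ?E] \<sigma> E(1) that unfolding v_def by simp
    have vA: "v \<in> index_lists A m"
      using inv E J unfolding v_def by (simp add: index_lists_def)
    then have v: "permute_list \<sigma> v = ?E" using iff by (simp add: index_lists_def)
    have "(\<Sum>vs\<in>index_lists A m. if permute_list \<sigma> vs = ?E then of_int (sign \<sigma>) * F vs else 0)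
        = (\<Sum>vs\<in>index_lists A m. if vs = v then of_int (sign \<sigma>) * F v else 0)"
      by (intro sum.cong refl) (auto simp: iff index_lists_def)
    also have "\<dots> = of_int (sign \<sigma>) * F v" using A vA by simp
    also have "\<dots> = F ?E"
    proof -
      have "F ?E = of_int (sign \<sigma>) * F v"
        using alternating_permute[OF F, of \<sigma> v] \<sigma> vA v by (simp add: index_lists_def)
      then show ?thesis by simp
    qed
    finally show "(\<Sum>vs\<in>index_lists A m. if permute_list \<sigma> vs = ?E then of_int (sign \<sigma>) * F vs else 0) = F ?E" .
  qed
  also have "\<dots> = fact m * F ?E" by (simp add: card_permutations[of "{..<m}" m])
  finally show ?thesis .
qed

text \<open>
  Both the multivector field and the cocycle are antisymmetrized products of directional
  derivatives, or difference quotients, in the directions of a fixed set \<open>I\<close>. On coordinate functions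
  the matrix of these derivatives has unit rows, and its determinant is a component of the wedge
  product.
\<close>

lemma det_coordinates:
  assumes I: "finite I" "card I = length is"
    and M: "\<And>j e. j < length is \<Longrightarrow> e \<in> I \<Longrightarrow> M j e = (if e = is ! j then 1 else 0)"
  shows "(\<Sum>\<sigma> | \<sigma> permutes {..<length is}. of_int (sign \<sigma>) *
           (\<Prod>j<length is. M j (sorted_list_of_set I ! \<sigma> j))) = wedge is I"
proof -
  let ?m = "length is" and ?E = "sorted_list_of_set I"
  have E: "length ?E = ?m" "set ?E = I" using I by auto
  have "(\<Sum>\<sigma> | \<sigma> permutes {..<?m}. of_int (sign \<sigma>) * (\<Prod>j<?m. M j (?E ! \<sigma> j))) =
        (\<Sum>\<sigma> | \<sigma> permutes {..<?m}. if permute_list (inv_into UNIV \<sigma>) is = ?E then of_int (sign (inv_into UNIV \<sigma>)) else 0)"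
  proof (intro sum.cong refl)
    fix \<sigma> assume "\<sigma> \<in> {\<sigma>. \<sigma> permutes {..<?m}}"
    then have \<sigma>: "\<sigma> permutes {..<?m}" by simp
    have c: "\<sigma> permutes {..<length ?E}" "length is = length ?E" using \<sigma> E(1) by auto
    have perm: "permutation \<sigma>" using \<sigma> permutation_permutes by blast
    have inI: "?E ! \<sigma> j \<in> I" if "j < ?m" for j
      using that permutes_in_image[OF \<sigma>, of j] E by (metis lessThan_iff nth_mem)
    have "(\<Prod>j<?m. M j (?E ! \<sigma> j)) = (\<Prod>j<?m. if ?E ! \<sigma> j = is ! j then 1 else 0)"
      using inI by (intro prod.cong refl) (auto simp: M)
    also have "\<dots> = (if \<forall>j<?m. ?E ! \<sigma> j = is ! j then 1 else 0)"
      by (auto intro!: prod_zero)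
    also have "(\<forall>j<?m. ?E ! \<sigma> j = is ! j) \<longleftrightarrow> permute_list \<sigma> ?E = is"
      using E \<sigma> by (auto simp: list_eq_iff_nth_eq permute_list_nth)
    also have "\<dots> \<longleftrightarrow> permute_list (inv_into UNIV \<sigma>) is = ?E"
      using permute_list_inv_iff[OF c] by (rule trans) (rule eq_commute)
    finally show "of_int (sign \<sigma>) * (\<Prod>j<?m. M j (?E ! \<sigma> j)) =
        (if permute_list (inv_into UNIV \<sigma>) is = ?E then of_int (sign (inv_into UNIV \<sigma>)) else 0)"
      by (simp add: sign_inverse[OF perm])
  qed
  also have "\<dots> = wedge is I"
    unfolding wedge_permute_list using I
    by (subst sum_permutations_inverse) (auto intro!: sum.cong simp: permutes_inv_inv)
  finally show ?thesis .
qed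

text \<open>
  Expansion of the determinant by linearity in row \<open>k\<close>, the one that need not be a unit row.
\<close>

lemma det_slot:
  assumes I: "finite I" "card I = length is" and k: "k < length is"
    and M: "\<And>j e. j < length is \<Longrightarrow> j \<noteq> k \<Longrightarrow> e \<in> I \<Longrightarrow> M j e = (if e = is ! j then 1 else 0)"
  shows "(\<Sum>\<sigma> | \<sigma> permutes {..<length is}. of_int (sign \<sigma>) *
           (\<Prod>j<length is. M j (sorted_list_of_set I ! \<sigma> j))) =
         (\<Sum>e\<in>I. M k e * wedge (is[k := e]) I)"
proof -
  let ?m = "length is" and ?E = "sorted_list_of_set I"
  have E: "length ?E = ?m" "set ?E = I" using I by auto
  define N where "N = (\<lambda>e j x. if j = k then (if x = e then 1 else 0) else M j x)"
  have N: "N e j x = (if x = is[k := e] ! j then 1 else 0)" if "j < ?m" "x \<in> I" for e j x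
    using that M k by (auto simp: N_def nth_list_update)
  have "(\<Sum>\<sigma> | \<sigma> permutes {..<?m}. of_int (sign \<sigma>) * (\<Prod>j<?m. M j (?E ! \<sigma> j))) =
     (\<Sum>\<sigma> | \<sigma> permutes {..<?m}. \<Sum>e\<in>I. M k e * (of_int (sign \<sigma>) * (\<Prod>j<?m. N e j (?E ! \<sigma> j))))"
  proof (intro sum.cong refl)
    fix \<sigma> assume "\<sigma> \<in> {\<sigma>. \<sigma> permutes {..<?m}}"
    then have \<sigma>: "\<sigma> permutes {..<?m}" by simp
    let ?R = "\<Prod>j\<in>{..<?m} - {k}. M j (?E ! \<sigma> j)"
    have in_I: "?E ! \<sigma> k \<in> I"
      using k permutes_in_image[OF \<sigma>, of k] E by (metis lessThan_iff nth_mem)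
    have split: "(\<Prod>j<?m. h j) = h k * (\<Prod>j\<in>{..<?m} - {k}. h j)" for h :: "nat \<Rightarrow> complex"
      using k by (intro prod.remove) auto
    have Np: "(\<Prod>j<?m. N e j (?E ! \<sigma> j)) = (if ?E ! \<sigma> k = e then ?R else 0)" for e
      by (subst split) (simp add: N_def)
    have "(\<Sum>e\<in>I. M k e * (of_int (sign \<sigma>) * (\<Prod>j<?m. N e j (?E ! \<sigma> j)))) =
        (\<Sum>e\<in>I. if ?E ! \<sigma> k = e then M k e * (of_int (sign \<sigma>) * ?R) else 0)"
      unfolding Np by (intro sum.cong refl) auto
    also have "\<dots> = M k (?E ! \<sigma> k) * (of_int (sign \<sigma>) * ?R)"
      using in_I I by simp
    finally show "of_int (sign \<sigma>) * (\<Prod>j<?m. M j (?E ! \<sigma> j)) =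
        (\<Sum>e\<in>I. M k e * (of_int (sign \<sigma>) * (\<Prod>j<?m. N e j (?E ! \<sigma> j))))"
      by (subst split) (simp add: mult_ac)
  qed
  also have "\<dots> = (\<Sum>e\<in>I. M k e * (\<Sum>\<sigma> | \<sigma> permutes {..<?m}.
      of_int (sign \<sigma>) * (\<Prod>j<?m. N e j (?E ! \<sigma> j))))"
    by (subst sum.swap) (simp add: sum_distrib_left)
  also have "\<dots> = (\<Sum>e\<in>I. M k e * wedge (is[k := e]) I)"
  proof (intro sum.cong refl arg_cong2[where f = "(*)"])
    fix e assume "e \<in> I"
    show "(\<Sum>\<sigma> | \<sigma> permutes {..<?m}. of_int (sign \<sigma>) * (\<Prod>j<?m. N e j (?E ! \<sigma> j))) =
        wedge (is[k := e]) I"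
      using I k det_coordinates[of I "is[k := e]" "N e"]
        N[of _ _ e] by simp
  qed
  finally show ?thesis .
qed

section \<open>Derivatives and difference quotients of polynomial functions\<close>

lemma polys_mono: "f \<in> polys I \<Longrightarrow> I \<subseteq> J \<Longrightarrow> f \<in> polys J"
  by (induction rule: polys.induct) (auto intro: polys.intros)

lemma polys_cong: "f \<in> polys I \<Longrightarrow> (\<And>i. i \<in> I \<Longrightarrow> p i = q i) \<Longrightarrow> f p = f q"
  by (induction rule: polys.induct) auto

lemma polys_cmult: "f \<in> polys I \<Longrightarrow> (\<lambda>p. c * f p) \<in> polys I"
  by (intro polys.intros)

lemma polys_sum: "(\<And>t. t \<in> Q \<Longrightarrow> f t \<in> polys I) \<Longrightarrow> (\<lambda>p. \<Sum>t\<in>Q. f t p) \<in> polys I"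
  by (induction Q rule: infinite_finite_induct) (auto intro: polys.intros)

lemma polys_prod: "(\<And>t. t \<in> Q \<Longrightarrow> f t \<in> polys I) \<Longrightarrow> (\<lambda>p. \<Prod>t\<in>Q. f t p) \<in> polys I"
  by (induction Q rule: infinite_finite_induct) (auto intro: polys.intros)

lemma polys_scale: "f \<in> polys I \<Longrightarrow> (\<lambda>p. f (\<lambda>j. d j * p j)) \<in> polys I"
  by (induction rule: polys.induct) (auto intro: polys.intros)

lemma polys_upd: "f \<in> polys I \<Longrightarrow> (\<lambda>p. f (p(i := c * p i))) \<in> polys I"
proof -
  assume "f \<in> polys I"
  then have "(\<lambda>p. f (\<lambda>j. (if j = i then c else 1) * p j)) \<in> polys I" by (rule polys_scale)
  also have "(\<lambda>p. f (\<lambda>j. (if j = i then c else 1) * p j)) = (\<lambda>p. f (p(i := c * p i)))"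
    by (intro ext arg_cong[where f = f]) auto
  finally show ?thesis .
qed

lemma polys_affine: "i \<in> I \<Longrightarrow> (\<lambda>q. c * q i - d) \<in> polys I"
  using polys.add[OF polys_cmult[OF polys.coordinate] polys.const, of i I c "- d"] by simp

lemma polys_differentiable:
  "f \<in> polys I \<Longrightarrow> (\<lambda>t. f (p(i := t))) field_differentiable at s"
proof (induction rule: polys.induct)
  case (coordinate j)
  show ?case by (cases "j = i") auto
qed (auto intro: field_differentiable_add field_differentiable_mult)

lemma partial_const: "partial i (\<lambda>p. c) = (\<lambda>p. 0)"
  by (simp add: partial_def fun_eq_iff)

lemma partial_coordinate: "partial i (\<lambda>p. p j) = (\<lambda>p. if i = j then 1 else 0)"
  by (auto simp: partial_def fun_eq_iff)

lemma partial_add: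
  assumes "f \<in> polys I" "h \<in> polys J"
  shows "partial i (\<lambda>p. f p + h p) = (\<lambda>p. partial i f p + partial i h p)"
  using assms by (simp add: partial_def polys_differentiable fun_eq_iff)

lemma partial_mult:
  assumes "f \<in> polys I" "h \<in> polys J"
  shows "partial i (\<lambda>p. f p * h p) = (\<lambda>p. f p * partial i h p + partial i f p * h p)"
  using assms by (simp add: partial_def polys_differentiable fun_eq_iff)

lemma partial_affine: "partial i (\<lambda>q. c * q j - d) p = (if i = j then c else 0)"
proof -
  have "partial i (\<lambda>q. (\<lambda>q. c) q * q j + (\<lambda>q. - d) q) p =
      partial i (\<lambda>q. (\<lambda>q. c) q * q j) p + partial i (\<lambda>q. - d) p"
    by (subst partial_add[where I = "{j}" and J = "{j}"]) (auto intro: polys.intros)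
  also have "partial i (\<lambda>q. (\<lambda>q. c) q * q j) p = (if i = j then c else 0)"
    by (subst partial_mult[where I = "{j}" and J = "{j}"])
       (auto intro: polys.intros simp: partial_const partial_coordinate)
  finally show ?thesis by (simp add: partial_const)
qed

lemma polys_partial: "f \<in> polys I \<Longrightarrow> partial i f \<in> polys I"
proof (induction rule: polys.induct)
  case (coordinate j)
  show ?case unfolding partial_coordinate by (rule polys.const)
qed (simp_all add: partial_const partial_add partial_mult polys.intros)

lemma partial_not_in: "f \<in> polys I \<Longrightarrow> i \<notin> I \<Longrightarrow> partial i f p = 0"
  by (induction rule: polys.induct)
     (auto simp: partial_const partial_coordinate partial_add partial_mult)

lemma partial_sum:
  assumes "finite Q" "\<And>t. t \<in> Q \<Longrightarrow> f t \<in> polys I"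
  shows "partial i (\<lambda>p. \<Sum>t\<in>Q. c t * f t p) p = (\<Sum>t\<in>Q. c t * partial i (f t) p)"
  using assms
proof (induction Q)
  case (insert x Q)
  have 1: "(\<lambda>p. c x * f x p) \<in> polys I" using insert.prems by (auto intro: polys_cmult)
  have 2: "(\<lambda>p. \<Sum>t\<in>Q. c t * f t p) \<in> polys I"
    using insert.prems by (auto intro!: polys_cmult polys_sum)
  have 3: "partial i (\<lambda>p. (\<lambda>p. c x) p * f x p) p = c x * partial i (f x) p"
    using insert.prems by (subst partial_mult[where I = I and J = I])
      (auto intro: polys.intros simp: partial_const)
  show ?case using insert partial_add[OF 1 2] 3 by simp
qed (simp add: partial_const)

lemma partial_scale:
  "f \<in> polys I \<Longrightarrow>
     partial i (\<lambda>p. f (\<lambda>j. d j * p j)) p = d i * partial i f (\<lambda>j. d j * p j)"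
proof (induction rule: polys.induct)
  case (coordinate j)
  show ?case using partial_affine[of i "d j" j 0 p] by (simp add: partial_coordinate)
next
  case (add f h)
  then show ?case
    using partial_add[OF polys_scale[OF add.hyps(1)] polys_scale[OF add.hyps(2)], of i d d]
    by (simp add: partial_add algebra_simps)
next
  case (mult f h)
  then show ?case
    using partial_mult[OF polys_scale[OF mult.hyps(1)] polys_scale[OF mult.hyps(2)], of i d d]
    by (simp add: partial_mult algebra_simps)
qed (simp add: partial_const)

text \<open>
  The value at \<open>p i = 0\<close>, where numerator and denominator vanish, is the one that makes the quotient of
  a polynomial again a polynomial (\<open>polys_difference_quotient\<close>); the factor \<open>1 - c\<close> of the
  denominator cancels there.
\<close>

definition difference_quotient :: "complex \<Rightarrow> nat \<Rightarrow> pfun \<Rightarrow> pfun" where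
  "difference_quotient c i f p =
     (if p i = 0 then partial i f p else (f p - f (p(i := c * p i))) / (p i - c * p i))"

lemma difference_quotient_const [simp]: "difference_quotient c i (\<lambda>p. d) = (\<lambda>p. 0)"
  by (auto simp: difference_quotient_def partial_const)

lemma difference_quotient_affine:
  "c \<noteq> 1 \<Longrightarrow> difference_quotient c i (\<lambda>q. a * q j - d) = (\<lambda>p. if i = j then a else 0)"
  by (auto simp: difference_quotient_def partial_affine fun_eq_iff divide_simps)
     (simp_all add: algebra_simps)

lemma difference_quotient_add:
  assumes "f \<in> polys I" "h \<in> polys I"
  shows "difference_quotient c i (\<lambda>p. f p + h p) =
     (\<lambda>p. difference_quotient c i f p + difference_quotient c i h p)"
  using assms
  by (auto simp: difference_quotient_def partial_add fun_eq_iff add_divide_distrib diff_divide_distrib)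

lemma difference_quotient_mult:
  assumes "f \<in> polys I" "h \<in> polys I"
  shows "difference_quotient c i (\<lambda>p. f p * h p) =
     (\<lambda>p. f p * difference_quotient c i h p + difference_quotient c i f p * h (p(i := c * p i)))"
proof
  fix p :: point
  have "p(i := 0) = p" if "p i = 0" using that by auto
  moreover have "(f p * h p - f' * h') / D = f p * ((h p - h') / D) + (f p - f') / D * h'"
    for f' h' D
    by (simp add: diff_divide_distrib algebra_simps)
  ultimately show "difference_quotient c i (\<lambda>p. f p * h p) p =
      f p * difference_quotient c i h p + difference_quotient c i f p * h (p(i := c * p i))"
    using assms by (auto simp: difference_quotient_def partial_mult)
qed

lemma polys_difference_quotient:
  "f \<in> polys I \<Longrightarrow> c \<noteq> 1 \<Longrightarrow> difference_quotient c i f \<in> polys I"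
proof (induction rule: polys.induct)
  case (coordinate j)
  show ?case using difference_quotient_affine[OF coordinate(2), of i 1 j 0]
    by (simp add: polys.const)
next
  case (mult f h)
  then show ?case
    by (subst difference_quotient_mult[where I = I]) (auto intro!: polys.intros polys_upd)
qed (auto simp: difference_quotient_add intro: polys.intros)

lemma difference_quotient_times:
  "difference_quotient c i f p * (p i - c * p i) = f p - f (p(i := c * p i))" if "c \<noteq> 1"
proof (cases "p i = 0")
  case True
  then have "p(i := 0) = p" by auto
  then show ?thesis using True by simp
next
  case False
  then have "p i - c * p i \<noteq> 0" using that by (simp add: algebra_simps)
  then show ?thesis using False by (simp add: difference_quotient_def)
qed

lemma difference_quotient_not_in:
  assumes "f \<in> polys I" "i \<notin> I"
  shows "difference_quotient c i f p = 0"
proof -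
  have "f (p(i := c * p i)) = f p" using assms by (intro polys_cong[OF assms(1)]) auto
  then show ?thesis using partial_not_in[OF assms] by (simp add: difference_quotient_def)
qed

lemma difference_quotient_sum:
  assumes "finite Q" "\<And>t. t \<in> Q \<Longrightarrow> f t \<in> polys I"
  shows "difference_quotient c i (\<lambda>p. \<Sum>t\<in>Q. k t * f t p) p =
    (\<Sum>t\<in>Q. k t * difference_quotient c i (f t) p)"
  unfolding difference_quotient_def
  using partial_sum[OF assms]
  by (auto simp: sum_subtractf[symmetric] sum_divide_distrib right_diff_distrib diff_divide_distrib)

lemma difference_quotient_scale:
  assumes "f \<in> polys I" "d i \<noteq> 0"
  shows "difference_quotient c i (\<lambda>p. f (\<lambda>j. d j * p j)) p =
    d i * difference_quotient c i f (\<lambda>j. d j * p j)"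
proof (cases "p i = 0")
  case True
  then show ?thesis using partial_scale[OF assms(1)] by (simp add: difference_quotient_def)
next
  case False
  have *: "(\<lambda>j. d j * (p(i := c * p i)) j) = (\<lambda>j. d j * p j)(i := c * (d i * p i))"
    by auto
  have "(x / (p i - c * p i)) = d i * (x / (d i * p i - c * (d i * p i)))" for x
    using assms(2) by (simp add: divide_simps) (simp add: algebra_simps)
  then show ?thesis using False assms(2) unfolding difference_quotient_def * by simp
qed

lemma polys_isCont_shift: "f \<in> polys I \<Longrightarrow> isCont (\<lambda>t. f (\<lambda>i. p i + t)) s"
  by (induction rule: polys.induct) (auto intro!: continuous_intros)

text \<open>
  The product of linear forms vanishes only on finitely many points of any translate of the
  diagonal direction, so continuity along that direction allows it to be cancelled.
\<close>

lemma polys_cancel: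
  fixes a :: nat
  assumes q: "q \<in> polys I" "r \<in> polys I" and c: "\<And>j. j < a \<Longrightarrow> c j \<noteq> 1"
    and eq: "\<And>p. q p * (\<Prod>j<a. p (y j) - c j * p (y j)) = r p * (\<Prod>j<a. p (y j) - c j * p (y j))"
  shows "q = r"
proof
  fix p :: point
  let ?P = "\<lambda>t i. p i + t"
  have "\<forall>\<^sub>F t in at 0. \<forall>j\<in>{..<a}. ?P t (y j) \<noteq> 0"
  proof (intro eventually_ball_finite ballI)
    fix j
    have "\<forall>\<^sub>F t in at 0. t \<noteq> - p (y j)" by (rule eventually_neq_at_within)
    then show "\<forall>\<^sub>F t in at 0. ?P t (y j) \<noteq> 0"
      by eventually_elim (auto simp: eq_neg_iff_add_eq_0 add.commute)
  qed simp
  then have ev: "\<forall>\<^sub>F t in at 0. q (?P t) - r (?P t) = 0"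
  proof eventually_elim
    case (elim t)
    have "(\<Prod>j<a. ?P t (y j) - c j * ?P t (y j)) \<noteq> 0"
      using elim c by (simp add: prod_zero_iff)
    then show ?case using eq[of "?P t"] by simp
  qed
  have "((\<lambda>t. q (?P t) - r (?P t)) \<longlongrightarrow> q (?P 0) - r (?P 0)) (at 0)"
    using polys_isCont_shift[OF q(1), where p = p and s = 0]
      polys_isCont_shift[OF q(2), where p = p and s = 0]
    by (auto simp: isCont_def intro!: tendsto_diff)
  moreover have "((\<lambda>t. q (?P t) - r (?P t)) \<longlongrightarrow> 0) (at 0)"
    using ev by (simp add: tendsto_eventually)
  ultimately have "q (?P 0) - r (?P 0) = 0"
    by (rule LIM_unique)
  then show "q p = r p" by simp
qed

section \<open>Operators of finite order on a real vector space\<close>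

text \<open>
  An operator of finite order is all that the action of a cyclic group provides, and averaging over
  its powers gives Maschke's theorem for it.
\<close>

locale finite_order_operator =
  fixes T :: "'v::real_vector \<Rightarrow> 'v" and N :: nat
  assumes linear_T: "linear T" and pos: "N > 0" and order: "T ^^ N = id"
begin

definition average :: "'v \<Rightarrow> 'v" where
  "average v = (1 / real N) *\<^sub>R (\<Sum>j<N. (T ^^ j) v)"

lemma linear_funpow: "linear (T ^^ j)"
proof (induction j)
  case (Suc j)
  then show ?case using linear_compose[OF Suc linear_T] by (simp add: o_def)
qed (simp add: linear_iff)

lemma linear_average: "linear average"
  unfolding average_def
  by (intro linear_compose_scale_right linear_compose_sum ballI linear_funpow)

lemma sum_cyclic:
  fixes h :: "nat \<Rightarrow> 'a::ab_group_add"
  assumes "h N = h 0"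
  shows "(\<Sum>j<N. h (Suc j)) = (\<Sum>j<N. h j)"
  using sum.lessThan_Suc_shift[of h N] assms by (simp add: algebra_simps)

lemma T_average: "T (average v) = average v"
proof -
  have "T (\<Sum>j<N. (T ^^ j) v) = (\<Sum>j<N. (T ^^ Suc j) v)"
    by (simp add: linear_sum[OF linear_T])
  also have "\<dots> = (\<Sum>j<N. (T ^^ j) v)"
    by (rule sum_cyclic) (simp add: order)
  finally show ?thesis by (simp add: average_def linear_scale[OF linear_T])
qed

lemma average_fixed: "T v = v \<Longrightarrow> average v = v"
proof -
  assume v: "T v = v"
  have "(T ^^ j) v = v" for j by (induction j) (simp_all add: v)
  then show ?thesis using pos by (simp add: average_def sum_constant_scaleR)
qed

lemma average_commute: "average (T v) = average v"
proof -
  have "(\<Sum>j<N. (T ^^ j) (T v)) = (\<Sum>j<N. (T ^^ Suc j) v)"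
    by (simp only: funpow_Suc_right o_def)
  also have "\<dots> = (\<Sum>j<N. (T ^^ j) v)"
    by (rule sum_cyclic) (simp add: order)
  finally show ?thesis by (simp add: average_def)
qed

definition invariant_subspace :: "'v set \<Rightarrow> bool" where
  "invariant_subspace W \<longleftrightarrow> subspace W \<and> T ` W \<subseteq> W"

definition minimal_subspace :: "'v set \<Rightarrow> bool" where
  "minimal_subspace W \<longleftrightarrow> invariant_subspace W \<and> W \<noteq> {0} \<and>
     (\<forall>U. invariant_subspace U \<and> U \<subseteq> W \<longrightarrow> U = {0} \<or> U = W)"

lemma average_invariant_subspace:
  assumes "invariant_subspace W" "w \<in> W"
  shows "average w \<in> W"
proof -
  have "(T ^^ j) w \<in> W" for j
    using assms by (induction j) (auto simp: invariant_subspace_def)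
  then show ?thesis using assms(1)
    by (auto simp: average_def invariant_subspace_def intro!: subspace_scale subspace_sum)
qed

text \<open>
  A proper nonzero invariant subspace has smaller dimension, so the descent terminates.
\<close>

lemma ex_minimal_subspace:
  assumes "finite B" "span B = (UNIV :: 'v set)"
    and "invariant_subspace W" "W \<noteq> {0}"
  shows "\<exists>U. minimal_subspace U \<and> U \<subseteq> W"
  using assms(3,4)
proof (induction "dim W" arbitrary: W rule: less_induct)
  case less
  show ?case
  proof (cases "minimal_subspace W")
    case False
    then obtain U where U: "invariant_subspace U" "U \<subseteq> W" "U \<noteq> {0}" "U \<noteq> W"
      using less.prems unfolding minimal_subspace_def by blast
    have "dim U < dim W"
    proof -
      obtain C where C: "C \<subseteq> U" "independent C" "U \<subseteq> span C" "card C = dim U"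
        using basis_exists by blast
      obtain w where w: "w \<in> W" "w \<notin> U" using U by blast
      have spanC: "span C = U" using C U(1) span_minimal[of C U]
        by (auto simp: invariant_subspace_def)
      have indep: "independent (insert w C)"
        using C w spanC by (simp add: independent_insert)
      obtain D where D: "D \<subseteq> W" "independent D" "W \<subseteq> span D" "card D = dim W"
        using basis_exists by blast
      have finD: "finite D" using independent_span_bound[OF assms(1) D(2)] assms(2) by auto
      have "finite (insert w C) \<and> card (insert w C) \<le> card D"
      proof (rule independent_span_bound[OF finD indep])
        show "insert w C \<subseteq> span D" using w(1) C(1) U(2) D(3) by blast
      qed
      then have le: "card (insert w C) \<le> card D" and finC: "finite C" by auto
      have "w \<notin> C" using w C by blast
      from card_insert_disjoint[OF finC this] have "Suc (card C) \<le> card D" using le by linarith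
      then show ?thesis using C(4) D(4) by linarith
    qed
    then show ?thesis using less.hyps[OF _ U(1,3)] U(2) by blast
  qed blast
qed

text \<open>
  Every invariant subspace has an invariant complement: averaging the conjugates of a projection
  onto it yields an equivariant one.
\<close>

lemma ex_equivariant_projection:
  assumes M: "invariant_subspace M"
  shows "\<exists>\<pi>. linear \<pi> \<and> range \<pi> \<subseteq> M \<and> (\<forall>v\<in>M. \<pi> v = v) \<and> (\<forall>v. \<pi> (T v) = T (\<pi> v))"
proof -
  have sub: "subspace M" using M by (simp add: invariant_subspace_def)
  obtain \<rho> where \<rho>: "range \<rho> \<subseteq> M" "linear \<rho>" "\<And>v. v \<in> M \<Longrightarrow> \<rho> v = v"
    using linear_exists_left_inverse_on[of id M] sub by (auto simp: linear_id)
  define \<pi> where "\<pi> = (\<lambda>v. (1 / real N) *\<^sub>R (\<Sum>j<N. (T ^^ j) (\<rho> ((T ^^ (N - j)) v))))"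
  have inM: "(T ^^ j) v \<in> M" if "v \<in> M" for j v
    using that M by (induction j) (auto simp: invariant_subspace_def)
  have comp: "(T ^^ j) ((T ^^ (N - j)) v) = v" if "j \<le> N" for j v
  proof -
    have "(T ^^ j) ((T ^^ (N - j)) v) = (T ^^ (j + (N - j))) v" by (simp only: funpow_add o_def)
    then show ?thesis using that order by simp
  qed
  have "linear (\<lambda>v. (T ^^ j) (\<rho> ((T ^^ (N - j)) v)))" for j
    using linear_compose[OF linear_compose[OF linear_funpow[of "N - j"] \<rho>(2)] linear_funpow[of j]]
    by (simp add: o_def)
  then have "linear \<pi>"
    unfolding \<pi>_def by (intro linear_compose_scale_right linear_compose_sum) auto
  moreover have "range \<pi> \<subseteq> M"
    using \<rho>(1) inM sub by (auto simp: \<pi>_def intro!: subspace_scale subspace_sum)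
  moreover have "\<pi> v = v" if "v \<in> M" for v
  proof -
    have "(\<Sum>j<N. (T ^^ j) (\<rho> ((T ^^ (N - j)) v))) = (\<Sum>j<N. v)"
      using that \<rho>(3) inM comp by (intro sum.cong refl) simp
    then show ?thesis using pos by (simp add: \<pi>_def sum_constant_scaleR)
  qed
  moreover have "\<pi> (T v) = T (\<pi> v)" for v
  proof -
    let ?h = "\<lambda>j. (T ^^ j) (\<rho> ((T ^^ (N - j)) (T v)))"
    have "T (\<Sum>j<N. (T ^^ j) (\<rho> ((T ^^ (N - j)) v))) = (\<Sum>j<N. ?h (Suc j))"
      unfolding linear_sum[OF linear_T]
    proof (intro sum.cong refl)
      fix j assume "j \<in> {..<N}"
      then have "N - j = Suc (N - Suc j)" by auto
      then have "(T ^^ (N - j)) v = (T ^^ (N - Suc j)) (T v)"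
        by (metis comp_apply funpow_Suc_right)
      then show "T ((T ^^ j) (\<rho> ((T ^^ (N - j)) v))) = ?h (Suc j)" by simp
    qed
    also have "\<dots> = (\<Sum>j<N. ?h j)"
      by (rule sum_cyclic) (simp add: order)
    finally show ?thesis by (simp add: \<pi>_def linear_scale[OF linear_T])
  qed
  ultimately show ?thesis by blast
qed

text \<open>
  A minimal subspace with a nontrivial action meets the fixed vectors only in \<open>0\<close>, so the average, which
  is fixed, vanishes on it. Conversely, suppose that the span of these subspaces were smaller than the
  kernel of the average. The kernel of an equivariant projection onto the span would then contain a
  nonzero invariant subspace on which the average vanishes; a minimal subspace of it acts nontrivially,
  hence lies in the span, which is absurd.
\<close>

lemma span_minimal_subspaces:
  assumes B: "finite B" "span B = (UNIV :: 'v set)"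
  shows "span (\<Union>{W. minimal_subspace W \<and> (\<exists>w\<in>W. T w \<noteq> w)}) = {v. average v = 0}"
    (is "span ?X = ?R")
proof
  have subR: "subspace ?R" using linear_subspace_kernel[OF linear_average] .
  have invR: "invariant_subspace ?R"
    using subR by (auto simp: invariant_subspace_def average_commute)
  have "W \<subseteq> ?R" if W: "minimal_subspace W" "\<exists>w\<in>W. T w \<noteq> w" for W
  proof -
    let ?U = "W \<inter> {v. T v = v}"
    have W': "subspace W" "T ` W \<subseteq> W"
      using W(1) by (simp_all add: minimal_subspace_def invariant_subspace_def)
    have "subspace {v. T v = v}"
      using linear_T by (simp add: subspace_def linear_0 linear_add linear_scale)
    from subspace_inter[OF W'(1) this] have "invariant_subspace ?U"
      using W'(2) by (auto simp: invariant_subspace_def)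
    then have "?U = {0}" using W unfolding minimal_subspace_def by blast
    then show ?thesis
      using average_invariant_subspace[of W] T_average W(1)
      unfolding minimal_subspace_def by blast
  qed
  then show "span ?X \<subseteq> ?R" using subR by (intro span_minimal) auto
  have invM: "invariant_subspace (span ?X)"
  proof -
    have "T w \<in> span ?X" if "w \<in> ?X" for w
      using that by (intro span_base) (auto simp: minimal_subspace_def invariant_subspace_def)
    then have "?X \<subseteq> {w. T w \<in> span ?X}" by blast
    moreover have "subspace {w. T w \<in> span ?X}"
      using linear_subspace_vimage[OF linear_T subspace_span, of ?X] by (simp add: vimage_def)
    ultimately have "span ?X \<subseteq> {w. T w \<in> span ?X}" by (rule span_minimal)
    then show ?thesis by (auto simp: invariant_subspace_def)
  qed
  obtain \<pi> where \<pi>: "linear \<pi>" "range \<pi> \<subseteq> span ?X" "\<And>v. v \<in> span ?X \<Longrightarrow> \<pi> v = v"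
      "\<And>v. \<pi> (T v) = T (\<pi> v)"
    using ex_equivariant_projection[OF invM] by blast
  show "?R \<subseteq> span ?X"
  proof (rule ccontr)
    assume "\<not> ?R \<subseteq> span ?X"
    then obtain v where v: "average v = 0" "v \<notin> span ?X" by blast
    let ?U = "?R \<inter> {w. \<pi> w = 0}"
    have "invariant_subspace ?U"
      using invR linear_subspace_kernel[OF \<pi>(1)] \<pi>(4) linear_0[OF linear_T]
      by (auto simp: invariant_subspace_def subspace_inter)
    moreover have "v - \<pi> v \<in> ?U"
    proof -
      have "average (\<pi> v) = 0" using \<open>span ?X \<subseteq> ?R\<close> \<pi>(2) by blast
      then have "average (v - \<pi> v) = 0" using v linear_diff[OF linear_average] by simp
      moreover have "\<pi> (v - \<pi> v) = 0"
      proof -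
        have "\<pi> v \<in> span ?X" using \<pi>(2) by (rule subsetD) (rule rangeI)
        from \<pi>(3)[OF this] show ?thesis by (simp only: linear_diff[OF \<pi>(1)] diff_self)
      qed
      ultimately show ?thesis by simp
    qed
    moreover have "v - \<pi> v \<noteq> 0" using v \<pi>(2) by auto
    ultimately obtain W where W: "minimal_subspace W" "W \<subseteq> ?U"
      using ex_minimal_subspace[OF B, of ?U] by blast
    obtain w where w: "w \<in> W" "w \<noteq> 0"
      using W(1) by (auto simp: minimal_subspace_def invariant_subspace_def dest: subspace_0)
    have w': "average w = 0" "\<pi> w = 0" using w(1) W(2) by blast+
    have "T w \<noteq> w" using average_fixed[of w] w(2) w'(1) by metis
    then have "w \<in> ?X" using W(1) w(1) by blast
    from \<pi>(3)[OF span_base[OF this]] show False using w(2) w'(2) by simp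
  qed
qed

end

section \<open>Eigen-coordinates and the decomposition into fixed and normal subspaces\<close>

text \<open>
  Gaussian elimination: an equation that is not void is solved for one of the unknowns. The points
  \<open>b\<close> play the role of the equations, so that complex-valued functions on a real vector space can be
  compared with its real dimension.
\<close>

lemma underdetermined_system:
  fixes \<phi> :: "'i \<Rightarrow> 'b \<Rightarrow> complex"
  assumes "finite B" "finite I" "card B < card I"
  shows "\<exists>c. (\<exists>i\<in>I. c i \<noteq> 0) \<and> (\<forall>b\<in>B. (\<Sum>i\<in>I. c i * \<phi> i b) = 0)"
  using assms
proof (induction B arbitrary: I \<phi>)
  case empty
  then have "I \<noteq> {}" by auto
  then show ?case by (intro exI[of _ "\<lambda>_. 1"]) auto
next
  case (insert b B)
  show ?case
  proof (cases "\<forall>i\<in>I. \<phi> i b = 0")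
    case True
    have "card B < card I" using insert by simp
    from insert.IH[OF insert.prems(1) this, of \<phi>] True show ?thesis by auto
  next
    case False
    then obtain k where k: "k \<in> I" "\<phi> k b \<noteq> 0" by blast
    let ?I = "I - {k}" and ?\<psi> = "\<lambda>i x. \<phi> i x - \<phi> i b / \<phi> k b * \<phi> k x"
    have "card B < card ?I" using insert k by simp
    from insert.IH[OF _ this, of ?\<psi>] insert.prems(1) obtain c
      where c: "\<exists>i\<in>?I. c i \<noteq> 0" "\<And>x. x \<in> B \<Longrightarrow> (\<Sum>i\<in>?I. c i * ?\<psi> i x) = 0"
      by auto
    define s where "s = (\<Sum>i\<in>?I. c i * (\<phi> i b / \<phi> k b))"
    define d where "d = c(k := - s)"
    have sum_d: "(\<Sum>i\<in>I. d i * \<phi> i x) = (\<Sum>i\<in>?I. c i * ?\<psi> i x)" for x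
    proof -
      have "(\<Sum>i\<in>I. d i * \<phi> i x) = - s * \<phi> k x + (\<Sum>i\<in>?I. c i * \<phi> i x)"
        using k insert.prems(1)
        by (subst sum.remove[of I k]) (auto simp: d_def intro!: sum.cong)
      also have "\<dots> = (\<Sum>i\<in>?I. c i * ?\<psi> i x)"
        by (simp add: s_def sum_distrib_right sum_subtractf right_diff_distrib mult.assoc)
      finally show ?thesis .
    qed
    have "(\<Sum>i\<in>?I. c i * ?\<psi> i b) = 0" using k by simp
    then have "\<forall>x\<in>insert b B. (\<Sum>i\<in>I. d i * \<phi> i x) = 0" using c(2) sum_d by auto
    moreover have "\<exists>i\<in>I. d i \<noteq> 0" using c(1) by (auto simp: d_def)
    ultimately show ?thesis by blast
  qed
qed

context abelian_lin_action
begin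

abbreviation G where "G \<equiv> grp S"
abbreviation n where "n \<equiv> vdim S"
abbreviation ilists where "ilists \<equiv> index_lists {..<vdim S}"

sublocale comm_group "grp S" by (rule comm_group)

sublocale faithful_action "grp S" "UNIV :: 'v set" "act S" by (rule effective)

lemma act_mult: "g \<in> carrier G \<Longrightarrow> h \<in> carrier G \<Longrightarrow> act S (g \<otimes>\<^bsub>G\<^esub> h) v = act S g (act S h v)"
  by (rule composition_rule) auto

lemma act_one: "act S \<one>\<^bsub>G\<^esub> v = v"
  using id_eq_one by (metis UNIV_I restrict_apply')

lemma coord_nonzero:
  assumes "i < n"
  shows "\<exists>v. coord S i v \<noteq> 0"
proof (rule ccontr)
  assume "\<not> ?thesis"
  then have "\<forall>v. (\<Sum>j<n. (if j = i then 1 else 0) * coord S j v) = 0"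
    by (auto intro!: sum.neutral)
  from coord_independent[OF this assms] show False by simp
qed

lemma weight_inv_act:
  assumes "g \<in> carrier G" "i < n"
  shows "coord S i (act S (inv\<^bsub>G\<^esub> g) v) = weight S g i * coord S i v"
proof -
  obtain c where c: "\<forall>v. coord S i (act S (inv\<^bsub>G\<^esub> g) v) = c * coord S i v"
    using coord_eigen[OF assms] by blast
  obtain w where "coord S i w \<noteq> 0" using coord_nonzero[OF assms(2)] by blast
  then have "weight S g i = c"
    unfolding weight_def using c by (intro the_equality) (metis mult_cancel_right)+
  then show ?thesis using c by simp
qed

lemma weight_one [simp]: "i < n \<Longrightarrow> weight S \<one>\<^bsub>G\<^esub> i = 1"
  using weight_inv_act[of "\<one>\<^bsub>G\<^esub>" i] coord_nonzero[of i] act_one by auto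

lemma weight_mult:
  assumes "g \<in> carrier G" "h \<in> carrier G" "i < n"
  shows "weight S (g \<otimes>\<^bsub>G\<^esub> h) i = weight S g i * weight S h i"
proof -
  obtain w where w: "coord S i w \<noteq> 0" using coord_nonzero[OF assms(3)] by blast
  have "weight S (g \<otimes>\<^bsub>G\<^esub> h) i * coord S i w = weight S g i * weight S h i * coord S i w"
    using assms weight_inv_act[of "g \<otimes>\<^bsub>G\<^esub> h" i w]
    by (auto simp: weight_inv_act inv_mult act_mult)
  then show ?thesis using w by simp
qed

lemma weight_inv:
  assumes "g \<in> carrier G" "i < n"
  shows "weight S (inv\<^bsub>G\<^esub> g) i * weight S g i = 1"
  using assms weight_mult[of "inv\<^bsub>G\<^esub> g" g i] by simp

lemma weight_nonzero: "g \<in> carrier G \<Longrightarrow> i < n \<Longrightarrow> weight S g i \<noteq> 0"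
  using weight_inv by force

lemma coord_act:
  "g \<in> carrier G \<Longrightarrow> i < n \<Longrightarrow> coord S i (act S g v) = weight S (inv\<^bsub>G\<^esub> g) i * coord S i v"
  using weight_inv_act[of "inv\<^bsub>G\<^esub> g" i v] by simp

lemma coord_combination_eq_0:
  assumes "\<And>b. b \<in> B \<Longrightarrow> (\<Sum>i\<in>I. c i * coord S i b) = 0" "I \<subseteq> {..<n}" "v \<in> span B"
  shows "(\<Sum>i\<in>I. c i * coord S i v) = 0"
proof -
  have "linear (\<lambda>v. \<Sum>i\<in>I. c i * coord S i v)"
    using assms(2) coord_linear
    by (intro linear_compose_sum ballI)
       (auto intro!: linearI simp: linear_add linear_scale algebra_simps)
  from linear_eq_0_on_span[OF this assms(1,3)] show ?thesis by simp
qed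

lemma independent_finite:
  assumes "independent (B :: 'v set)"
  shows "finite B"
  using finite_dim independent_span_bound[OF _ assms] by blast

text \<open>
  Let all \<open>n\<close> coordinates vanish on some \<open>v \<noteq> 0\<close>. Completing \<open>v\<close> to a basis leaves \<open>n - 1\<close> conditions for a
  linear relation between the coordinates, which therefore exists, against their independence.
\<close>

lemma coord_injective:
  assumes "\<And>i. i < n \<Longrightarrow> coord S i v = 0"
  shows "v = 0"
proof (rule ccontr)
  assume "v \<noteq> 0"
  then have "independent {v}" by simp
  then obtain B where B: "{v} \<subseteq> B" "independent B" "UNIV \<subseteq> span B"
    using maximal_independent_subset_extend[OF subset_UNIV] by metis
  have fin: "finite B" using B(2) by (rule independent_finite)
  have "n = card B" unfolding vdim_def using B by (intro dim_unique[of B]) auto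
  moreover have "card B > 0" using fin B(1) by (auto simp: card_gt_0_iff)
  ultimately have "card (B - {v}) < card {..<n}" using B(1) by simp
  then obtain c
    where c: "\<exists>i\<in>{..<n}. c i \<noteq> 0" "\<And>b. b \<in> B - {v} \<Longrightarrow> (\<Sum>i<n. c i * coord S i b) = 0"
    using underdetermined_system[of "B - {v}" "{..<n}" "coord S"] fin by blast
  have "(\<Sum>i<n. c i * coord S i b) = 0" if "b \<in> B" for b
    using c(2)[of b] that assms by (cases "b = v") auto
  then have "\<forall>w. (\<Sum>i<n. c i * coord S i w) = 0"
    using coord_combination_eq_0[of B c "{..<n}"] B(3) by auto
  then show False using coord_independent c(1) by blast
qed

lemma finite_order_operator:
  assumes "g \<in> carrier G"
  shows "finite_order_operator (act S g) (order G)"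
    and "(act S g ^^ j) v = act S (g [^]\<^bsub>G\<^esub> j) v"
proof -
  have pow: "(act S g ^^ j) v = act S (g [^]\<^bsub>G\<^esub> j) v" for j v
  proof (induction j arbitrary: v)
    case (Suc j)
    then show ?case using assms by (simp add: funpow_Suc_right act_mult del: funpow.simps)
  qed (simp add: act_one)
  then show "(act S g ^^ j) v = act S (g [^]\<^bsub>G\<^esub> j) v" .
  have "act S g ^^ order G = id"
    by (rule ext) (simp add: pow pow_order_eq_1[OF assms] act_one)
  then show "finite_order_operator (act S g) (order G)"
    using act_linear[OF assms] order_gt_0_iff_finite finite_group
    by (simp add: finite_order_operator_def)
qed

text \<open>
  As the group is finite, \<open>g\<^sup>-\<^sup>1\<close> is a power of \<open>g\<close> with a natural exponent.
\<close>

lemma generate_singleton: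
  assumes g: "g \<in> carrier G" and h: "h \<in> generate G {g}"
  shows "\<exists>j::nat. h = g [^]\<^bsub>G\<^esub> j"
  using h
proof (induction rule: generate.induct)
  case one
  show ?case by (rule exI[of _ 0]) simp
next
  case (incl h)
  then show ?case using g by (intro exI[of _ "1::nat"]) simp
next
  case (inv h)
  have "order G > 0" using order_gt_0_iff_finite finite_group by blast
  then have "g [^]\<^bsub>G\<^esub> (order G - 1) \<otimes>\<^bsub>G\<^esub> g = \<one>\<^bsub>G\<^esub>"
    using pow_order_eq_1[OF g] by (metis Suc_diff_1 nat_pow_Suc)
  then have "inv\<^bsub>G\<^esub> g = g [^]\<^bsub>G\<^esub> (order G - 1)"
    using g by (intro inv_equality) auto
  then show ?case using inv by blast
next
  case (eng h1 h2)
  then show ?case using g by (metis nat_pow_mult)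
qed

lemma normal_sub_kernel:
  assumes g: "g \<in> carrier G"
  shows "normal_sub S g = {v. finite_order_operator.average (act S g) (order G) v = 0}"
proof -
  interpret T: finite_order_operator "act S g" "order G" by (rule finite_order_operator[OF g])
  have g_gen: "g \<in> generate G {g}" by (simp add: generate.incl)
  have "subrep S g W \<longleftrightarrow> T.invariant_subspace W" for W
  proof
    assume "T.invariant_subspace W"
    then have W: "subspace W" "act S g ` W \<subseteq> W" by (auto simp: T.invariant_subspace_def)
    have "(act S g ^^ j) w \<in> W" if "w \<in> W" for j w
      using that W(2) by (induction j) auto
    then have "act S h ` W \<subseteq> W" if "h \<in> generate G {g}" for h
      using generate_singleton[OF g that] finite_order_operator(2)[OF g] by fastforce
    then show "subrep S g W" using W by (simp add: subrep_def)
  qed (use g_gen in \<open>auto simp: subrep_def T.invariant_subspace_def\<close>)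
  then have irr: "irreducible_subrep S g W \<longleftrightarrow> T.minimal_subspace W" for W
    unfolding irreducible_subrep_def T.minimal_subspace_def by simp
  have triv: "(\<exists>h \<in> generate G {g}. \<exists>w \<in> W. act S h w \<noteq> w) \<longleftrightarrow> (\<exists>w \<in> W. act S g w \<noteq> w)" for W
  proof
    assume "\<exists>h \<in> generate G {g}. \<exists>w \<in> W. act S h w \<noteq> w"
    then obtain h w where hw: "h \<in> generate G {g}" "w \<in> W" "act S h w \<noteq> w" by blast
    obtain j :: nat where "h = g [^]\<^bsub>G\<^esub> j" using generate_singleton[OF g hw(1)] by blast
    then have "(act S g ^^ j) w \<noteq> w" using hw finite_order_operator(2)[OF g] by simp
    moreover have "(act S g ^^ j) w = w" if "act S g w = w" using that by (induction j) auto
    ultimately show "\<exists>w \<in> W. act S g w \<noteq> w" using hw(2) by blast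
  qed (use g_gen in blast)
  obtain B :: "'v set" where "finite B" "span B = UNIV" using finite_dim by blast
  then show ?thesis unfolding normal_sub_def irr triv by (rule T.span_minimal_subspaces)
qed

text \<open>
  A coordinate of weight \<open>1\<close> has the same values on a vector and on its average, which is fixed.
\<close>

lemma fix_idx_weight:
  assumes g: "g \<in> carrier G"
  shows "fix_idx S g = {i. i < n \<and> weight S g i = 1}"
    and "normal_idx S g = {i. i < n \<and> weight S g i \<noteq> 1}"
proof -
  interpret T: finite_order_operator "act S g" "order G" by (rule finite_order_operator[OF g])
  have 0: "coord S i v = 0" if "act S g v = v" "i < n" "weight S g i \<noteq> 1" for i v
  proof -
    have "act S (inv\<^bsub>G\<^esub> g) v = v"
      using act_mult[of "inv\<^bsub>G\<^esub> g" g v] g that(1) by (simp add: act_one)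
    then show ?thesis using weight_inv_act[OF g that(2), of v] that(3) by simp
  qed
  have 1: "\<exists>v. act S g v = v \<and> coord S i v \<noteq> 0" if i: "i < n" "weight S g i = 1" for i
  proof -
    obtain v where v: "coord S i v \<noteq> 0" using coord_nonzero[OF i(1)] by blast
    have w: "weight S (inv\<^bsub>G\<^esub> g) i = 1" using weight_inv[OF g i(1)] i(2) by simp
    have c: "coord S i ((act S g ^^ j) v) = coord S i v" for j
      by (induction j) (simp_all add: coord_act[OF g i(1)] w)
    have "coord S i (T.average v) = coord S i v"
      using T.pos by (simp add: T.average_def linear_scale[OF coord_linear[OF i(1)]]
          linear_sum[OF coord_linear[OF i(1)]] c scaleR_conv_of_real)
    then show ?thesis using T.T_average v by metis
  qed
  show "fix_idx S g = {i. i < n \<and> weight S g i = 1}"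
    using 0 1 unfolding fix_idx_def fix_sub_def by blast
  show "normal_idx S g = {i. i < n \<and> weight S g i \<noteq> 1}"
    using 0 1 unfolding normal_idx_def fix_sub_def by blast
qed

lemma idx_subset: "fix_idx S g \<subseteq> {..<n}" "normal_idx S g \<subseteq> {..<n}"
  by (auto simp: fix_idx_def normal_idx_def)

lemma finite_idx [simp]: "finite (fix_idx S g)" "finite (normal_idx S g)"
  using finite_subset[OF idx_subset(1)] finite_subset[OF idx_subset(2)] by auto

lemma idx_less: "i \<in> fix_idx S g \<Longrightarrow> i < n" "i \<in> normal_idx S g \<Longrightarrow> i < n"
  using idx_subset by auto

lemma coord_add: "i < n \<Longrightarrow> coord S i (u + w) = coord S i u + coord S i w"
  by (rule linear_add[OF coord_linear])

lemma coord_zero: "i < n \<Longrightarrow> coord S i 0 = 0"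
  by (rule linear_0[OF coord_linear])

lemma idx_disjoint: "fix_idx S g \<inter> normal_idx S g = {}" "fix_idx S g \<union> normal_idx S g = {..<n}"
  by (auto simp: fix_idx_def normal_idx_def)

lemma fix_sub_coords:
  assumes g: "g \<in> carrier G"
  shows "fix_sub S g = {v. \<forall>i\<in>normal_idx S g. coord S i v = 0}"
proof
  show "{v. \<forall>i\<in>normal_idx S g. coord S i v = 0} \<subseteq> fix_sub S g"
  proof
    fix v assume v: "v \<in> {v. \<forall>i\<in>normal_idx S g. coord S i v = 0}"
    have "coord S i (act S g v - v) = 0" if i: "i < n" for i
    proof (cases "weight S g i = 1")
      case True
      then show ?thesis using weight_inv[OF g i]
        by (simp add: linear_diff[OF coord_linear[OF i]] coord_act[OF g i])
    next
      case False
      then show ?thesis using v i fix_idx_weight(2)[OF g]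
        by (simp add: linear_diff[OF coord_linear[OF i]] coord_act[OF g i])
    qed
    then have "act S g v - v = 0" by (rule coord_injective)
    then show "v \<in> fix_sub S g" by (simp add: fix_sub_def)
  qed
qed (auto simp: normal_idx_def)

lemma fixed_projection:
  assumes g: "g \<in> carrier G"
  obtains E where "\<And>v. E v \<in> fix_sub S g" and "\<And>v. v - E v \<in> normal_sub S g"
    and "\<And>v i. i \<in> fix_idx S g \<Longrightarrow> coord S i (E v) = coord S i v"
    and "\<And>v i. i < n \<Longrightarrow> coord S i v = 0 \<Longrightarrow> coord S i (E v) = 0"
    and "normal_sub S g = {v. E v = 0}"
proof -
  interpret T: finite_order_operator "act S g" "order G" by (rule finite_order_operator[OF g])
  have c: "coord S i ((act S g ^^ j) v) = weight S (inv\<^bsub>G\<^esub> g) i ^ j * coord S i v" if "i < n" for i j v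
    by (induction j) (simp_all add: coord_act[OF g that])
  have avg: "coord S i (T.average v) =
      (1 / of_nat (order G)) * ((\<Sum>j<order G. weight S (inv\<^bsub>G\<^esub> g) i ^ j) * coord S i v)"
    if "i < n" for i v
    by (simp add: T.average_def linear_scale[OF coord_linear[OF that]]
          linear_sum[OF coord_linear[OF that]] c[OF that] scaleR_conv_of_real sum_distrib_right)
  show thesis
  proof (rule that[of T.average])
    show "T.average v \<in> fix_sub S g" for v by (simp add: fix_sub_def T.T_average)
    show "v - T.average v \<in> normal_sub S g" for v
      by (simp add: normal_sub_kernel[OF g] linear_diff[OF T.linear_average]
          T.average_fixed[OF T.T_average])
    show "coord S i (T.average v) = coord S i v" if "i \<in> fix_idx S g" for v i
    proof -
      have i: "i < n" "weight S g i = 1" using that fix_idx_weight[OF g] by auto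
      then have "weight S (inv\<^bsub>G\<^esub> g) i = 1" using weight_inv[OF g i(1)] by simp
      then show ?thesis using T.pos by (simp add: avg[OF i(1)])
    qed
    show "coord S i (T.average v) = 0" if "i < n" "coord S i v = 0" for v i
      using avg that by simp
    show "normal_sub S g = {v. T.average v = 0}" by (rule normal_sub_kernel[OF g])
  qed
qed

lemma normal_sub_coords:
  assumes g: "g \<in> carrier G"
  shows "normal_sub S g = {v. \<forall>i\<in>fix_idx S g. coord S i v = 0}"
proof -
  obtain E where E: "\<And>v. E v \<in> fix_sub S g"
    "\<And>v i. i \<in> fix_idx S g \<Longrightarrow> coord S i (E v) = coord S i v"
    "normal_sub S g = {v. E v = 0}"
    using fixed_projection[OF g] by metis
  have "E v = 0 \<longleftrightarrow> (\<forall>i\<in>fix_idx S g. coord S i v = 0)" for v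
  proof
    assume "E v = 0"
    then show "\<forall>i\<in>fix_idx S g. coord S i v = 0"
      using E(2)[of _ v] by (auto simp: coord_zero idx_less)
  next
    assume *: "\<forall>i\<in>fix_idx S g. coord S i v = 0"
    show "E v = 0"
    proof (rule coord_injective)
      fix i assume "i < n"
      then consider "i \<in> fix_idx S g" | "i \<in> normal_idx S g" using idx_disjoint[of g] by auto
      then show "coord S i (E v) = 0"
        using * E(1)[of v] E(2)[of i v] fix_sub_coords[OF g] by cases auto
    qed
  qed
  then show ?thesis using E(3) by simp
qed

lemma subspace_coords: "I \<subseteq> {..<n} \<Longrightarrow> subspace {v. \<forall>i\<in>I. coord S i v = 0}"
  using coord_linear by (auto simp: subspace_def linear_0 linear_add linear_scale subset_eq)

text \<open>
  The average splits a vector into its parts in \<open>V\<^sup>g\<close> and \<open>N\<^sup>g\<close>. It multiplies each coordinate by a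
  scalar, so both parts satisfy all the coordinate equations that the vector satisfies.
\<close>

lemma direct_sum_coords:
  assumes g: "g \<in> carrier G" and K: "K \<subseteq> {..<n}"
    and I: "I = K \<union> normal_idx S g" and J: "J = K \<union> fix_idx S g"
  shows "direct_sum {v. \<forall>i\<in>K. coord S i v = 0} {v. \<forall>i\<in>I. coord S i v = 0}
    {v. \<forall>i\<in>J. coord S i v = 0}"
  unfolding direct_sum_def
proof
  obtain E where E: "\<And>v. E v \<in> fix_sub S g" "\<And>v. v - E v \<in> normal_sub S g"
    "\<And>v i. i < n \<Longrightarrow> coord S i v = 0 \<Longrightarrow> coord S i (E v) = 0"
    using fixed_projection[OF g] by metis
  note E' = E(1)[unfolded fix_sub_coords[OF g]] E(2)[unfolded normal_sub_coords[OF g]]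
  show "{v. \<forall>i\<in>K. coord S i v = 0} =
      sum_space {v. \<forall>i\<in>I. coord S i v = 0} {v. \<forall>i\<in>J. coord S i v = 0}" (is "?K = ?S")
  proof
    show "?S \<subseteq> ?K" using K unfolding sum_space_def I J by (auto simp: coord_add)
    show "?K \<subseteq> ?S"
    proof
      fix v assume v: "v \<in> ?K"
      have EK: "coord S i (E v) = 0" "coord S i (v - E v) = 0" if "i \<in> K" for i
        using v that K E(3)[of i v] linear_diff[OF coord_linear[of i], of v "E v"] by auto
      show "v \<in> ?S"
        unfolding sum_space_def I J using E'[of v] EK
        by (intro CollectI exI[of _ "E v"] exI[of _ "v - E v"]) auto
    qed
  qed
  have "i \<in> I \<union> J" if "i < n" for i using that idx_disjoint(2)[of g] unfolding I J by blast
  then have "v = 0" if "\<forall>i\<in>I. coord S i v = 0" "\<forall>i\<in>J. coord S i v = 0" for v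
    using that by (intro coord_injective) blast
  moreover have "i < n" if "i \<in> I \<union> J" for i using that K idx_subset unfolding I J by blast
  ultimately show "{v. \<forall>i\<in>I. coord S i v = 0} \<inter> {v. \<forall>i\<in>J. coord S i v = 0} = {0}"
    by (auto simp: coord_zero)
qed

text \<open>
  The coordinates in \<open>I\<close> are independent on the subspace \<open>x\<^sup>J = 0\<close>, since a relation between them that
  holds there holds on all of \<open>V\<close>.
\<close>

lemma card_le_dim_coords:
  assumes IJ: "I \<union> J = {..<n}" "I \<inter> J = {}"
    and W: "\<And>v. \<exists>u w. v = u + w \<and> (\<forall>i\<in>J. coord S i w = 0) \<and> (\<forall>i\<in>I. coord S i u = 0)"
  shows "card I \<le> dim {v. \<forall>i\<in>J. coord S i v = 0}"
proof (rule ccontr)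
  let ?W = "{v. \<forall>i\<in>J. coord S i v = 0}"
  assume "\<not> ?thesis"
  moreover obtain B where B: "B \<subseteq> ?W" "independent B" "?W \<subseteq> span B" "card B = dim ?W"
    using basis_exists by blast
  ultimately have lt: "card B < card I" by simp
  have fin: "finite I" "finite J" using IJ(1) by (metis finite_Un finite_lessThan)+
  obtain c where c: "\<exists>i\<in>I. c i \<noteq> 0" "\<And>b. b \<in> B \<Longrightarrow> (\<Sum>i\<in>I. c i * coord S i b) = 0"
    using underdetermined_system[OF independent_finite[OF B(2)] fin(1) lt, of "coord S"] by blast
  define d where "d = (\<lambda>i. if i \<in> I then c i else 0)"
  have dI: "(\<Sum>i<n. d i * coord S i v) = (\<Sum>i\<in>I. c i * coord S i v)" for v
    unfolding d_def using IJ by (intro sum.mono_neutral_cong_right) auto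
  have "(\<Sum>i<n. d i * coord S i v) = 0" for v
  proof -
    obtain u w where uw: "v = u + w" "\<forall>i\<in>J. coord S i w = 0" "\<forall>i\<in>I. coord S i u = 0"
      using W[of v] by blast
    have I: "I \<subseteq> {..<n}" using IJ by blast
    have "(\<Sum>i\<in>I. c i * coord S i w) = 0"
      using coord_combination_eq_0[OF c(2) I] B(3) uw(2) by blast
    moreover have "coord S i v = coord S i w" if "i \<in> I" for i
      using that uw I linear_add[OF coord_linear[of i]] by auto
    ultimately show ?thesis unfolding dI by simp
  qed
  then have "\<forall>i<n. d i = 0" using coord_independent[of d] by blast
  then show False using c(1) IJ(1) unfolding d_def by (metis UnCI lessThan_iff)
qed

text \<open>
  The dimensions of \<open>V\<^sup>g\<close> and \<open>N\<^sup>g\<close> add up to \<open>n\<close> and are bounded below by numbers of coordinates that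
  also add up to \<open>n\<close>.
\<close>

lemma codim_eq:
  assumes g: "g \<in> carrier G"
  shows "codim S g = card (normal_idx S g)"
proof -
  let ?F = "{v. \<forall>i\<in>normal_idx S g. coord S i v = 0}" and ?R = "{v. \<forall>i\<in>fix_idx S g. coord S i v = 0}"
  have ds: "direct_sum UNIV ?F ?R" using direct_sum_coords[OF g, of "{}"] by simp
  obtain B :: "'v set" where B: "independent B" "UNIV \<subseteq> span B"
    using maximal_independent_subset[of "UNIV :: 'v set"] by metis
  then have B': "span B = UNIV" by blast
  interpret fd: finite_dimensional_vector_space "scaleR :: real \<Rightarrow> 'v \<Rightarrow> 'v" B
    using B B' independent_finite[OF B(1)]
    by unfold_locales (auto simp: dependent_raw_def span_raw_def algebra_simps)
  have UN: "{x + y |x y. x \<in> ?F \<and> y \<in> ?R} = UNIV" and INT: "?F \<inter> ?R = {0}"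
    using ds by (simp_all add: direct_sum_def sum_space_def)
  then have E: "\<exists>x y. v = x + y \<and> x \<in> ?F \<and> y \<in> ?R" for v by blast
  have "dim (UNIV :: 'v set) + dim {0 :: 'v} = dim ?F + dim ?R"
    using fd.dim_sums_Int[of ?F ?R] subspace_coords[OF idx_subset(1)] subspace_coords[OF idx_subset(2)]
    unfolding UN INT dim_raw_def subspace_raw_def by simp
  moreover have "dim {0 :: 'v} = 0" using dim_eq_card[of "{}" "{0 :: 'v}"] independent_empty by simp
  ultimately have n: "n = dim ?F + dim ?R" by (simp add: vdim_def)
  have "card (fix_idx S g) \<le> dim ?F"
  proof (rule card_le_dim_coords)
    fix v
    show "\<exists>u w. v = u + w \<and> (\<forall>i\<in>normal_idx S g. coord S i w = 0) \<and> (\<forall>i\<in>fix_idx S g. coord S i u = 0)"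
    proof -
      obtain x y where "v = x + y" "x \<in> ?F" "y \<in> ?R" using E by blast
      then show ?thesis by (intro exI[of _ y] exI[of _ x]) (simp add: add.commute)
    qed
  qed (use idx_disjoint[of g] in blast)+
  moreover have "card (normal_idx S g) \<le> dim ?R"
  proof (rule card_le_dim_coords)
    fix v
    show "\<exists>u w. v = u + w \<and> (\<forall>i\<in>fix_idx S g. coord S i w = 0) \<and> (\<forall>i\<in>normal_idx S g. coord S i u = 0)"
    proof -
      obtain x y where "v = x + y" "x \<in> ?F" "y \<in> ?R" using E by blast
      then show ?thesis by (intro exI[of _ x] exI[of _ y]) simp
    qed
  qed (use idx_disjoint[of g] in blast)+
  moreover have "card (fix_idx S g) + card (normal_idx S g) = n"
    using idx_disjoint[of g] by (metis card_Un_disjoint card_lessThan finite_idx)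
  ultimately show ?thesis unfolding codim_def normal_sub_coords[OF g] using n by linarith
qed

lemma sum_fix_sub_eq_UNIV_iff:
  assumes "\<alpha> \<in> carrier G" "\<beta> \<in> carrier G"
  shows "sum_space (fix_sub S \<alpha>) (fix_sub S \<beta>) = UNIV \<longleftrightarrow> normal_idx S \<alpha> \<inter> normal_idx S \<beta> = {}"
proof
  assume *: "sum_space (fix_sub S \<alpha>) (fix_sub S \<beta>) = UNIV"
  show "normal_idx S \<alpha> \<inter> normal_idx S \<beta> = {}"
  proof (rule ccontr)
    assume "\<not> ?thesis"
    then obtain c where c: "c \<in> normal_idx S \<alpha>" "c \<in> normal_idx S \<beta>" by blast
    then have "c < n" using idx_subset by blast
    have "coord S c v = 0" for v
    proof -
      have "v \<in> sum_space (fix_sub S \<alpha>) (fix_sub S \<beta>)" using * by simp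
      then obtain u w where "v = u + w" "u \<in> fix_sub S \<alpha>" "w \<in> fix_sub S \<beta>"
        unfolding sum_space_def by blast
      then show ?thesis using c fix_sub_coords assms linear_add[OF coord_linear[OF \<open>c < n\<close>]] by simp
    qed
    then show False using coord_nonzero[OF \<open>c < n\<close>] by blast
  qed
next
  assume *: "normal_idx S \<alpha> \<inter> normal_idx S \<beta> = {}"
  then have "{v. \<forall>i\<in>fix_idx S \<alpha>. coord S i v = 0} \<subseteq> fix_sub S \<beta>"
    unfolding fix_sub_coords[OF assms(2)] using idx_disjoint[of \<alpha>] idx_subset by blast
  moreover have "UNIV = sum_space (fix_sub S \<alpha>) {v. \<forall>i\<in>fix_idx S \<alpha>. coord S i v = 0}"
    using direct_sum_coords[OF assms(1), of "{}"]
    by (simp add: direct_sum_def fix_sub_coords[OF assms(1)])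
  ultimately show "sum_space (fix_sub S \<alpha>) (fix_sub S \<beta>) = UNIV"
    unfolding sum_space_def by blast
qed

context
  fixes \<alpha> \<beta> :: 'g
  assumes ab: "\<alpha> \<in> carrier G" "\<beta> \<in> carrier G"
    and disjoint: "normal_idx S \<alpha> \<inter> normal_idx S \<beta> = {}"
begin

lemma normal_idx_mult: "normal_idx S (\<alpha> \<otimes>\<^bsub>G\<^esub> \<beta>) = normal_idx S \<alpha> \<union> normal_idx S \<beta>"
  using ab disjoint by (auto simp: fix_idx_weight weight_mult)

lemma fix_idx_mult: "fix_idx S (\<alpha> \<otimes>\<^bsub>G\<^esub> \<beta>) = fix_idx S \<alpha> \<inter> fix_idx S \<beta>"
  using ab disjoint by (auto simp: fix_idx_weight weight_mult)

lemma codim_mult: "codim S (\<alpha> \<otimes>\<^bsub>G\<^esub> \<beta>) = codim S \<alpha> + codim S \<beta>"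
  using ab disjoint by (simp add: codim_eq normal_idx_mult card_Un_disjoint)

lemma normal_idx_subset: "normal_idx S \<alpha> \<subseteq> fix_idx S \<beta>" "normal_idx S \<beta> \<subseteq> fix_idx S \<alpha>"
  using disjoint idx_disjoint[of \<alpha>] idx_disjoint[of \<beta>] idx_subset by blast+

lemma direct_sum_normal: "direct_sum (normal_sub S (\<alpha> \<otimes>\<^bsub>G\<^esub> \<beta>)) (normal_sub S \<alpha>) (normal_sub S \<beta>)"
proof -
  let ?F = "fix_idx S \<alpha> \<inter> fix_idx S \<beta>"
  have *: "fix_idx S \<alpha> = ?F \<union> normal_idx S \<beta>" "fix_idx S \<beta> = ?F \<union> fix_idx S \<beta>"
    using normal_idx_subset idx_disjoint[of \<beta>] idx_subset by blast+
  have "?F \<subseteq> {..<n}" using idx_subset by blast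
  from direct_sum_coords[OF ab(2) this *] show ?thesis
    using ab by (simp add: normal_sub_coords fix_idx_mult)
qed

lemma direct_sum_fix: "direct_sum (fix_sub S \<alpha>) (fix_sub S (\<alpha> \<otimes>\<^bsub>G\<^esub> \<beta>)) (normal_sub S \<beta>)"
proof -
  have "fix_idx S \<beta> = normal_idx S \<alpha> \<union> fix_idx S \<beta>" using normal_idx_subset by blast
  from direct_sum_coords[OF ab(2) idx_subset(2) refl this] show ?thesis
    using ab by (simp add: normal_sub_coords fix_sub_coords normal_idx_mult)
qed

end

lemma direct_sum_fix_normal:
  "g \<in> carrier G \<Longrightarrow> direct_sum UNIV (fix_sub S g) (normal_sub S g)"
  using direct_sum_coords[of g "{}"] by (simp add: fix_sub_coords normal_sub_coords)

end

section \<open>The twisted cocycle\<close>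

context abelian_lin_action
begin

abbreviation A where "A \<equiv> polys {..<n}"

lemma set_ys: "set (ys S g) = normal_idx S g" "distinct (ys S g)"
  by (simp_all add: ys_def)

lemma length_ys: "g \<in> carrier G \<Longrightarrow> length (ys S g) = codim S g"
  by (simp add: ys_def codim_eq)

lemma weight_ys:
  assumes "g \<in> carrier G" "j < codim S g"
  shows "ys S g ! j < n" "weight S g (ys S g ! j) \<noteq> 1" "ys S g ! j \<in> normal_idx S g"
proof -
  show *: "ys S g ! j \<in> normal_idx S g"
    using assms by (metis length_ys nth_mem set_ys(1))
  show "ys S g ! j < n" "weight S g (ys S g ! j) \<noteq> 1"
    using * fix_idx_weight(2)[OF assms(1)] by auto
qed

lemma zpoint_polys: "f \<in> polys I \<Longrightarrow> (\<lambda>p. f (zpoint S g \<sigma> j p)) \<in> polys I"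
proof -
  assume "f \<in> polys I"
  then have "(\<lambda>p. f (\<lambda>i. (if i \<in> (\<lambda>m. ys S g ! \<sigma> m) ` {..<j} then weight S g i else 1) * p i)) \<in> polys I"
    by (rule polys_scale)
  also have "(\<lambda>p. f (\<lambda>i. (if i \<in> (\<lambda>m. ys S g ! \<sigma> m) ` {..<j} then weight S g i else 1) * p i)) =
      (\<lambda>p. f (zpoint S g \<sigma> j p))"
    by (intro ext arg_cong[where f = f]) (simp add: zpoint_def)
  finally show ?thesis .
qed

lemma zpoint_step:
  assumes g: "g \<in> carrier G" and \<sigma>: "\<sigma> permutes {..<codim S g}" and j: "j < codim S g"
  shows "zpoint S g \<sigma> j p (ys S g ! \<sigma> j) = p (ys S g ! \<sigma> j)"
    and "zpoint S g \<sigma> (Suc j) p =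
      (zpoint S g \<sigma> j p)(ys S g ! \<sigma> j := weight S g (ys S g ! \<sigma> j) * p (ys S g ! \<sigma> j))"
proof -
  have *: "ys S g ! \<sigma> j \<notin> (\<lambda>m. ys S g ! \<sigma> m) ` {..<j}"
  proof
    assume "ys S g ! \<sigma> j \<in> (\<lambda>m. ys S g ! \<sigma> m) ` {..<j}"
    then obtain m where m: "m < j" "ys S g ! \<sigma> j = ys S g ! \<sigma> m" by auto
    have "\<sigma> j < codim S g" "\<sigma> m < codim S g"
      using permutes_in_image[OF \<sigma>] j m(1) by auto
    then have "\<sigma> j = \<sigma> m" using m(2) set_ys(2)[of g] length_ys[OF g] by (simp add: nth_eq_iff_index_eq)
    then show False using permutes_inj[OF \<sigma>] m(1) by (auto dest: injD)
  qed
  then show "zpoint S g \<sigma> j p (ys S g ! \<sigma> j) = p (ys S g ! \<sigma> j)"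
    by (simp add: zpoint_def)
  show "zpoint S g \<sigma> (Suc j) p =
      (zpoint S g \<sigma> j p)(ys S g ! \<sigma> j := weight S g (ys S g ! \<sigma> j) * p (ys S g ! \<sigma> j))"
    using * by (auto simp: zpoint_def fun_eq_iff lessThan_Suc)
qed

text \<open>
  In the numerator of the cocycle, the factor number \<open>j\<close> compares two points that differ in the coordinate
  \<open>y\<^bsup>\<sigma>(j)\<^esup>\<close> only; it is divisible by the factor number \<open>\<sigma>(j)\<close> of the denominator.
\<close>

definition Omega_formula :: "'g \<Rightarrow> pfun list \<Rightarrow> pfun" where
  "Omega_formula g fs p = 1 / fact (codim S g) *
     (\<Sum>\<sigma> | \<sigma> permutes {..<codim S g}. of_int (sign \<sigma>) *
       (\<Prod>j<codim S g. difference_quotient (weight S g (ys S g ! \<sigma> j)) (ys S g ! \<sigma> j) (fs ! j)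
          (zpoint S g \<sigma> j p)))"

lemma Omega_formula_polys:
  assumes g: "g \<in> carrier G" and fs: "\<And>j. j < codim S g \<Longrightarrow> fs ! j \<in> A"
  shows "Omega_formula g fs \<in> A"
  unfolding Omega_formula_def[abs_def]
proof (intro polys_cmult polys_sum polys_prod zpoint_polys polys_difference_quotient)
  fix \<sigma> j assume *: "\<sigma> \<in> {\<sigma>. \<sigma> permutes {..<codim S g}}" "j \<in> {..<codim S g}"
  then show "fs ! j \<in> A" using fs by simp
  have "\<sigma> j < codim S g" using * permutes_in_image[of \<sigma> "{..<codim S g}" j] by simp
  then show "weight S g (ys S g ! \<sigma> j) \<noteq> 1" by (rule weight_ys(2)[OF g])
qed

lemma Omega_eq:
  assumes g: "g \<in> carrier G" and fs: "\<And>j. j < codim S g \<Longrightarrow> fs ! j \<in> A"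
  shows "Omega S g fs = Omega_formula g fs"
  unfolding Omega_def
proof (rule the_equality)
  let ?a = "codim S g" and ?y = "\<lambda>j. ys S g ! j"
  let ?D = "\<lambda>p. \<Prod>j<?a. p (?y j) - weight S g (?y j) * p (?y j)"
  let ?N = "\<lambda>p. 1 / fact ?a * (\<Sum>\<sigma> | \<sigma> permutes {..<?a}. of_int (sign \<sigma>) *
          (\<Prod>j<?a. (fs ! j) (zpoint S g \<sigma> j p) - (fs ! j) (zpoint S g \<sigma> (Suc j) p)))"
  have eq: "Omega_formula g fs p * ?D p = ?N p" for p
  proof -
    have "(\<Prod>j<?a. difference_quotient (weight S g (?y (\<sigma> j))) (?y (\<sigma> j)) (fs ! j) (zpoint S g \<sigma> j p)) * ?D p =
      (\<Prod>j<?a. (fs ! j) (zpoint S g \<sigma> j p) - (fs ! j) (zpoint S g \<sigma> (Suc j) p))"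
      if \<sigma>: "\<sigma> permutes {..<?a}" for \<sigma>
    proof -
      have D: "?D p = (\<Prod>j<?a. p (?y (\<sigma> j)) - weight S g (?y (\<sigma> j)) * p (?y (\<sigma> j)))"
        using prod.permute[OF \<sigma>, of "\<lambda>j. p (?y j) - weight S g (?y j) * p (?y j)"] by (simp add: o_def)
      show ?thesis unfolding D prod.distrib[symmetric]
      proof (intro prod.cong refl)
        fix j assume "j \<in> {..<?a}"
        then have j: "j < ?a" "\<sigma> j < ?a" using permutes_in_image[OF \<sigma>] by auto
        show "difference_quotient (weight S g (?y (\<sigma> j))) (?y (\<sigma> j)) (fs ! j) (zpoint S g \<sigma> j p) *
            (p (?y (\<sigma> j)) - weight S g (?y (\<sigma> j)) * p (?y (\<sigma> j))) =
            (fs ! j) (zpoint S g \<sigma> j p) - (fs ! j) (zpoint S g \<sigma> (Suc j) p)"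
          using difference_quotient_times[OF weight_ys(2)[OF g j(2)], of "?y (\<sigma> j)" "fs ! j" "zpoint S g \<sigma> j p"]
          unfolding zpoint_step[OF g \<sigma> j(1)] .
      qed
    qed
    then show ?thesis
      unfolding Omega_formula_def
      by (simp add: sum_distrib_right mult.assoc)
  qed
  then show "Omega_formula g fs \<in> A \<and> (\<forall>p. Omega_formula g fs p * ?D p = ?N p)"
    using Omega_formula_polys[OF g fs] by blast
  fix q assume q: "q \<in> A \<and> (\<forall>p. q p * ?D p = ?N p)"
  show "q = Omega_formula g fs"
    using q Omega_formula_polys[OF g fs] eq weight_ys[OF g]
    by (intro polys_cancel[where I = "{..<n}" and a = ?a and y = ?y and c = "\<lambda>j. weight S g (?y j)"])
      auto
qed

text \<open>
  Every term contains a difference quotient in the direction \<open>c\<close>.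
\<close>

lemma Omega_zero:
  assumes g: "g \<in> carrier G" and fs: "\<And>j. j < codim S g \<Longrightarrow> fs ! j \<in> A"
    and c: "c \<in> normal_idx S g"
    and indep: "\<And>j. j < codim S g \<Longrightarrow> fs ! j \<in> polys ({..<n} - {c})"
  shows "Omega S g fs p = 0"
proof -
  have "(\<Prod>j<codim S g. difference_quotient (weight S g (ys S g ! \<sigma> j)) (ys S g ! \<sigma> j) (fs ! j)
          (zpoint S g \<sigma> j p)) = 0" if \<sigma>: "\<sigma> permutes {..<codim S g}" for \<sigma>
  proof -
    obtain i where i: "i < codim S g" "ys S g ! i = c"
      using c set_ys(1)[of g] length_ys[OF g] by (metis in_set_conv_nth)
    obtain j where j: "j < codim S g" "\<sigma> j = i"
      using i(1) permutes_image[OF \<sigma>] by (metis imageE lessThan_iff)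
    have "difference_quotient (weight S g (ys S g ! \<sigma> j)) (ys S g ! \<sigma> j) (fs ! j)
        (zpoint S g \<sigma> j p) = 0"
      using indep[OF j(1)] i j by (intro difference_quotient_not_in) auto
    then show ?thesis using j(1) by (auto intro: prod_zero)
  qed
  then show ?thesis by (simp add: Omega_eq[OF g fs] Omega_formula_def del: prod_zero_iff)
qed

section \<open>Functions and the crossed product\<close>

lemma act_point_inv: "g \<in> carrier G \<Longrightarrow> act_point S (inv\<^bsub>G\<^esub> g) p = (\<lambda>i. weight S g i * p i)"
  by (simp add: act_point_def)

lemma act_fun_eq: "g \<in> carrier G \<Longrightarrow> act_fun S g f = (\<lambda>p. f (\<lambda>i. weight S g i * p i))"
  by (simp add: act_fun_def act_point_inv)

lemma act_fun_polys: "g \<in> carrier G \<Longrightarrow> f \<in> polys I \<Longrightarrow> act_fun S g f \<in> polys I"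
  by (simp add: act_fun_eq polys_scale)

lemma act_fun_const [simp]: "act_fun S g (\<lambda>p. c) = (\<lambda>p. c)"
  by (simp add: act_fun_def)

lemma act_fun_mult:
  assumes "g \<in> carrier G" "h \<in> carrier G" "f \<in> A"
  shows "act_fun S g (act_fun S h f) = act_fun S (g \<otimes>\<^bsub>G\<^esub> h) f"
  using assms by (auto simp: act_fun_eq fun_eq_iff weight_mult intro!: polys_cong[OF assms(3)])

lemma act_fun_one:
  assumes "f \<in> A"
  shows "act_fun S \<one>\<^bsub>G\<^esub> f = f"
  by (auto simp: act_fun_eq fun_eq_iff intro!: polys_cong[OF assms])

lemma monom_U_apply: "monom_U a g h = (if h = g then a else (\<lambda>p. 0))"
  by (auto simp: monom_U_def)

lemma cmult_monom:
  assumes "\<kappa> \<in> carrier G" "\<gamma> \<in> carrier G"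
  shows "cmult S (monom_U F \<kappa>) (monom_U H \<gamma>) = monom_U (\<lambda>p. F p * act_fun S \<kappa> H p) (\<kappa> \<otimes>\<^bsub>G\<^esub> \<gamma>)"
proof (intro ext)
  fix m p
  let ?I = "{(g, h). g \<in> carrier G \<and> h \<in> carrier G \<and> g \<otimes>\<^bsub>G\<^esub> h = m}"
  have fin: "finite ?I"
    by (rule finite_subset[of _ "carrier G \<times> carrier G"]) (auto simp: finite_group)
  have "cmult S (monom_U F \<kappa>) (monom_U H \<gamma>) m p =
    (\<Sum>x\<in>?I. if x = (\<kappa>, \<gamma>) then F p * act_fun S \<kappa> H p else 0)"
    unfolding cmult_def
    by (intro sum.cong refl) (auto simp: monom_U_apply split: if_splits)
  also have "\<dots> = monom_U (\<lambda>p. F p * act_fun S \<kappa> H p) (\<kappa> \<otimes>\<^bsub>G\<^esub> \<gamma>) m p"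
    using fin assms by (auto simp: monom_U_def)
  finally show "cmult S (monom_U F \<kappa>) (monom_U H \<gamma>) m p =
      monom_U (\<lambda>p. F p * act_fun S \<kappa> H p) (\<kappa> \<otimes>\<^bsub>G\<^esub> \<gamma>) m p" .
qed

section \<open>The cochain of a multivector field\<close>

text \<open>
  The coefficient \<open>T\<^sub>1\<^sup>g(X \<otimes> \<Lambda>\<^sub>g)\<close> of \<open>U\<^sub>g\<close>, so that cochains can be composed as maps on functions.
\<close>

definition T1_coeff :: "nat \<Rightarrow> 'g \<Rightarrow> mvfield \<Rightarrow> pfun list \<Rightarrow> pfun" where
  "T1_coeff k g X fs p = mv_apply S (k - codim S g) X (take (k - codim S g) fs) p *
     Omega S g (drop (k - codim S g) fs) p"

lemma T1_eq: "T1 S k g X fs = monom_U (T1_coeff k g X fs) g"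
  by (simp add: T1_def T1_coeff_def[abs_def])

lemma sectionsD:
  assumes "X \<in> sections S g k"
  shows "(\<lambda>p. X p T) \<in> polys (fix_idx S g)" "(\<lambda>p. X p T) \<in> A"
    "X p T \<noteq> 0 \<Longrightarrow> T \<subseteq> fix_idx S g" "X p T \<noteq> 0 \<Longrightarrow> card T + codim S g = k"
proof -
  show *: "(\<lambda>p. X p T) \<in> polys (fix_idx S g)" using assms by (simp add: sections_def)
  show "(\<lambda>p. X p T) \<in> A" by (rule polys_mono[OF * idx_subset(1)])
qed (use assms in \<open>auto simp: sections_def\<close>)

lemma T1_coeff_small:
  assumes "X \<in> sections S g k" "k < codim S g"
  shows "T1_coeff k g X fs p = 0"
  using sectionsD(4)[OF assms(1)] assms(2)
  by (auto simp: T1_coeff_def mv_apply_def intro!: sum.neutral)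

lemma mv_apply_polys:
  assumes "X \<in> sections S g k" "\<And>j. j < m \<Longrightarrow> fs ! j \<in> A"
  shows "mv_apply S m X fs \<in> A"
  unfolding mv_apply_def[abs_def]
  using assms(2)
  by (intro polys_sum polys.mult[OF sectionsD(2)[OF assms(1)]] polys_cmult polys_prod polys_partial) auto

lemma nth_drop_polys:
  assumes "length fs = k" "set fs \<subseteq> A" "codim S g \<le> k" "j < codim S g"
  shows "drop (k - codim S g) fs ! j \<in> A"
  using assms by (auto simp: subset_iff)

lemma T1_coeff_polys:
  assumes X: "X \<in> sections S g k" and g: "g \<in> carrier G" and fs: "length fs = k" "set fs \<subseteq> A"
  shows "T1_coeff k g X fs \<in> A"
proof (cases "k < codim S g")
  case True
  then have "T1_coeff k g X fs = (\<lambda>p. 0)" using T1_coeff_small[OF X] by blast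
  then show ?thesis by (simp add: polys.const)
next
  case False
  then have "mv_apply S (k - codim S g) X (take (k - codim S g) fs) \<in> A"
    using fs by (intro mv_apply_polys[OF X]) (auto simp: subset_iff)
  moreover have "Omega S g (drop (k - codim S g) fs) \<in> A"
    using Omega_eq[OF g] Omega_formula_polys[OF g] nth_drop_polys[OF fs] False by simp
  ultimately show ?thesis unfolding T1_coeff_def[abs_def] by (rule polys.mult)
qed

lemma T1_coeff_zero_argument:
  assumes X: "X \<in> sections S g k" and g: "g \<in> carrier G" and fs: "length fs = k" "set fs \<subseteq> A"
    and i: "i < k" "fs ! i = (\<lambda>p. 0)"
  shows "T1_coeff k g X fs p = 0"
proof (cases "k < codim S g")
  case True
  then show ?thesis by (rule T1_coeff_small[OF X])
next
  case False
  let ?m = "k - codim S g"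
  show ?thesis
  proof (cases "i < ?m")
    case True
    then have "(\<Prod>j<?m. partial (x j) (take ?m fs ! j) p) = 0" for x
      using i by (intro prod_zero) (auto simp: partial_const intro!: bexI[of _ i])
    then show ?thesis by (simp add: T1_coeff_def mv_apply_def del: prod_zero_iff)
  next
    case F: False
    have "Omega S g (drop ?m fs) p = 0"
    proof -
      have "(\<Prod>j<codim S g. difference_quotient (c j) (x j) (drop ?m fs ! j) (z j)) = 0" for c x z
        using i F False fs(1) by (intro prod_zero) (auto intro!: bexI[of _ "i - ?m"])
      then show ?thesis
        using Omega_eq[OF g nth_drop_polys[OF fs]] False by (simp add: Omega_formula_def del: prod_zero_iff)
    qed
    then show ?thesis by (simp add: T1_coeff_def)
  qed
qed

lemma gprod_closed: "set gs \<subseteq> carrier G \<Longrightarrow> gprod S gs \<in> carrier G"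
  by (induction gs) (auto simp: gprod_def)

text \<open>
  In the multilinear extension, all families of group elements other than the given one insert the zero
  function into some argument.
\<close>

lemma T_map_monom:
  assumes X: "X \<in> sections S g k" and g: "g \<in> carrier G"
    and fs: "length fs = k" "set fs \<subseteq> A" and gs: "length gs = k" "set gs \<subseteq> carrier G"
  shows "T_map S k g X (map2 monom_U fs gs) =
     monom_U (T1_coeff k g X (map (\<lambda>j. act_fun S (gprod S (take j gs)) (fs ! j)) [0..<k]))
       (g \<otimes>\<^bsub>G\<^esub> gprod S gs)"
proof (intro ext)
  fix m p
  let ?R = "monom_U (T1_coeff k g X (map (\<lambda>j. act_fun S (gprod S (take j gs)) (fs ! j)) [0..<k]))
       (g \<otimes>\<^bsub>G\<^esub> gprod S gs)"
  let ?L = "{gs. set gs \<subseteq> carrier G \<and> length gs = k}"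
  let ?bs = "map2 monom_U fs gs"
  let ?arg = "\<lambda>hs. map (\<lambda>j. act_fun S (gprod S (take j hs)) ((?bs ! j) (hs ! j))) [0..<k]"
  have summand: "cmult S (T1 S k g X (?arg hs)) (U_elem (gprod S hs)) m p = (if hs = gs then ?R m p else 0)"
    if hs: "set hs \<subseteq> carrier G" "length hs = k" for hs
  proof -
    have bs: "?bs ! j = monom_U (fs ! j) (gs ! j)" if "j < k" for j
      using that fs gs by simp
    have arg: "set (?arg hs) \<subseteq> A"
    proof -
      have "(?bs ! j) (hs ! j) \<in> A" if "j < k" for j
        using that fs bs[OF that] by (simp add: monom_U_apply polys.const subset_iff)
      then show ?thesis
        using hs by (auto intro!: act_fun_polys gprod_closed dest!: in_set_takeD)
    qed
    have T1: "cmult S (T1 S k g X (?arg hs)) (U_elem (gprod S hs)) =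
        monom_U (T1_coeff k g X (?arg hs)) (g \<otimes>\<^bsub>G\<^esub> gprod S hs)"
      unfolding T1_eq using cmult_monom[OF g gprod_closed[OF hs(1)]] by simp
    show ?thesis
    proof (cases "hs = gs")
      case True
      have eq: "?arg gs = map (\<lambda>j. act_fun S (gprod S (take j gs)) (fs ! j)) [0..<k]"
        by (simp add: bs) (simp add: monom_U_def)
      show ?thesis unfolding T1 unfolding True eq by simp
    next
      case False
      then obtain i where i: "i < k" "hs ! i \<noteq> gs ! i"
        using hs(2) gs(1) by (metis nth_equalityI)
      have "?arg hs ! i = (\<lambda>p. 0)"
        using i by (simp add: bs) (simp add: monom_U_def)
      then have "T1_coeff k g X (?arg hs) p = 0"
        using T1_coeff_zero_argument[OF X g _ arg i(1)] by simp
      then show ?thesis unfolding T1 using False by (simp add: monom_U_apply)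
    qed
  qed
  have "T_map S k g X ?bs m p = (\<Sum>hs\<in>?L. if hs = gs then ?R m p else 0)"
    unfolding T_map_def T2_def by (intro sum.cong refl summand) auto
  also have "\<dots> = ?R m p"
    using gs finite_lists_length_eq[OF finite_group, of k] by simp
  finally show "T_map S k g X ?bs m p = ?R m p" .
qed

lemma gprod_replicate_one: "gprod S (replicate j \<one>\<^bsub>G\<^esub>) = \<one>\<^bsub>G\<^esub>"
  by (induction j) (auto simp: gprod_def)

lemma gprod_insert:
  "\<beta> \<in> carrier G \<Longrightarrow> gprod S (replicate i \<one>\<^bsub>G\<^esub> @ \<beta> # replicate j \<one>\<^bsub>G\<^esub>) = \<beta>"
  using gprod_replicate_one[of j] by (induction i) (auto simp: gprod_def)

lemma T_map_one:
  assumes X: "X \<in> sections S g k" and g: "g \<in> carrier G"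
    and fs: "length fs = k" "set fs \<subseteq> A"
  shows "T_map S k g X (map (\<lambda>f. monom_U f \<one>\<^bsub>G\<^esub>) fs) = monom_U (T1_coeff k g X fs) g"
proof -
  have 1: "map (\<lambda>f. monom_U f \<one>\<^bsub>G\<^esub>) fs = map2 monom_U fs (replicate k \<one>\<^bsub>G\<^esub>)"
    using fs(1) by (intro nth_equalityI) auto
  have 2: "map (\<lambda>j. act_fun S (gprod S (take j (replicate k \<one>\<^bsub>G\<^esub>))) (fs ! j)) [0..<k] = fs"
    using fs by (intro nth_equalityI) (auto simp: gprod_replicate_one subset_iff intro!: act_fun_one)
  have "T_map S k g X (map2 monom_U fs (replicate k \<one>\<^bsub>G\<^esub>)) =
      monom_U (T1_coeff k g X fs) (g \<otimes>\<^bsub>G\<^esub> gprod S (replicate k \<one>\<^bsub>G\<^esub>))"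
    using T_map_monom[OF X g fs, of "replicate k \<one>\<^bsub>G\<^esub>"] unfolding 2
    by (simp add: set_replicate_conv_if)
  then show ?thesis using g unfolding 1 gprod_replicate_one by simp
qed

lemma T_map_insert:
  assumes X: "X \<in> sections S g k" and g: "g \<in> carrier G" and \<beta>: "\<beta> \<in> carrier G"
    and us: "set us \<subseteq> A" and b: "b \<in> A" and ws: "set ws \<subseteq> A"
    and len: "Suc (length us + length ws) = k"
  shows "T_map S k g X (map (\<lambda>f. monom_U f \<one>\<^bsub>G\<^esub>) us @ monom_U b \<beta> # map (\<lambda>f. monom_U f \<one>\<^bsub>G\<^esub>) ws) =
    monom_U (T1_coeff k g X (us @ b # map (act_fun S \<beta>) ws)) (g \<otimes>\<^bsub>G\<^esub> \<beta>)"
proof -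
  let ?fs = "us @ b # ws"
  let ?gs = "replicate (length us) \<one>\<^bsub>G\<^esub> @ \<beta> # replicate (length ws) \<one>\<^bsub>G\<^esub>"
  have rep: "map2 monom_U fs (replicate (length fs) \<one>\<^bsub>G\<^esub>) = map (\<lambda>f. monom_U f \<one>\<^bsub>G\<^esub>) fs" for fs
    by (intro nth_equalityI) auto
  have 1: "map (\<lambda>f. monom_U f \<one>\<^bsub>G\<^esub>) us @ monom_U b \<beta> # map (\<lambda>f. monom_U f \<one>\<^bsub>G\<^esub>) ws =
      map2 monom_U ?fs ?gs"
    by (simp add: rep)
  have 2: "map (\<lambda>j. act_fun S (gprod S (take j ?gs)) (?fs ! j)) [0..<k] = us @ b # map (act_fun S \<beta>) ws"
  proof (rule nth_equalityI)
    show "length (map (\<lambda>j. act_fun S (gprod S (take j ?gs)) (?fs ! j)) [0..<k]) =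
        length (us @ b # map (act_fun S \<beta>) ws)" using len by simp
    fix j assume "j < length (map (\<lambda>j. act_fun S (gprod S (take j ?gs)) (?fs ! j)) [0..<k])"
    then have j: "j < k" by simp
    consider "j < length us" | "j = length us" | i where "j = length us + Suc i" "i < length ws"
    proof (cases "j \<le> length us")
      case False
      then have "j = length us + Suc (j - length us - 1)" "j - length us - 1 < length ws"
        using j len by auto
      then show ?thesis using that(3) by blast
    qed (use that in linarith)
    then show "map (\<lambda>j. act_fun S (gprod S (take j ?gs)) (?fs ! j)) [0..<k] ! j =
        (us @ b # map (act_fun S \<beta>) ws) ! j"
    proof cases
      case 1
      then show ?thesis using j us by (simp add: nth_append gprod_replicate_one act_fun_one subset_iff)
    next
      case 2
      then show ?thesis using j b by (simp add: nth_append gprod_replicate_one act_fun_one)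
    next
      case 3
      then show ?thesis using j \<beta> by (simp add: nth_append gprod_insert)
    qed
  qed
  have "T_map S k g X (map2 monom_U ?fs ?gs) =
      monom_U (T1_coeff k g X (us @ b # map (act_fun S \<beta>) ws)) (g \<otimes>\<^bsub>G\<^esub> gprod S ?gs)"
    unfolding 2[symmetric] using us b ws \<beta> len by (intro T_map_monom[OF X g]) auto
  then show ?thesis unfolding 1 using gprod_insert[OF \<beta>] by simp
qed

end

section \<open>The pre-Lie product and its invariance\<close>

context abelian_lin_action
begin

text \<open>
  The component of \<open>X \<otimes> \<Lambda>\<^sub>g\<close> at \<open>I \<union> N\<^sup>g\<close> is the one of \<open>X\<close> at \<open>I\<close> up to sign.
\<close>

lemma section_invariant:
  assumes X: "X \<in> sections S g k" and inv: "invariant S (tensor_Lambda S g X)"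
    and h: "h \<in> carrier G" and I: "I \<subseteq> fix_idx S g"
  shows "X (\<lambda>i. weight S h i * p i) I =
     (\<Prod>i\<in>I. weight S h i) * (\<Prod>i\<in>normal_idx S g. weight S h i) * X p I"
proof -
  let ?N = "normal_idx S g" and ?q = "\<lambda>i. weight S h i * p i"
  let ?T = "I \<union> ?N"
  have fin: "finite I" "finite ?N" using I finite_subset[OF I] by auto
  have disj: "I \<inter> ?N = {}" using I idx_disjoint[of g] by blast
  have Tn: "?T \<subseteq> {..<n}" using I idx_subset by blast
  let ?w = "wedge (sorted_list_of_set I @ sorted_list_of_set ?N) ?T"
  have w: "?w \<noteq> 0"
    using wedge_distinct_nonzero[of "sorted_list_of_set I @ sorted_list_of_set ?N"] fin disj by simp
  have tensor: "tensor_Lambda S g X r ?T = X r I * ?w" for r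
  proof -
    have "tensor_Lambda S g X r ?T = (\<Sum>P\<in>Pow ?T. if P = I then X r I * ?w else 0)"
      unfolding tensor_Lambda_def wedge_mult_def Lambda_def ys_def
    proof (intro sum.cong refl)
      fix P assume P: "P \<in> Pow ?T"
      have "?T - P = ?N \<longleftrightarrow> P = I" using P disj by blast
      moreover have "?T - I = ?N" using disj by blast
      ultimately show "X r P * wedge (sorted_list_of_set ?N) (?T - P) *
          wedge (sorted_list_of_set P @ sorted_list_of_set (?T - P)) ?T =
        (if P = I then X r I * ?w else 0)"
        by (simp add: wedge_sorted_eq)
    qed
    also have "\<dots> = X r I * ?w" using fin by simp
    finally show ?thesis .
  qed
  have "push_forward S h (tensor_Lambda S g X) p ?T = tensor_Lambda S g X p ?T"
    using inv h by (simp add: invariant_def)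
  then have a: "(\<Prod>i\<in>?T. weight S (inv\<^bsub>G\<^esub> h) i) * X ?q I = X p I"
    using w by (simp add: push_forward_def act_point_inv[OF h] tensor)
  have b: "(\<Prod>i\<in>?T. weight S (inv\<^bsub>G\<^esub> h) i) * (\<Prod>i\<in>?T. weight S h i) = 1"
    unfolding prod.distrib[symmetric] using Tn weight_inv[OF h] by (intro prod.neutral) auto
  have "(\<Prod>i\<in>?T. weight S h i) * X p I =
      ((\<Prod>i\<in>?T. weight S (inv\<^bsub>G\<^esub> h) i) * (\<Prod>i\<in>?T. weight S h i)) * X ?q I"
    by (simp only: a[symmetric] mult_ac)
  then have "X ?q I = (\<Prod>i\<in>?T. weight S h i) * X p I" by (simp only: b mult_1_left)
  then show ?thesis using fin disj by (simp add: prod.union_disjoint)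
qed

lemma mv_apply_act:
  assumes h: "h \<in> carrier G" and fs: "\<And>j. j < m \<Longrightarrow> fs ! j \<in> A" "m \<le> length fs"
  shows "mv_apply S m X (map (act_fun S h) fs) p =
    (\<Sum>T | T \<subseteq> {..<n} \<and> card T = m. X p T * (\<Prod>i\<in>T. weight S h i) *
     (1 / fact m * (\<Sum>\<sigma> | \<sigma> permutes {..<m}. of_int (sign \<sigma>) *
        (\<Prod>j<m. partial (sorted_list_of_set T ! \<sigma> j) (fs ! j) (\<lambda>i. weight S h i * p i)))))"
  unfolding mv_apply_def
proof (intro sum.cong refl)
  fix T assume T: "T \<in> {T. T \<subseteq> {..<n} \<and> card T = m}"
  then have E: "length (sorted_list_of_set T) = m" "set (sorted_list_of_set T) = T"
    using finite_subset[of T "{..<n}"] by auto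
  have "(\<Prod>j<m. partial (sorted_list_of_set T ! \<sigma> j) (map (act_fun S h) fs ! j) p) =
      (\<Prod>i\<in>T. weight S h i) *
      (\<Prod>j<m. partial (sorted_list_of_set T ! \<sigma> j) (fs ! j) (\<lambda>i. weight S h i * p i))"
    if \<sigma>: "\<sigma> permutes {..<m}" for \<sigma>
  proof -
    have "(\<Prod>j<m. partial (sorted_list_of_set T ! \<sigma> j) (map (act_fun S h) fs ! j) p) =
      (\<Prod>j<m. weight S h (sorted_list_of_set T ! \<sigma> j) *
         partial (sorted_list_of_set T ! \<sigma> j) (fs ! j) (\<lambda>i. weight S h i * p i))"
      using fs by (intro prod.cong refl) (simp add: act_fun_eq[OF h] partial_scale[OF fs(1), where d = "weight S h"])
    then show ?thesis
      using prod_permuted_nth[of \<sigma> "sorted_list_of_set T" "weight S h"] \<sigma> E by (simp add: prod.distrib)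
  qed
  then have "(\<Sum>\<sigma> | \<sigma> permutes {..<m}. of_int (sign \<sigma>) *
        (\<Prod>j<m. partial (sorted_list_of_set T ! \<sigma> j) (map (act_fun S h) fs ! j) p)) =
     (\<Prod>i\<in>T. weight S h i) * (\<Sum>\<sigma> | \<sigma> permutes {..<m}. of_int (sign \<sigma>) *
        (\<Prod>j<m. partial (sorted_list_of_set T ! \<sigma> j) (fs ! j) (\<lambda>i. weight S h i * p i)))"
    unfolding sum_distrib_left by (intro sum.cong refl) (simp add: mult_ac)
  then show "X p T * (1 / fact m * (\<Sum>\<sigma> | \<sigma> permutes {..<m}. of_int (sign \<sigma>) *
        (\<Prod>j<m. partial (sorted_list_of_set T ! \<sigma> j) (map (act_fun S h) fs ! j) p))) =
     X p T * (\<Prod>i\<in>T. weight S h i) *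
     (1 / fact m * (\<Sum>\<sigma> | \<sigma> permutes {..<m}. of_int (sign \<sigma>) *
        (\<Prod>j<m. partial (sorted_list_of_set T ! \<sigma> j) (fs ! j) (\<lambda>i. weight S h i * p i))))"
    by simp
qed

lemma Omega_act:
  assumes g: "g \<in> carrier G" and h: "h \<in> carrier G"
    and fs: "\<And>j. j < codim S g \<Longrightarrow> fs ! j \<in> A" "codim S g \<le> length fs"
  shows "Omega S g (map (act_fun S h) fs) p =
    (\<Prod>i\<in>normal_idx S g. weight S h i) * Omega S g fs (\<lambda>i. weight S h i * p i)"
proof -
  let ?a = "codim S g"
  have fs': "map (act_fun S h) fs ! j \<in> A" if "j < ?a" for j
    using fs that by (simp add: act_fun_polys[OF h])
  have z: "(\<lambda>i. weight S h i * zpoint S g \<sigma> j p i) = zpoint S g \<sigma> j (\<lambda>i. weight S h i * p i)" for \<sigma> j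
    by (auto simp: zpoint_def fun_eq_iff)
  have "(\<Prod>j<?a. difference_quotient (weight S g (ys S g ! \<sigma> j)) (ys S g ! \<sigma> j)
          (map (act_fun S h) fs ! j) (zpoint S g \<sigma> j p)) =
      (\<Prod>i\<in>normal_idx S g. weight S h i) *
      (\<Prod>j<?a. difference_quotient (weight S g (ys S g ! \<sigma> j)) (ys S g ! \<sigma> j)
          (fs ! j) (zpoint S g \<sigma> j (\<lambda>i. weight S h i * p i)))"
    if \<sigma>: "\<sigma> permutes {..<?a}" for \<sigma>
  proof -
    have "difference_quotient (weight S g (ys S g ! \<sigma> j)) (ys S g ! \<sigma> j)
          (map (act_fun S h) fs ! j) (zpoint S g \<sigma> j p) = weight S h (ys S g ! \<sigma> j) *
        difference_quotient (weight S g (ys S g ! \<sigma> j)) (ys S g ! \<sigma> j)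
          (fs ! j) (zpoint S g \<sigma> j (\<lambda>i. weight S h i * p i))" if j: "j < ?a" for j
    proof -
      have "\<sigma> j < ?a" using permutes_in_image[OF \<sigma>, of j] j by simp
      then have "weight S h (ys S g ! \<sigma> j) \<noteq> 0" using weight_nonzero[OF h] weight_ys(1)[OF g] by blast
      from difference_quotient_scale[where d = "weight S h", OF fs(1)[OF j] this] show ?thesis
        using j fs(2) by (simp add: act_fun_eq[OF h] z)
    qed
    then have "(\<Prod>j<?a. difference_quotient (weight S g (ys S g ! \<sigma> j)) (ys S g ! \<sigma> j)
          (map (act_fun S h) fs ! j) (zpoint S g \<sigma> j p)) =
      (\<Prod>j<?a. weight S h (ys S g ! \<sigma> j) *
        difference_quotient (weight S g (ys S g ! \<sigma> j)) (ys S g ! \<sigma> j)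
          (fs ! j) (zpoint S g \<sigma> j (\<lambda>i. weight S h i * p i)))"
      by (intro prod.cong refl) simp
    then show ?thesis
      using prod_permuted_nth[of \<sigma> "ys S g" "weight S h"] \<sigma> set_ys[of g] length_ys[OF g]
      by (simp add: prod.distrib)
  qed
  then show ?thesis
    using Omega_eq[OF g fs'] Omega_eq[OF g fs(1)]
    by (simp add: Omega_formula_def sum_distrib_left mult_ac)
qed

text \<open>
  Transporting the arguments by \<open>h\<close> multiplies each derivative in \<open>X\<close> and each difference quotient in
  \<open>\<Omega>\<^sub>g\<close> by the weight of its direction. The product of all these weights is the one by which \<open>h\<close>
  multiplies the coefficients of \<open>X\<close>.
\<close>

lemma T1_coeff_act:
  assumes X: "X \<in> sections S g k" and inv: "invariant S (tensor_Lambda S g X)"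
    and g: "g \<in> carrier G" and h: "h \<in> carrier G" and fs: "length fs = k" "set fs \<subseteq> A"
  shows "T1_coeff k g X (map (act_fun S h) fs) = act_fun S h (T1_coeff k g X fs)"
proof
  fix p
  let ?m = "k - codim S g" and ?q = "\<lambda>i. weight S h i * p i"
  show "T1_coeff k g X (map (act_fun S h) fs) p = act_fun S h (T1_coeff k g X fs) p"
  proof (cases "k < codim S g")
    case True
    then show ?thesis by (simp add: T1_coeff_small[OF X True] act_fun_eq[OF h])
  next
    case False
    let ?W = "\<Prod>i\<in>normal_idx S g. weight S h i"
    have take_poly: "take ?m fs ! j \<in> A" if "j < ?m" for j
      using that fs by (simp add: subset_iff)
    have "mv_apply S ?m X (map (act_fun S h) (take ?m fs)) p * ?W = mv_apply S ?m X (take ?m fs) ?q"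
    proof -
      let ?c = "\<lambda>T. 1 / fact ?m * (\<Sum>\<sigma> | \<sigma> permutes {..<?m}. of_int (sign \<sigma>) *
        (\<Prod>j<?m. partial (sorted_list_of_set T ! \<sigma> j) (take ?m fs ! j) ?q))"
      have "X p T * (\<Prod>i\<in>T. weight S h i) * ?c T * ?W = X ?q T * ?c T" for T
      proof (cases "T \<subseteq> fix_idx S g")
        case True
        show ?thesis unfolding section_invariant[OF X inv h True] by (simp only: mult_ac)
      next
        case False
        then have "X p T = 0" "X ?q T = 0" using sectionsD(3)[OF X] by blast+
        then show ?thesis by simp
      qed
      moreover have "mv_apply S ?m X (map (act_fun S h) (take ?m fs)) p =
          (\<Sum>T | T \<subseteq> {..<n} \<and> card T = ?m. X p T * (\<Prod>i\<in>T. weight S h i) * ?c T)"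
        using mv_apply_act[OF h take_poly, where X = X and p = p] fs by simp
      ultimately show ?thesis
        unfolding mv_apply_def[of S ?m X "take ?m fs"] by (simp only: sum_distrib_right)
    qed
    moreover have "Omega S g (map (act_fun S h) (drop ?m fs)) p = ?W * Omega S g (drop ?m fs) ?q"
      using nth_drop_polys[OF fs] False fs by (intro Omega_act[OF g h]) auto
    ultimately show ?thesis
      unfolding T1_coeff_def act_fun_eq[OF h] take_map drop_map by simp
  qed
qed

text \<open>
  The pre-Lie product on functions. The inner value carries \<open>U\<^sub>\<beta>\<close>, which acts on all later arguments when
  it is moved to the right.
\<close>

definition pre_lie_coeff :: "nat \<Rightarrow> nat \<Rightarrow> 'g \<Rightarrow> 'g \<Rightarrow> mvfield \<Rightarrow> mvfield \<Rightarrow> pfun list \<Rightarrow> pfun" where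
  "pre_lie_coeff k l \<alpha> \<beta> X Y fs p = (\<Sum>i = 1..k. (-1) powi ((int i - 1) * (int l - 1)) *
     T1_coeff k \<alpha> X (take (i - 1) fs @ T1_coeff l \<beta> Y (take l (drop (i - 1) fs)) #
       map (act_fun S \<beta>) (drop (i - 1 + l) fs)) p)"

end

locale section_pair = abelian_lin_action S for S :: "('g, 'v::real_vector) lin_action" +
  fixes \<alpha> \<beta> :: 'g and k l :: nat and X Y :: mvfield
  assumes ab: "\<alpha> \<in> carrier (grp S)" "\<beta> \<in> carrier (grp S)"
    and X: "X \<in> sections S \<alpha> k" "invariant S (tensor_Lambda S \<alpha> X)"
    and Y: "Y \<in> sections S \<beta> l" "invariant S (tensor_Lambda S \<beta> Y)"
begin

abbreviation product where "product \<equiv> pre_lie k l (T_map S k \<alpha> X) (T_map S l \<beta> Y)"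
abbreviation product_coeff where "product_coeff \<equiv> pre_lie_coeff k l \<alpha> \<beta> X Y"

lemma set_take_drop_polys: "set fs \<subseteq> A \<Longrightarrow> set (take i fs) \<subseteq> A" "set fs \<subseteq> A \<Longrightarrow> set (drop i fs) \<subseteq> A"
  using set_take_subset set_drop_subset by fast+

lemma inner_polys:
  assumes "length fs = k + l - 1" "set fs \<subseteq> A" "1 \<le> i" "i \<le> k"
  shows "T1_coeff l \<beta> Y (take l (drop (i - 1) fs)) \<in> A"
  using assms by (intro T1_coeff_polys[OF Y(1) ab(2)] set_take_drop_polys) auto

lemma outer_arguments:
  assumes "length fs = k + l - 1" "set fs \<subseteq> A" "1 \<le> i" "i \<le> k"
  shows "length (take (i - 1) fs @ T1_coeff l \<beta> Y (take l (drop (i - 1) fs)) #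
       map (act_fun S \<beta>) (drop (i - 1 + l) fs)) = k"
    and "set (take (i - 1) fs @ T1_coeff l \<beta> Y (take l (drop (i - 1) fs)) #
       map (act_fun S \<beta>) (drop (i - 1 + l) fs)) \<subseteq> A"
proof -
  show "length (take (i - 1) fs @ T1_coeff l \<beta> Y (take l (drop (i - 1) fs)) #
       map (act_fun S \<beta>) (drop (i - 1 + l) fs)) = k"
    using assms by auto
  show "set (take (i - 1) fs @ T1_coeff l \<beta> Y (take l (drop (i - 1) fs)) #
       map (act_fun S \<beta>) (drop (i - 1 + l) fs)) \<subseteq> A"
    using inner_polys[OF assms] set_take_drop_polys(1)[OF assms(2), of "i - 1"]
      set_take_drop_polys(2)[OF assms(2), of "i - 1 + l"]
    by (auto intro!: act_fun_polys[OF ab(2)])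
qed

lemma pre_lie_coeff_polys:
  assumes "length fs = k + l - 1" "set fs \<subseteq> A"
  shows "product_coeff fs \<in> A"
  unfolding pre_lie_coeff_def[abs_def]
  using outer_arguments[OF assms]
  by (intro polys_sum polys_cmult T1_coeff_polys[OF X(1) ab(1)]) auto

lemma pre_lie_monom:
  assumes fs: "length fs = k + l - 1" "set fs \<subseteq> A"
  shows "product (map (\<lambda>f. monom_U f \<one>\<^bsub>G\<^esub>) fs) =
     monom_U (product_coeff fs) (\<alpha> \<otimes>\<^bsub>G\<^esub> \<beta>)"
proof (intro ext)
  fix m p
  let ?M = "map (\<lambda>f. monom_U f \<one>\<^bsub>G\<^esub>)"
  have "T_map S k \<alpha> X (take (i - 1) (?M fs) @ [T_map S l \<beta> Y (take l (drop (i - 1) (?M fs)))] @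
        drop (i - 1 + l) (?M fs)) =
     monom_U (T1_coeff k \<alpha> X (take (i - 1) fs @ T1_coeff l \<beta> Y (take l (drop (i - 1) fs)) #
       map (act_fun S \<beta>) (drop (i - 1 + l) fs))) (\<alpha> \<otimes>\<^bsub>G\<^esub> \<beta>)"
    if i: "1 \<le> i" "i \<le> k" for i
  proof -
    have "T_map S l \<beta> Y (?M (take l (drop (i - 1) fs))) =
        monom_U (T1_coeff l \<beta> Y (take l (drop (i - 1) fs))) \<beta>"
      using fs i by (intro T_map_one[OF Y(1) ab(2)] set_take_drop_polys) auto
    then show ?thesis
      using T_map_insert[OF X(1) ab set_take_drop_polys(1)[OF fs(2)] inner_polys[OF fs i]
          set_take_drop_polys(2)[OF fs(2)], of "i - 1" "i - 1 + l"] fs(1) i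
      by (simp add: take_map drop_map)
  qed
  then have "product (?M fs) m p =
    (\<Sum>i = 1..k. (-1) powi ((int i - 1) * (int l - 1)) *
     monom_U (T1_coeff k \<alpha> X (take (i - 1) fs @ T1_coeff l \<beta> Y (take l (drop (i - 1) fs)) #
       map (act_fun S \<beta>) (drop (i - 1 + l) fs))) (\<alpha> \<otimes>\<^bsub>G\<^esub> \<beta>) m p)"
    unfolding pre_lie_def by (intro sum.cong refl arg_cong2[where f = "(*)"]) simp
  then show "product (?M fs) m p =
     monom_U (product_coeff fs) (\<alpha> \<otimes>\<^bsub>G\<^esub> \<beta>) m p"
    by (auto simp: monom_U_def pre_lie_coeff_def)
qed

lemma pre_lie_coeff_act:
  assumes h: "h \<in> carrier G" and fs: "length fs = k + l - 1" "set fs \<subseteq> A"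
  shows "product_coeff (map (act_fun S h) fs) = act_fun S h (product_coeff fs)"
proof -
  let ?arg = "\<lambda>fs i. take (i - 1) fs @ T1_coeff l \<beta> Y (take l (drop (i - 1) fs)) #
       map (act_fun S \<beta>) (drop (i - 1 + l) fs)"
  have "T1_coeff k \<alpha> X (?arg (map (act_fun S h) fs) i) = act_fun S h (T1_coeff k \<alpha> X (?arg fs i))"
    if i: "1 \<le> i" "i \<le> k" for i
  proof -
    have "T1_coeff l \<beta> Y (map (act_fun S h) (take l (drop (i - 1) fs))) =
        act_fun S h (T1_coeff l \<beta> Y (take l (drop (i - 1) fs)))"
      using fs i by (intro T1_coeff_act[OF Y ab(2) h] set_take_drop_polys) auto
    moreover have "act_fun S \<beta> (act_fun S h f) = act_fun S h (act_fun S \<beta> f)" if "f \<in> A" for f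
      using act_fun_mult[OF ab(2) h that] act_fun_mult[OF h ab(2) that] m_comm[OF ab(2) h] by simp
    ultimately have "?arg (map (act_fun S h) fs) i = map (act_fun S h) (?arg fs i)"
      using set_take_drop_polys(2)[OF fs(2), of "i - 1 + l"] by (auto simp: take_map drop_map)
    then show ?thesis
      using T1_coeff_act[OF X ab(1) h outer_arguments[OF fs i]] by simp
  qed
  then show ?thesis
    unfolding pre_lie_coeff_def[abs_def] act_fun_eq[OF h]
    by (intro ext sum.cong refl arg_cong2[where f = "(*)"]) (auto simp: fun_eq_iff)
qed

text \<open>
  By equivariance, conjugation with \<open>U\<^sub>h\<close> undoes the action of \<open>h\<close> on the arguments, so all terms of the
  average over the group agree. Commutativity keeps the result at \<open>U\<^bsub>\<alpha>\<beta>\<^esub>\<close>.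
\<close>

lemma L1_pre_lie:
  assumes fs: "length fs = k + l - 1" "set fs \<subseteq> A"
  shows "L1 S product fs =
     monom_U (product_coeff fs) (\<alpha> \<otimes>\<^bsub>G\<^esub> \<beta>)"
proof -
  let ?C = "product_coeff" and ?g = "\<alpha> \<otimes>\<^bsub>G\<^esub> \<beta>"
  have g: "?g \<in> carrier G" using ab by simp
  have "cmult S (cmult S (U_elem (inv\<^bsub>G\<^esub> h))
       (product
         (map (\<lambda>f. monom_U (act_fun S h f) \<one>\<^bsub>G\<^esub>) fs))) (U_elem h) = monom_U (?C fs) ?g"
    if h: "h \<in> carrier G" for h
  proof -
    have set: "set (map (act_fun S h) fs) \<subseteq> A" using fs(2) act_fun_polys[OF h] by auto
    have 1: "map (\<lambda>f. monom_U (act_fun S h f) \<one>\<^bsub>G\<^esub>) fs =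
        map (\<lambda>f. monom_U f \<one>\<^bsub>G\<^esub>) (map (act_fun S h) fs)" by simp
    have "product
         (map (\<lambda>f. monom_U (act_fun S h f) \<one>\<^bsub>G\<^esub>) fs) = monom_U (act_fun S h (?C fs)) ?g"
      unfolding 1 using pre_lie_monom[OF _ set] pre_lie_coeff_act[OF h fs] fs(1) by simp
    moreover have "act_fun S (inv\<^bsub>G\<^esub> h) (act_fun S h (?C fs)) = ?C fs"
      using act_fun_mult[OF _ h pre_lie_coeff_polys[OF fs], of "inv\<^bsub>G\<^esub> h"] h
        act_fun_one[OF pre_lie_coeff_polys[OF fs]] by simp
    moreover have "inv\<^bsub>G\<^esub> h \<otimes>\<^bsub>G\<^esub> ?g \<otimes>\<^bsub>G\<^esub> h = ?g"
    proof -
      have "inv\<^bsub>G\<^esub> h \<otimes>\<^bsub>G\<^esub> ?g \<otimes>\<^bsub>G\<^esub> h = ?g \<otimes>\<^bsub>G\<^esub> inv\<^bsub>G\<^esub> h \<otimes>\<^bsub>G\<^esub> h"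
        using m_comm[OF inv_closed[OF h] g] by simp
      then show ?thesis using h g by (simp add: m_assoc)
    qed
    ultimately show ?thesis using h g by (simp add: cmult_monom)
  qed
  then have "L1 S product fs m p = monom_U (?C fs) ?g m p" for m p
    using order_gt_0_iff_finite finite_group carrier_not_empty by (simp add: L1_def order_def)
  then show ?thesis by blast
qed

end

section \<open>Evaluation on coordinate functions\<close>

definition shifted :: "point \<Rightarrow> nat \<Rightarrow> pfun" where
  "shifted p i = (\<lambda>q. q i - p i)"

lemma shifted_polys: "i \<in> I \<Longrightarrow> shifted p i \<in> polys I"
  using polys_affine[of i I 1 "p i"] by (simp add: shifted_def)

lemma set_map_shifted: "set vs \<subseteq> I \<Longrightarrow> set (map (shifted p) vs) \<subseteq> polys I"
  by (auto intro: shifted_polys)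

lemma partial_shifted: "partial e (shifted p i) q = (if e = i then 1 else 0)"
  using partial_affine[of e 1 i "p i" q] by (simp add: shifted_def)

lemma difference_quotient_shifted:
  "c \<noteq> 1 \<Longrightarrow> difference_quotient c e (shifted p i) q = (if e = i then 1 else 0)"
  using difference_quotient_affine[of c e 1 i "p i"] by (simp add: shifted_def)

lemma prod_update_sum:
  fixes D :: "nat \<Rightarrow> 'f \<Rightarrow> complex"
  assumes "i < m" "m \<le> length fs" and D: "D i f = (\<Sum>t\<in>Q. c t * D i (h t))"
  shows "(\<Prod>j<m. D j (fs[i := f] ! j)) = (\<Sum>t\<in>Q. c t * (\<Prod>j<m. D j (fs[i := h t] ! j)))"
proof -
  have split: "(\<Prod>j<m. D j (fs[i := x] ! j)) = D i x * (\<Prod>j\<in>{..<m} - {i}. D j (fs ! j))" for x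
    using assms(1,2) by (subst prod.remove[of _ i]) (auto intro!: prod.cong)
  show ?thesis unfolding split D by (simp add: sum_distrib_right mult.assoc)
qed

lemma sum_scaled_swap:
  fixes c :: "'t \<Rightarrow> complex"
  shows "(\<Sum>x\<in>B. s x * (\<Sum>t\<in>Q. c t * f x t)) = (\<Sum>t\<in>Q. c t * (\<Sum>x\<in>B. s x * f x t))"
proof -
  have "(\<Sum>x\<in>B. s x * (\<Sum>t\<in>Q. c t * f x t)) = (\<Sum>x\<in>B. \<Sum>t\<in>Q. c t * (s x * f x t))"
    by (simp add: sum_distrib_left mult_ac)
  also have "\<dots> = (\<Sum>t\<in>Q. \<Sum>x\<in>B. c t * (s x * f x t))" by (rule sum.swap)
  finally show ?thesis by (simp add: sum_distrib_left)
qed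

context abelian_lin_action
begin

lemma mv_apply_shifted:
  assumes "length vs = m"
  shows "mv_apply S m X (map (shifted p) vs) q =
    (\<Sum>J | J \<subseteq> {..<n} \<and> card J = m. X q J * (1 / fact m * wedge vs J))"
  unfolding mv_apply_def
proof (intro sum.cong refl arg_cong2[where f = "(*)"])
  fix J assume J: "J \<in> {J. J \<subseteq> {..<n} \<and> card J = m}"
  then have "finite J" "card J = length vs" using assms finite_subset[of J "{..<n}"] by auto
  from det_coordinates[OF this, of "\<lambda>j e. partial e (map (shifted p) vs ! j) q"] assms
  show "(\<Sum>\<sigma> | \<sigma> permutes {..<m}. of_int (sign \<sigma>) *
        (\<Prod>j<m. partial (sorted_list_of_set J ! \<sigma> j) (map (shifted p) vs ! j) q)) = wedge vs J"
    by (simp add: partial_shifted)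
qed

lemma sum_wedge_extend:
  assumes "I \<subseteq> {..<n}"
  shows "(\<Sum>e\<in>I. h e * wedge (us @ e # ws) I) = (\<Sum>e<n. h e * wedge (us @ e # ws) I)"
  using assms wedge_nonzeroD(3) by (intro sum.mono_neutral_left) fastforce+

lemma nth_slot [simp]: "(map f us @ y # zs) ! length us = y"
  by (metis length_map nth_append_length)

lemma nth_map_slot:
  assumes "j < length (us @ e # ws)" "j \<noteq> length us"
  shows "(map f us @ y # map f ws) ! j = f ((us @ e # ws) ! j)"
  using assms by (auto simp: nth_append nth_Cons split: nat.splits)

lemma mv_apply_slot:
  assumes "Suc (length us + length ws) = m"
  shows "mv_apply S m X (map (shifted p) us @ y # map (shifted p) ws) q =
    (\<Sum>J | J \<subseteq> {..<n} \<and> card J = m. X q J *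
      (1 / fact m * (\<Sum>e<n. partial e y q * wedge (us @ e # ws) J)))"
  unfolding mv_apply_def
proof (intro sum.cong refl arg_cong2[where f = "(*)"])
  fix J assume J: "J \<in> {J. J \<subseteq> {..<n} \<and> card J = m}"
  let ?fs = "map (shifted p) us @ y # map (shifted p) ws" and ?is = "us @ 0 # ws"
  have J': "finite J" "card J = length ?is" "length us < length ?is" "length ?is = m" "J \<subseteq> {..<n}"
    using J assms finite_subset[of J "{..<n}"] by auto
  have "(\<Sum>\<sigma> | \<sigma> permutes {..<length ?is}. of_int (sign \<sigma>) *
        (\<Prod>j<length ?is. partial (sorted_list_of_set J ! \<sigma> j) (?fs ! j) q)) =
      (\<Sum>e\<in>J. partial e (?fs ! length us) q * wedge (?is[length us := e]) J)"
  proof (rule det_slot[OF J'(1,2,3)])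
    fix j e assume "j < length ?is" "j \<noteq> length us" "e \<in> J"
    then show "partial e (?fs ! j) q = (if e = ?is ! j then 1 else 0)"
      using nth_map_slot[of j us 0 ws "shifted p" y] partial_shifted[of e p "?is ! j" q] by simp
  qed
  also have "\<dots> = (\<Sum>e\<in>J. partial e y q * wedge (us @ e # ws) J)" by simp
  finally show "(\<Sum>\<sigma> | \<sigma> permutes {..<m}. of_int (sign \<sigma>) *
        (\<Prod>j<m. partial (sorted_list_of_set J ! \<sigma> j) (?fs ! j) q)) =
      (\<Sum>e<n. partial e y q * wedge (us @ e # ws) J)"
    unfolding J'(4) sum_wedge_extend[OF J'(5)] .
qed

text \<open>
  All difference quotients of coordinate functions are constant, hence so is the cocycle, and its values
  are those of \<open>\<Lambda>\<^sub>g\<close>.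
\<close>

lemma Omega_shifted:
  assumes g: "g \<in> carrier G" and vs: "length vs = codim S g" "set vs \<subseteq> {..<n}"
  shows "Omega S g (map (shifted p) vs) q = 1 / fact (codim S g) * wedge vs (normal_idx S g)"
proof -
  let ?fs = "map (shifted p) vs"
  have fs: "?fs ! j \<in> A" if "j < codim S g" for j
    using that vs by (auto intro!: shifted_polys simp: subset_iff)
  have "(\<Sum>\<sigma> | \<sigma> permutes {..<codim S g}. of_int (sign \<sigma>) *
       (\<Prod>j<codim S g. difference_quotient (weight S g (ys S g ! \<sigma> j)) (ys S g ! \<sigma> j) (?fs ! j)
          (zpoint S g \<sigma> j q))) =
     (\<Sum>\<sigma> | \<sigma> permutes {..<length vs}. of_int (sign \<sigma>) *
       (\<Prod>j<length vs. if sorted_list_of_set (normal_idx S g) ! \<sigma> j = vs ! j then 1 else 0))"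
    unfolding vs(1)
  proof (intro sum.cong refl arg_cong2[where f = "(*)"] prod.cong)
    fix \<sigma> j assume *: "\<sigma> \<in> {\<sigma>. \<sigma> permutes {..<codim S g}}" "j \<in> {..<codim S g}"
    then have "\<sigma> j < codim S g" using permutes_in_image[of \<sigma> "{..<codim S g}" j] by simp
    then show "difference_quotient (weight S g (ys S g ! \<sigma> j)) (ys S g ! \<sigma> j) (?fs ! j)
          (zpoint S g \<sigma> j q) = (if sorted_list_of_set (normal_idx S g) ! \<sigma> j = vs ! j then 1 else 0)"
      using * vs(1) weight_ys(2)[OF g] by (simp add: difference_quotient_shifted ys_def)
  qed
  also have "\<dots> = wedge vs (normal_idx S g)"
    by (rule det_coordinates) (simp_all add: vs codim_eq[OF g])
  finally show ?thesis using Omega_eq[OF g fs] by (simp add: Omega_formula_def)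
qed

text \<open>
  Where all normal coordinates vanish, the points \<open>(x, z\<^sup>j\<^sub>\<sigma>)\<close> coincide, and the difference quotients of
  \<open>y\<close> there are its partial derivatives.
\<close>

lemma Omega_slot:
  assumes g: "g \<in> carrier G" and len: "Suc (length us + length ws) = codim S g"
    and vs: "set us \<subseteq> {..<n}" "set ws \<subseteq> {..<n}" and y: "y \<in> A"
    and q: "\<And>i. i \<in> normal_idx S g \<Longrightarrow> q i = 0"
  shows "Omega S g (map (shifted p) us @ y # map (shifted p) ws) q =
    1 / fact (codim S g) * (\<Sum>e<n. partial e y q * wedge (us @ e # ws) (normal_idx S g))"
proof -
  let ?fs = "map (shifted p) us @ y # map (shifted p) ws" and ?is = "us @ 0 # ws"
  let ?N = "normal_idx S g"
  have "set ?fs \<subseteq> A" using set_map_shifted[OF vs(1), of p] set_map_shifted[OF vs(2), of p] y by auto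
  moreover have "length ?fs = codim S g" using len by simp
  ultimately have fs: "?fs ! j \<in> A" if "j < codim S g" for j
    using that by (metis nth_mem subsetD)
  have z: "zpoint S g \<sigma> j q = q" if "\<sigma> permutes {..<codim S g}" "j < codim S g" for \<sigma> j
  proof -
    have "q (ys S g ! \<sigma> m) = 0" if "m < j" for m
      using that \<open>j < codim S g\<close> permutes_in_image[OF \<open>\<sigma> permutes _\<close>, of m]
      by (intro q weight_ys(3)[OF g]) auto
    then show ?thesis by (auto simp: zpoint_def fun_eq_iff)
  qed
  let ?M = "\<lambda>j e. difference_quotient (weight S g e) e (?fs ! j) q"
  have lis: "length ?is = codim S g" using len by simp
  have "(\<Sum>\<sigma> | \<sigma> permutes {..<codim S g}. of_int (sign \<sigma>) *
       (\<Prod>j<codim S g. difference_quotient (weight S g (ys S g ! \<sigma> j)) (ys S g ! \<sigma> j) (?fs ! j)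
          (zpoint S g \<sigma> j q))) =
     (\<Sum>\<sigma> | \<sigma> permutes {..<length ?is}. of_int (sign \<sigma>) *
       (\<Prod>j<length ?is. ?M j (sorted_list_of_set ?N ! \<sigma> j)))"
    unfolding lis
    by (intro sum.cong refl arg_cong2[where f = "(*)"] prod.cong) (simp add: z ys_def)
  also have "\<dots> = (\<Sum>e\<in>?N. ?M (length us) e * wedge (?is[length us := e]) ?N)"
  proof (rule det_slot)
    show "card ?N = length ?is" using lis codim_eq[OF g] by simp
    fix j e assume *: "j < length ?is" "j \<noteq> length us" "e \<in> ?N"
    then have "weight S g e \<noteq> 1" using fix_idx_weight(2)[OF g] by simp
    then show "?M j e = (if e = ?is ! j then 1 else 0)"
      using nth_map_slot[OF *(1,2), of "shifted p" y] difference_quotient_shifted[of _ e p "?is ! j" q]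
      by simp
  qed auto
  also have "\<dots> = (\<Sum>e\<in>?N. partial e y q * wedge (us @ e # ws) ?N)"
    by (intro sum.cong refl) (simp add: difference_quotient_def q)
  finally show ?thesis
    using Omega_eq[OF g fs] sum_wedge_extend[OF idx_subset(2)] by (simp add: Omega_formula_def)
qed

lemma T1_coeff_sum:
  assumes g: "g \<in> carrier G" and k: "codim S g \<le> k" and fs: "length fs = k" "set fs \<subseteq> A"
    and i: "i < k" and Q: "finite Q" and h: "\<And>t. t \<in> Q \<Longrightarrow> h t \<in> A"
  shows "T1_coeff k g X (fs[i := (\<lambda>q. \<Sum>t\<in>Q. c t * h t q)]) p =
    (\<Sum>t\<in>Q. c t * T1_coeff k g X (fs[i := h t]) p)"
proof -
  let ?m = "k - codim S g" and ?s = "\<lambda>q. \<Sum>t\<in>Q. c t * h t q"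
  show ?thesis
  proof (cases "i < ?m")
    case True
    have mv: "mv_apply S ?m X ((take ?m fs)[i := ?s]) p =
        (\<Sum>t\<in>Q. c t * mv_apply S ?m X ((take ?m fs)[i := h t]) p)"
    proof -
      have "(\<Prod>j<?m. partial (E ! \<sigma> j) ((take ?m fs)[i := ?s] ! j) p) =
        (\<Sum>t\<in>Q. c t * (\<Prod>j<?m. partial (E ! \<sigma> j) ((take ?m fs)[i := h t] ! j) p))" for E \<sigma>
        using True fs k partial_sum[OF Q h]
        by (intro prod_update_sum[where D = "\<lambda>j f. partial (E ! \<sigma> j) f p"]) auto
      note prod_eq = this
      define \<Theta> where "\<Theta> = (\<lambda>T f. 1 / fact ?m * (\<Sum>\<sigma> | \<sigma> permutes {..<?m}. of_int (sign \<sigma>) *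
        (\<Prod>j<?m. partial (sorted_list_of_set T ! \<sigma> j) ((take ?m fs)[i := f] ! j) p)))"
      have "\<Theta> T ?s = (\<Sum>t\<in>Q. c t * \<Theta> T (h t))" for T
        unfolding \<Theta>_def prod_eq
        by (subst sum_scaled_swap) (simp add: sum_distrib_left mult_ac)
      moreover have "mv_apply S ?m X ((take ?m fs)[i := f]) p =
          (\<Sum>T | T \<subseteq> {..<n} \<and> card T = ?m. X p T * \<Theta> T f)" for f
        by (simp only: mv_apply_def \<Theta>_def)
      ultimately show ?thesis by (simp only: sum_scaled_swap[of "X p"])
    qed
    show ?thesis
      using True by (simp add: T1_coeff_def take_update_swap drop_update_cancel mv sum_distrib_right mult.assoc)
  next
    case False
    let ?a = "codim S g" and ?j = "i - ?m"
    have len: "length (drop ?m fs) = ?a" "?j < ?a" using fs k i False by auto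
    have polys: "(drop ?m fs)[?j := x] ! j \<in> A" if "x \<in> A" "j < ?a" for x j
      using that fs k len by (cases "j = ?j") (auto simp: subset_iff)
    have sA: "?s \<in> A" using h by (intro polys_sum polys_cmult)
    have "(\<Prod>j<?a. difference_quotient (w j) (E j) ((drop ?m fs)[?j := ?s] ! j) (z j)) =
        (\<Sum>t\<in>Q. c t * (\<Prod>j<?a. difference_quotient (w j) (E j) ((drop ?m fs)[?j := h t] ! j) (z j)))" for w E z
      using len difference_quotient_sum[OF Q h]
      by (intro prod_update_sum[where D = "\<lambda>j f. difference_quotient (w j) (E j) f (z j)"]) auto
    then have "Omega_formula g ((drop ?m fs)[?j := ?s]) p =
        (\<Sum>t\<in>Q. c t * Omega_formula g ((drop ?m fs)[?j := h t]) p)"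
      unfolding Omega_formula_def
      by (simp only:) (subst sum_scaled_swap, simp add: sum_distrib_left mult_ac)
    then have "Omega S g ((drop ?m fs)[?j := ?s]) p =
        (\<Sum>t\<in>Q. c t * Omega S g ((drop ?m fs)[?j := h t]) p)"
      using Omega_eq[OF g polys[OF sA]] Omega_eq[OF g polys[OF h]] by simp
    then show ?thesis
      using False by (simp add: T1_coeff_def take_update_cancel drop_update_swap sum_distrib_left mult_ac)
  qed
qed

text \<open>
  The permutation in the antisymmetrization can be moved from the arguments to the directions, where its
  sign is absorbed by the wedge product. All \<open>m!\<close> terms then agree.
\<close>

lemma L2_eq:
  "L2 S m \<Psi> p T = (\<Sum>is\<in>ilists m. \<Psi> (map (shifted p) is) p * wedge is T)"
proof -
  let ?L = "ilists m"
  have "L2 S m \<Psi> p T = (\<Sum>is\<in>?L. \<Sum>\<sigma> | \<sigma> permutes {..<m}.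
      1 / fact m * (\<Psi> (map (shifted p) (permute_list \<sigma> is)) p * wedge (permute_list \<sigma> is) T))"
    unfolding L2_def index_lists_def
  proof (intro sum.cong refl)
    fix "is" assume "is \<in> {is. set is \<subseteq> {..<n} \<and> length is = m}"
    then have lis: "length is = m" by simp
    have "map (\<lambda>j q. q (is ! \<sigma> j) - p (is ! \<sigma> j)) [0..<m] = map (shifted p) (permute_list \<sigma> is)" for \<sigma>
      using lis by (auto simp: shifted_def permute_list_def)
    then show "(1 / fact m * (\<Sum>\<sigma> | \<sigma> permutes {..<m}. of_int (sign \<sigma>) *
        \<Psi> (map (\<lambda>j q. q (is ! \<sigma> j) - p (is ! \<sigma> j)) [0..<m]) p)) * wedge is T =
      (\<Sum>\<sigma> | \<sigma> permutes {..<m}.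
      1 / fact m * (\<Psi> (map (shifted p) (permute_list \<sigma> is)) p * wedge (permute_list \<sigma> is) T))"
      unfolding sum_distrib_left sum_distrib_right
      using lis by (intro sum.cong refl) (simp add: wedge_permute)
  qed
  also have "\<dots> = (\<Sum>\<sigma> | \<sigma> permutes {..<m}. \<Sum>is\<in>?L.
      1 / fact m * (\<Psi> (map (shifted p) (permute_list \<sigma> is)) p * wedge (permute_list \<sigma> is) T))"
    by (rule sum.swap)
  also have "\<dots> = (\<Sum>\<sigma> | \<sigma> permutes {..<m}. \<Sum>is\<in>?L.
      1 / fact m * (\<Psi> (map (shifted p) is) p * wedge is T))"
  proof (rule sum.cong[OF refl])
    fix \<sigma> assume "\<sigma> \<in> {\<sigma>. \<sigma> permutes {..<m}}"
    then have \<sigma>: "\<sigma> permutes {..<m}" by simp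
    have i: "inv_into UNIV \<sigma> permutes {..<m}" using \<sigma> by (rule permutes_inv)
    show "(\<Sum>is\<in>?L. 1 / fact m * (\<Psi> (map (shifted p) (permute_list \<sigma> is)) p * wedge (permute_list \<sigma> is) T)) =
        (\<Sum>is\<in>?L. 1 / fact m * (\<Psi> (map (shifted p) is) p * wedge is T))"
    proof (rule sum.reindex_bij_witness[where i = "permute_list (inv_into UNIV \<sigma>)" and j = "permute_list \<sigma>"])
      fix "is" assume "is \<in> ?L"
      then have lis: "length is = m" "set is \<subseteq> {..<n}" by (auto simp: index_lists_def)
      show "permute_list (inv_into UNIV \<sigma>) (permute_list \<sigma> is) = is"
        using permute_list_inv_iff[of \<sigma> "is" "permute_list \<sigma> is"] lis \<sigma> by simp
      show "permute_list \<sigma> (permute_list (inv_into UNIV \<sigma>) is) = is"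
        using permute_list_inv_iff[of \<sigma> "permute_list (inv_into UNIV \<sigma>) is" "is"] lis \<sigma> by simp
      show "permute_list \<sigma> is \<in> ?L" "permute_list (inv_into UNIV \<sigma>) is \<in> ?L"
        using lis \<sigma> i by (auto simp: index_lists_def)
    qed simp
  qed
  also have "\<dots> = (\<Sum>is\<in>?L. \<Psi> (map (shifted p) is) p * wedge is T)"
    by (simp add: card_permutations[of "{..<m}" m] sum_divide_distrib[symmetric])
  finally show ?thesis .
qed

end

section \<open>Summation over index lists\<close>

lemma minus_one_powi: "(-1 :: complex) powi x = (if even x then 1 else -1)"
  by (simp add: power_int_minus_left)

lemma antisymmetrize:
  assumes "alternating F" "finite A" "J \<subseteq> A" "card J = m"
  shows "(\<Sum>vs\<in>index_lists A m. 1 / fact m * wedge vs J * F vs) = F (sorted_list_of_set J)"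
proof -
  have "(\<Sum>vs\<in>index_lists A m. 1 / fact m * wedge vs J * F vs) =
      1 / fact m * (\<Sum>vs\<in>index_lists A m. wedge vs J * F vs)"
    by (simp add: sum_distrib_left mult.assoc)
  then show ?thesis using sum_lists_wedge[OF assms] by simp
qed

text \<open>
  The same field written in two ways: by its components and by an expansion with redundant indices.
  An alternating function cannot tell them apart.
\<close>

lemma sum_expansion:
  assumes "alternating F" "finite A" "\<And>t. t \<in> Q \<Longrightarrow> xl t \<in> index_lists A m"
    and "\<And>J. J \<subseteq> A \<Longrightarrow> card J = m \<Longrightarrow> w J = (\<Sum>t\<in>Q. c t * wedge (xl t) J)"
  shows "(\<Sum>J | J \<subseteq> A \<and> card J = m. w J * F (sorted_list_of_set J)) = (\<Sum>t\<in>Q. c t * F (xl t))"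
proof -
  have "(\<Sum>J | J \<subseteq> A \<and> card J = m. w J * F (sorted_list_of_set J)) =
      (\<Sum>J | J \<subseteq> A \<and> card J = m. F (sorted_list_of_set J) * (\<Sum>t\<in>Q. c t * wedge (xl t) J))"
    using assms(4) by (intro sum.cong refl) (simp add: mult.commute)
  also have "\<dots> = (\<Sum>t\<in>Q. c t * (\<Sum>J | J \<subseteq> A \<and> card J = m. wedge (xl t) J * F (sorted_list_of_set J)))"
    by (subst sum_scaled_swap) (simp add: mult.commute)
  also have "\<dots> = (\<Sum>t\<in>Q. c t * F (xl t))"
    using sum_sets_wedge[OF assms(1,2) assms(3)] by (intro sum.cong refl) simp
  finally show ?thesis .
qed

text \<open>
  The pre-Lie sign of the insertion at position \<open>i\<close> is \<open>(-1)\<^bsup>i(l-1)\<^esup>\<close>. Moving the inserted block of length \<open>l\<close>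
  to the front contributes \<open>(-1)\<^bsup>il\<^esup>\<close>, and the product is the sign of a contraction.
\<close>

lemma sum_insert_block:
  assumes "alternating F"
  shows "(\<Sum>i<length xs. (-1) powi (int i * (int (length M) - 1)) *
       (u (xs ! i) * F (take i xs @ M @ drop (Suc i) xs))) = contraction u (\<lambda>zs. F (M @ zs)) xs"
  unfolding contraction_eq_sum
proof (intro sum.cong refl)
  fix i assume "i \<in> {..<length xs}"
  then have "F (take i xs @ M @ drop (Suc i) xs) =
      (-1) ^ (i * length M) * F (M @ take i xs @ drop (Suc i) xs)"
    using alternating_move_block[OF assms, of "[]" "take i xs" M "drop (Suc i) xs"] by simp
  then show "(-1) powi (int i * (int (length M) - 1)) *
       (u (xs ! i) * F (take i xs @ M @ drop (Suc i) xs)) =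
      (-1) ^ i * u (xs ! i) * F (M @ take i xs @ drop (Suc i) xs)"
    by (simp add: minus_one_powi minus_one_power_iff)
qed

section \<open>The image of the pre-Lie product\<close>

context section_pair
begin

text \<open>
  The expansion of \<open>Y\<close> is left open: its components serve when the normal directions overlap, the given
  coefficients when they are disjoint. The alternating function \<open>W\<close> stands for the component of the wedge
  product at a fixed set of directions.
\<close>

context
  fixes yc :: "'t \<Rightarrow> pfun" and yl :: "'t \<Rightarrow> nat list" and Q :: "'t set"
    and W :: "nat list \<Rightarrow> complex" and P :: point
  assumes W: "alternating W" and Q: "finite Q"
    and yc: "\<And>t. t \<in> Q \<Longrightarrow> yc t \<in> A"
    and yl: "\<And>t. t \<in> Q \<Longrightarrow> yl t \<in> ilists (l - codim S \<beta>)"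
    and Y_exp: "\<And>q J. J \<subseteq> {..<n} \<Longrightarrow> card J = l - codim S \<beta> \<Longrightarrow>
        Y q J = (\<Sum>t\<in>Q. yc t q * wedge (yl t) J)"
    and kl: "codim S \<alpha> \<le> k" "codim S \<beta> \<le> l"
begin

text \<open>
  Summation over the arguments of the inner cochain replaces them by the directions of
  \<open>Y \<otimes> \<Lambda>\<^sub>\<beta>\<close>, whose coefficient \<open>y\<^sub>t\<close> becomes an argument of the outer one.
\<close>

lemma sum_inner:
  assumes fus: "set fus \<subseteq> A" and fws: "set fws \<subseteq> A" and len: "Suc (length fus + length fws) = k"
  shows "(\<Sum>vs\<in>ilists l.
      T1_coeff k \<alpha> X (fus @ T1_coeff l \<beta> Y (map (shifted P) vs) # fws) P * W (us @ vs @ ws)) =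
    (\<Sum>t\<in>Q. T1_coeff k \<alpha> X (fus @ yc t # fws) P * W (us @ yl t @ ys S \<beta> @ ws))"
proof -
  let ?m = "l - codim S \<beta>" and ?b = "codim S \<beta>"
  let ?J = "{J. J \<subseteq> {..<n} \<and> card J = ?m}" and ?N = "normal_idx S \<beta>"
  define \<kappa>1 where "\<kappa>1 = (\<lambda>t vs. \<Sum>J\<in>?J. wedge (yl t) J * (1 / fact ?m * wedge vs J))"
  define \<kappa> where "\<kappa> = (\<lambda>t vs. \<kappa>1 t (take ?m vs) * (1 / fact ?b * wedge (drop ?m vs) ?N))"
  have inner: "T1_coeff l \<beta> Y (map (shifted P) vs) = (\<lambda>q. \<Sum>t\<in>Q. \<kappa> t vs * yc t q)"
    if vs: "vs \<in> ilists l" for vs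
  proof
    fix q
    have v: "set vs \<subseteq> {..<n}" "length vs = l" using vs by (auto simp: index_lists_def)
    have "set (drop ?m vs) \<subseteq> {..<n}" using v(1) set_drop_subset[of ?m vs] by blast
    then have Om: "Omega S \<beta> (map (shifted P) (drop ?m vs)) q = 1 / fact ?b * wedge (drop ?m vs) ?N"
      using v(2) kl by (intro Omega_shifted[OF ab(2)]) auto
    have mv: "mv_apply S ?m Y (map (shifted P) (take ?m vs)) q = (\<Sum>t\<in>Q. yc t q * \<kappa>1 t (take ?m vs))"
    proof -
      have "mv_apply S ?m Y (map (shifted P) (take ?m vs)) q =
          (\<Sum>J\<in>?J. Y q J * (1 / fact ?m * wedge (take ?m vs) J))"
        using v(2) kl by (intro mv_apply_shifted) auto
      also have "\<dots> = (\<Sum>J\<in>?J. (1 / fact ?m * wedge (take ?m vs) J) * (\<Sum>t\<in>Q. yc t q * wedge (yl t) J))"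
        by (intro sum.cong refl) (simp add: Y_exp)
      also have "\<dots> = (\<Sum>t\<in>Q. yc t q * \<kappa>1 t (take ?m vs))"
        unfolding \<kappa>1_def by (subst sum_scaled_swap) (simp add: mult_ac)
      finally show ?thesis .
    qed
    show "T1_coeff l \<beta> Y (map (shifted P) vs) q = (\<Sum>t\<in>Q. \<kappa> t vs * yc t q)"
      unfolding T1_coeff_def take_map drop_map Om mv \<kappa>_def sum_distrib_right
      by (simp only: mult_ac)
  qed
  let ?D = "\<lambda>t. T1_coeff k \<alpha> X (fus @ yc t # fws) P"
  have outer: "T1_coeff k \<alpha> X (fus @ T1_coeff l \<beta> Y (map (shifted P) vs) # fws) P = (\<Sum>t\<in>Q. ?D t * \<kappa> t vs)"
    if vs: "vs \<in> ilists l" for vs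
  proof -
    have "length (fus @ (\<lambda>p. 0) # fws) = k" "set (fus @ (\<lambda>p. 0) # fws) \<subseteq> A" "length fus < k"
      using len fus fws by (auto simp: polys.const)
    from T1_coeff_sum[OF ab(1) kl(1) this Q yc, where X = X and c = "\<lambda>t. \<kappa> t vs" and p = P] show ?thesis
      unfolding inner[OF vs] by (simp add: mult.commute)
  qed
  have "(\<Sum>vs\<in>ilists l.
      T1_coeff k \<alpha> X (fus @ T1_coeff l \<beta> Y (map (shifted P) vs) # fws) P * W (us @ vs @ ws)) =
      (\<Sum>vs\<in>ilists l. W (us @ vs @ ws) * (\<Sum>t\<in>Q. ?D t * \<kappa> t vs))"
    by (intro sum.cong refl) (simp add: outer mult.commute)
  also have "\<dots> = (\<Sum>t\<in>Q. ?D t * (\<Sum>vs\<in>ilists l. W (us @ vs @ ws) * \<kappa> t vs))"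
    by (rule sum_scaled_swap)
  also have "\<dots> = (\<Sum>t\<in>Q. ?D t * W (us @ yl t @ ys S \<beta> @ ws))"
  proof (rule sum.cong[OF refl], rule arg_cong[where f = "(*) _"])
    fix t assume t: "t \<in> Q"
    have "(\<Sum>vs\<in>ilists l. W (us @ vs @ ws) * \<kappa> t vs) =
        (\<Sum>vs\<in>ilists (?m + ?b). W (us @ vs @ ws) * \<kappa> t vs)"
      using kl by simp
    also have "\<dots> = (\<Sum>v1\<in>ilists ?m. \<Sum>v2\<in>ilists ?b.
        \<kappa>1 t v1 * (1 / fact ?b * wedge v2 ?N * W ((us @ v1) @ v2 @ ws)))"
      unfolding sum_index_lists_append \<kappa>_def
      by (intro sum.cong refl) (simp add: index_lists_def mult_ac)
    also have "\<dots> = (\<Sum>v1\<in>ilists ?m. \<kappa>1 t v1 * W ((us @ v1) @ ys S \<beta> @ ws))"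
      unfolding sum_distrib_left[symmetric] ys_def
      by (intro sum.cong[OF refl] arg_cong[where f = "(*) _"] antisymmetrize
          alternating_context[OF W] finite_lessThan idx_subset(2) codim_eq[OF ab(2), symmetric])
    also have "\<dots> = (\<Sum>v1\<in>ilists ?m. W (us @ v1 @ ys S \<beta> @ ws) *
        (\<Sum>J\<in>?J. wedge (yl t) J * (1 / fact ?m * wedge v1 J)))"
      unfolding \<kappa>1_def by (simp add: mult.commute)
    also have "\<dots> = (\<Sum>J\<in>?J. wedge (yl t) J * (\<Sum>v1\<in>ilists ?m.
        1 / fact ?m * wedge v1 J * W (us @ v1 @ ys S \<beta> @ ws)))"
      by (subst sum_scaled_swap) (simp add: mult_ac)
    also have "\<dots> = (\<Sum>J\<in>?J. wedge (yl t) J * W (us @ sorted_list_of_set J @ ys S \<beta> @ ws))"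
      by (intro sum.cong refl arg_cong2[where f = "(*)"] antisymmetrize alternating_context[OF W]) auto
    also have "\<dots> = W (us @ yl t @ ys S \<beta> @ ws)"
      by (rule sum_sets_wedge[OF alternating_context[OF W] finite_lessThan yl[OF t]])
    finally show "(\<Sum>vs\<in>ilists l. W (us @ vs @ ws) * \<kappa> t vs) = W (us @ yl t @ ys S \<beta> @ ws)" .
  qed
  finally show ?thesis .
qed

text \<open>
  If \<open>\<beta>\<close> acts nontrivially on one of the coordinates in \<open>ws\<close>, that direction is also in \<open>\<Lambda>\<^sub>\<beta>\<close>, and \<open>W\<close> vanishes.
\<close>

lemma untwist:
  assumes "set ws \<subseteq> {..<n}"
  shows "T1_coeff k \<alpha> X (fus @ f # map (act_fun S \<beta>) (map (shifted P) ws)) P * W (us @ vs @ ys S \<beta> @ ws) =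
     T1_coeff k \<alpha> X (fus @ f # map (shifted P) ws) P * W (us @ vs @ ys S \<beta> @ ws)"
proof (cases "set ws \<inter> normal_idx S \<beta> = {}")
  case True
  have "act_fun S \<beta> (shifted P i) = shifted P i" if "i \<in> set ws" for i
  proof -
    have "weight S \<beta> i = 1" using True that assms fix_idx_weight(2)[OF ab(2)] by blast
    then show ?thesis by (simp add: act_fun_eq[OF ab(2)] shifted_def)
  qed
  then have "map (act_fun S \<beta>) (map (shifted P) ws) = map (shifted P) ws" by simp
  then show ?thesis by (simp only:)
next
  case False
  then have "W (us @ vs @ ys S \<beta> @ ws) = 0"
    by (intro alternating_repeated[OF W]) (auto simp: set_ys)
  then show ?thesis by simp
qed

lemma sum_pre_lie_coeff:
  "(\<Sum>is\<in>ilists (k + l - 1). product_coeff (map (shifted P) is) P * W is) =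
   (\<Sum>i<k. (-1) powi (int i * (int l - 1)) *
     (\<Sum>us\<in>ilists i. \<Sum>ws\<in>ilists (k - Suc i). \<Sum>t\<in>Q.
       T1_coeff k \<alpha> X (map (shifted P) us @ yc t # map (shifted P) ws) P * W (us @ yl t @ ys S \<beta> @ ws)))"
proof -
  let ?sh = "map (shifted P)" and ?sg = "\<lambda>i. (-1 :: complex) powi (int i * (int l - 1))"
  let ?h = "\<lambda>i is. T1_coeff k \<alpha> X (take i (?sh is) @ T1_coeff l \<beta> Y (take l (drop i (?sh is))) #
       map (act_fun S \<beta>) (drop (i + l) (?sh is))) P"
  have "product_coeff (?sh is) P = (\<Sum>i<k. ?sg i * ?h i is)" for "is"
    unfolding pre_lie_coeff_def by (simp add: sum.atLeast1_atMost_eq)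
  then have "(\<Sum>is\<in>ilists (k + l - 1). product_coeff (?sh is) P * W is) =
      (\<Sum>is\<in>ilists (k + l - 1). W is * (\<Sum>i<k. ?sg i * ?h i is))"
    by (simp add: mult.commute)
  also have "\<dots> = (\<Sum>i<k. ?sg i * (\<Sum>is\<in>ilists (k + l - 1). W is * ?h i is))"
    by (rule sum_scaled_swap)
  also have "\<dots> = (\<Sum>i<k. ?sg i *
     (\<Sum>us\<in>ilists i. \<Sum>ws\<in>ilists (k - Suc i). \<Sum>t\<in>Q.
       T1_coeff k \<alpha> X (?sh us @ yc t # ?sh ws) P * W (us @ yl t @ ys S \<beta> @ ws)))"
  proof (rule sum.cong[OF refl], rule arg_cong[where f = "(*) _"])
    fix i assume "i \<in> {..<k}"
    then have i: "i < k" and kl1: "k + l - 1 = i + (l + (k - Suc i))" by auto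
    have "(\<Sum>is\<in>ilists (k + l - 1). W is * ?h i is) =
      (\<Sum>us\<in>ilists i. \<Sum>vs\<in>ilists l. \<Sum>ws\<in>ilists (k - Suc i).
         T1_coeff k \<alpha> X (?sh us @ T1_coeff l \<beta> Y (?sh vs) # map (act_fun S \<beta>) (?sh ws)) P * W (us @ vs @ ws))"
      unfolding kl1 sum_index_lists_append
      by (intro sum.cong refl) (simp add: index_lists_def mult.commute take_map drop_map)
    also have "\<dots> = (\<Sum>us\<in>ilists i. \<Sum>ws\<in>ilists (k - Suc i). \<Sum>vs\<in>ilists l.
         T1_coeff k \<alpha> X (?sh us @ T1_coeff l \<beta> Y (?sh vs) # map (act_fun S \<beta>) (?sh ws)) P * W (us @ vs @ ws))"
      by (intro sum.cong[OF refl] sum.swap)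
    also have "\<dots> = (\<Sum>us\<in>ilists i. \<Sum>ws\<in>ilists (k - Suc i). \<Sum>t\<in>Q.
       T1_coeff k \<alpha> X (?sh us @ yc t # ?sh ws) P * W (us @ yl t @ ys S \<beta> @ ws))"
    proof (rule sum.cong[OF refl], rule sum.cong[OF refl])
      fix us ws assume "us \<in> ilists i" "ws \<in> ilists (k - Suc i)"
      then have u: "set us \<subseteq> {..<n}" "length us = i" and w: "set ws \<subseteq> {..<n}" "length ws = k - Suc i"
        by (auto simp: index_lists_def)
      have "set (map (act_fun S \<beta>) (?sh ws)) \<subseteq> A"
        using set_map_shifted[OF w(1)] by (auto intro!: act_fun_polys[OF ab(2)])
      then have "(\<Sum>vs\<in>ilists l.
         T1_coeff k \<alpha> X (?sh us @ T1_coeff l \<beta> Y (?sh vs) # map (act_fun S \<beta>) (?sh ws)) P * W (us @ vs @ ws)) =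
        (\<Sum>t\<in>Q. T1_coeff k \<alpha> X (?sh us @ yc t # map (act_fun S \<beta>) (?sh ws)) P *
           W (us @ yl t @ ys S \<beta> @ ws))"
        using set_map_shifted[OF u(1)] u(2) w(2) i by (intro sum_inner) auto
      then show "(\<Sum>vs\<in>ilists l.
         T1_coeff k \<alpha> X (?sh us @ T1_coeff l \<beta> Y (?sh vs) # map (act_fun S \<beta>) (?sh ws)) P * W (us @ vs @ ws)) =
        (\<Sum>t\<in>Q. T1_coeff k \<alpha> X (?sh us @ yc t # ?sh ws) P * W (us @ yl t @ ys S \<beta> @ ws))"
        unfolding untwist[OF w(1)] .
    qed
    finally show "(\<Sum>is\<in>ilists (k + l - 1). W is * ?h i is) =
      (\<Sum>us\<in>ilists i. \<Sum>ws\<in>ilists (k - Suc i). \<Sum>t\<in>Q.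
       T1_coeff k \<alpha> X (?sh us @ yc t # ?sh ws) P * W (us @ yl t @ ys S \<beta> @ ws))" .
  qed
  finally show ?thesis .
qed

text \<open>
  The cocycle of \<open>\<alpha>\<close> needs an argument depending on \<open>x\<^sup>c\<close>. The coefficients of \<open>Y\<close> do not, and if
  \<open>c\<close> belongs to one of the coordinate functions it occurs twice in the argument of \<open>W\<close>.
\<close>

lemma sum_pre_lie_coeff_overlap:
  assumes c: "c \<in> normal_idx S \<alpha>" "c \<in> normal_idx S \<beta>"
    and yc_fix: "\<And>t. t \<in> Q \<Longrightarrow> yc t \<in> polys (fix_idx S \<beta>)"
  shows "(\<Sum>is\<in>ilists (k + l - 1). product_coeff (map (shifted P) is) P * W is) = 0"
proof -
  have "T1_coeff k \<alpha> X (map (shifted P) us @ yc t # map (shifted P) ws) P * W (us @ yl t @ ys S \<beta> @ ws) = 0"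
    if i: "i < k" and us: "us \<in> ilists i" and ws: "ws \<in> ilists (k - Suc i)"
      and t: "t \<in> Q" for i us ws t
  proof (cases "c \<in> set us \<union> set ws")
    case True
    then have "W (us @ yl t @ ys S \<beta> @ ws) = 0"
      using c(2) by (intro alternating_repeated[OF W]) (auto simp: set_ys)
    then show ?thesis by simp
  next
    case False
    let ?fs = "map (shifted P) us @ yc t # map (shifted P) ws"
    have len: "length ?fs = k" using i us ws by (simp add: index_lists_def)
    have "fix_idx S \<beta> \<subseteq> {..<n} - {c}" using c(2) idx_disjoint[of \<beta>] by blast
    then have "yc t \<in> polys ({..<n} - {c})" using polys_mono[OF yc_fix[OF t]] by blast
    moreover have "set us \<subseteq> {..<n} - {c}" "set ws \<subseteq> {..<n} - {c}"
      using us ws False by (auto simp: index_lists_def)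
    ultimately have sub: "set ?fs \<subseteq> polys ({..<n} - {c})"
      using set_map_shifted[of us _ P] set_map_shifted[of ws _ P] by simp
    have "drop (k - codim S \<alpha>) ?fs ! j \<in> polys ({..<n} - {c})" if "j < codim S \<alpha>" for j
    proof -
      have "drop (k - codim S \<alpha>) ?fs ! j = ?fs ! (k - codim S \<alpha> + j)" using len kl(1) by (intro nth_drop) simp
      also have "\<dots> \<in> set ?fs" using len kl(1) that by (intro nth_mem) linarith
      finally show ?thesis using sub by blast
    qed
    note * = this
    have "Omega S \<alpha> (drop (k - codim S \<alpha>) ?fs) P = 0"
      by (rule Omega_zero[OF ab(1) _ c(1) *]) (use * polys_mono[of _ "{..<n} - {c}" "{..<n}"] in blast)
    then show ?thesis by (simp add: T1_coeff_def)
  qed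
  then show ?thesis unfolding sum_pre_lie_coeff by (auto intro!: sum.neutral)
qed

context
  fixes xc :: "'s \<Rightarrow> complex" and xl :: "'s \<Rightarrow> nat list" and R :: "'s set"
  assumes R: "finite R"
    and xl: "\<And>s. s \<in> R \<Longrightarrow> xl s \<in> ilists (k - codim S \<alpha>)"
    and X_exp: "\<And>I. I \<subseteq> {..<n} \<Longrightarrow> card I = k - codim S \<alpha> \<Longrightarrow>
        X P I = (\<Sum>s\<in>R. xc s * wedge (xl s) I)"
begin

text \<open>
  The inner value is differentiated by \<open>X\<close>. The sum over the last arguments completes \<open>\<Lambda>\<^sub>\<alpha>\<close>; then the sum
  over the slots is a contraction, and as it alternates, the sum over the lists of directions can
  be replaced by the expansion of \<open>X\<close>.
\<close>

lemma field_slots: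
  assumes M: "length M = l"
  shows "(\<Sum>i<k - codim S \<alpha>. (-1) powi (int i * (int l - 1)) *
     (\<Sum>us\<in>ilists i. \<Sum>ws\<in>ilists (k - Suc i).
       T1_coeff k \<alpha> X (map (shifted P) us @ y # map (shifted P) ws) P * W (us @ M @ ws))) =
    (\<Sum>s\<in>R. xc s * contraction (\<lambda>e. partial e y P) (\<lambda>zs. W (M @ zs @ ys S \<alpha>)) (xl s))"
proof -
  let ?m = "k - codim S \<alpha>" and ?a = "codim S \<alpha>"
  let ?I = "{I. I \<subseteq> {..<n} \<and> card I = ?m}" and ?N = "normal_idx S \<alpha>"
  let ?sh = "map (shifted P)" and ?sg = "\<lambda>i. (-1 :: complex) powi (int i * (int l - 1))"
  let ?u = "\<lambda>e. partial e y P"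
  let ?K = "\<lambda>i is. ?u (is ! i) * W (take i is @ M @ drop (Suc i) is @ ys S \<alpha>)"
  have slot: "(\<Sum>us\<in>ilists i. \<Sum>ws\<in>ilists (k - Suc i).
       T1_coeff k \<alpha> X (?sh us @ y # ?sh ws) P * W (us @ M @ ws)) =
     (\<Sum>I\<in>?I. X P I * (\<Sum>is\<in>ilists ?m. 1 / fact ?m * wedge is I * ?K i is))"
    if i: "i < ?m" for i
  proof -
    have ki: "k - Suc i = (?m - Suc i) + ?a" using i kl(1) by simp
    let ?f = "\<lambda>us e w1. 1 / fact ?m * (\<Sum>I\<in>?I. X P I * wedge (us @ e # w1) I) * (?u e * W (us @ M @ w1 @ ys S \<alpha>))"
    have "(\<Sum>ws\<in>ilists (k - Suc i). T1_coeff k \<alpha> X (?sh us @ y # ?sh ws) P * W (us @ M @ ws)) =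
      (\<Sum>w1\<in>ilists (?m - Suc i). \<Sum>e<n. ?f us e w1)"
      if us: "us \<in> ilists i" for us
    proof -
      have u: "set us \<subseteq> {..<n}" "length us = i" using us by (auto simp: index_lists_def)
      have "(\<Sum>ws\<in>ilists (k - Suc i). T1_coeff k \<alpha> X (?sh us @ y # ?sh ws) P * W (us @ M @ ws)) =
        (\<Sum>w1\<in>ilists (?m - Suc i). \<Sum>w2\<in>ilists ?a.
           mv_apply S ?m X (?sh us @ y # ?sh w1) P *
             (1 / fact ?a * wedge w2 ?N * W ((us @ M @ w1) @ w2 @ [])))"
        unfolding ki sum_index_lists_append
      proof (intro sum.cong refl)
        fix w1 w2 assume "w1 \<in> ilists (?m - Suc i)" "w2 \<in> ilists ?a"
        then have w: "length w1 = ?m - Suc i" "set w2 \<subseteq> {..<n}" "length w2 = ?a"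
          by (auto simp: index_lists_def)
        have m: "?m = length (?sh us @ y # ?sh w1)" using u(2) w(1) i by simp
        have "take ?m (?sh us @ y # ?sh (w1 @ w2)) = ?sh us @ y # ?sh w1"
          unfolding m by simp
        moreover have "drop ?m (?sh us @ y # ?sh (w1 @ w2)) = ?sh w2"
          unfolding m by simp
        ultimately show "T1_coeff k \<alpha> X (?sh us @ y # ?sh (w1 @ w2)) P * W (us @ M @ w1 @ w2) =
            mv_apply S ?m X (?sh us @ y # ?sh w1) P *
             (1 / fact ?a * wedge w2 ?N * W ((us @ M @ w1) @ w2 @ []))"
          by (simp add: T1_coeff_def Omega_shifted[OF ab(1) w(3,2)])
      qed
      also have "\<dots> = (\<Sum>w1\<in>ilists (?m - Suc i).
          mv_apply S ?m X (?sh us @ y # ?sh w1) P * W ((us @ M @ w1) @ ys S \<alpha> @ []))"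
        unfolding sum_distrib_left[symmetric] ys_def
        by (intro sum.cong[OF refl] arg_cong[where f = "(*) _"] antisymmetrize
            alternating_context[OF W] finite_lessThan idx_subset(2) codim_eq[OF ab(1), symmetric])
      also have "\<dots> = (\<Sum>w1\<in>ilists (?m - Suc i). \<Sum>e<n. ?f us e w1)"
      proof (rule sum.cong[OF refl])
        fix w1 assume "w1 \<in> ilists (?m - Suc i)"
        then have "Suc (length us + length w1) = ?m" using u(2) i by (simp add: index_lists_def)
        from mv_apply_slot[OF this, of X P y P]
        have "mv_apply S ?m X (?sh us @ y # ?sh w1) P =
            (\<Sum>I\<in>?I. X P I * (1 / fact ?m * (\<Sum>e<n. ?u e * wedge (us @ e # w1) I)))" .
        also have "\<dots> = (\<Sum>I\<in>?I. (1 / fact ?m * X P I) * (\<Sum>e<n. ?u e * wedge (us @ e # w1) I))"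
          by (simp add: mult_ac)
        also have "\<dots> = (\<Sum>e<n. ?u e * (\<Sum>I\<in>?I. (1 / fact ?m * X P I) * wedge (us @ e # w1) I))"
          by (rule sum_scaled_swap)
        finally show "mv_apply S ?m X (?sh us @ y # ?sh w1) P * W ((us @ M @ w1) @ ys S \<alpha> @ []) =
            (\<Sum>e<n. ?f us e w1)"
          by (simp add: sum_distrib_left sum_distrib_right mult_ac)
      qed
      finally show ?thesis .
    qed
    then have "(\<Sum>us\<in>ilists i. \<Sum>ws\<in>ilists (k - Suc i).
       T1_coeff k \<alpha> X (?sh us @ y # ?sh ws) P * W (us @ M @ ws)) =
      (\<Sum>us\<in>ilists i. \<Sum>w1\<in>ilists (?m - Suc i). \<Sum>e<n. ?f us e w1)"
      by (rule sum.cong[OF refl])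
    also have "\<dots> = (\<Sum>is\<in>ilists ?m. ?f (take i is) (is ! i) (drop (Suc i) is))"
      by (rule sum_index_lists_split[OF i])
    also have "\<dots> = (\<Sum>is\<in>ilists ?m. 1 / fact ?m * ?K i is * (\<Sum>I\<in>?I. X P I * wedge is I))"
      using i by (intro sum.cong refl) (auto simp: index_lists_def id_take_nth_drop[symmetric])
    also have "\<dots> = (\<Sum>I\<in>?I. X P I * (\<Sum>is\<in>ilists ?m. 1 / fact ?m * ?K i is * wedge is I))"
      by (rule sum_scaled_swap)
    also have "\<dots> = (\<Sum>I\<in>?I. X P I * (\<Sum>is\<in>ilists ?m. 1 / fact ?m * wedge is I * ?K i is))"
      by (simp add: mult_ac)
    finally show ?thesis .
  qed
  let ?F = "\<lambda>zs. W (zs @ ys S \<alpha>)" and ?C = "contraction ?u (\<lambda>zs. W (M @ zs @ ys S \<alpha>))"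
  have F: "alternating ?F" using alternating_context[OF W, of "[]"] by simp
  have C: "alternating ?C"
    using alternating_contraction[OF alternating_context[OF W, of M "ys S \<alpha>"]] by simp
  have "(\<Sum>i<?m. ?sg i * (\<Sum>us\<in>ilists i. \<Sum>ws\<in>ilists (k - Suc i).
       T1_coeff k \<alpha> X (?sh us @ y # ?sh ws) P * W (us @ M @ ws))) =
    (\<Sum>i<?m. ?sg i * (\<Sum>I\<in>?I. X P I * (\<Sum>is\<in>ilists ?m. 1 / fact ?m * wedge is I * ?K i is)))"
    by (intro sum.cong[OF refl] arg_cong[where f = "(*) _"] slot) simp
  also have "\<dots> = (\<Sum>I\<in>?I. X P I * (\<Sum>i<?m. ?sg i * (\<Sum>is\<in>ilists ?m. (1 / fact ?m * wedge is I) * ?K i is)))"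
    by (rule sum_scaled_swap)
  also have "\<dots> = (\<Sum>I\<in>?I. X P I * (\<Sum>is\<in>ilists ?m. (1 / fact ?m * wedge is I) * (\<Sum>i<?m. ?sg i * ?K i is)))"
    by (intro sum.cong[OF refl] arg_cong[where f = "(*) _"] sum_scaled_swap)
  also have "\<dots> = (\<Sum>I\<in>?I. X P I * (\<Sum>is\<in>ilists ?m. (1 / fact ?m * wedge is I) * ?C is))"
  proof (intro sum.cong[OF refl] arg_cong[where f = "(*) _"])
    fix "is" assume "is \<in> ilists ?m"
    then have "?m = length is" by (simp add: index_lists_def)
    then show "(\<Sum>i<?m. ?sg i * ?K i is) = ?C is"
      using sum_insert_block[OF F, where u = ?u and M = M and xs = "is"] M by simp
  qed
  also have "\<dots> = (\<Sum>I\<in>?I. X P I * ?C (sorted_list_of_set I))"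
    by (intro sum.cong[OF refl] arg_cong[where f = "(*) _"] antisymmetrize C) auto
  also have "\<dots> = (\<Sum>s\<in>R. xc s * ?C (xl s))"
    by (rule sum_expansion[OF C finite_lessThan xl X_exp])
  finally show ?thesis .
qed

text \<open>
  The inner value stands in the slot \<open>r\<close> of \<open>\<Omega>\<^sub>\<alpha>\<close>, so that one direction of \<open>\<Lambda>\<^sub>\<alpha>\<close> is spent on a derivative
  of \<open>y\<close>. The \<open>k - l(\<alpha>)\<close> arguments of \<open>X\<close> in front contribute a common sign.
\<close>

lemma cocycle_slots:
  assumes M: "length M = l" and y: "y \<in> A" and P: "\<And>i. i \<in> normal_idx S \<alpha> \<Longrightarrow> P i = 0"
  shows "(\<Sum>r<codim S \<alpha>. (-1) powi (int (k - codim S \<alpha> + r) * (int l - 1)) *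
     (\<Sum>us\<in>ilists (k - codim S \<alpha> + r). \<Sum>ws\<in>ilists (k - Suc (k - codim S \<alpha> + r)).
       T1_coeff k \<alpha> X (map (shifted P) us @ y # map (shifted P) ws) P * W (us @ M @ ws))) =
    (-1) powi (int (k - codim S \<alpha>) * (int l - 1)) *
    (\<Sum>s\<in>R. xc s * contraction (\<lambda>e. partial e y P) (\<lambda>zs. W (xl s @ M @ zs)) (ys S \<alpha>))"
proof -
  let ?m = "k - codim S \<alpha>" and ?a = "codim S \<alpha>"
  let ?I = "{I. I \<subseteq> {..<n} \<and> card I = ?m}" and ?N = "normal_idx S \<alpha>"
  let ?sh = "map (shifted P)" and ?sg = "\<lambda>i. (-1 :: complex) powi (int i * (int l - 1))"
  let ?u = "\<lambda>e. partial e y P"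
  let ?K = "\<lambda>r es. ?u (es ! r) * (\<Sum>s\<in>R. xc s * W (xl s @ take r es @ M @ drop (Suc r) es))"
  have slot: "(\<Sum>us\<in>ilists (?m + r). \<Sum>ws\<in>ilists (k - Suc (?m + r)).
       T1_coeff k \<alpha> X (?sh us @ y # ?sh ws) P * W (us @ M @ ws)) =
     (\<Sum>es\<in>ilists ?a. (1 / fact ?a * wedge es ?N) * ?K r es)"
    if r: "r < ?a" for r
  proof -
    have kr: "k - Suc (?m + r) = ?a - Suc r" using r kl(1) by simp
    let ?Om = "\<lambda>u2 ws. 1 / fact ?a * (\<Sum>e<n. ?u e * wedge (u2 @ e # ws) ?N)"
    let ?mv = "\<lambda>u1. \<Sum>I\<in>?I. X P I * (1 / fact ?m * wedge u1 I)"
    have "(\<Sum>us\<in>ilists (?m + r). \<Sum>ws\<in>ilists (k - Suc (?m + r)).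
       T1_coeff k \<alpha> X (?sh us @ y # ?sh ws) P * W (us @ M @ ws)) =
      (\<Sum>u1\<in>ilists ?m. \<Sum>u2\<in>ilists r. \<Sum>ws\<in>ilists (?a - Suc r).
        ?mv u1 * (?Om u2 ws * W (u1 @ (u2 @ M @ ws))))"
      unfolding sum_index_lists_append kr
    proof (intro sum.cong[OF refl])
      fix u1 u2 ws
      assume "u1 \<in> ilists ?m" "u2 \<in> ilists r" "ws \<in> ilists (?a - Suc r)"
      then have u: "length u1 = ?m" "set u2 \<subseteq> {..<n}" "set ws \<subseteq> {..<n}" "Suc (length u2 + length ws) = ?a"
        using r by (auto simp: index_lists_def)
      have "T1_coeff k \<alpha> X (?sh (u1 @ u2) @ y # ?sh ws) P =
          mv_apply S ?m X (?sh u1) P * Omega S \<alpha> (?sh u2 @ y # ?sh ws) P"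
        using u(1) by (simp add: T1_coeff_def)
      moreover have "Omega S \<alpha> (?sh u2 @ y # ?sh ws) P = ?Om u2 ws"
        by (rule Omega_slot[OF ab(1) u(4,2,3) y P])
      ultimately show "T1_coeff k \<alpha> X (?sh (u1 @ u2) @ y # ?sh ws) P * W ((u1 @ u2) @ M @ ws) =
          ?mv u1 * (?Om u2 ws * W (u1 @ (u2 @ M @ ws)))"
        unfolding mv_apply_shifted[OF u(1)] by simp
    qed
    also have "\<dots> = (\<Sum>u2\<in>ilists r. \<Sum>ws\<in>ilists (?a - Suc r). \<Sum>u1\<in>ilists ?m.
        ?mv u1 * (?Om u2 ws * W (u1 @ (u2 @ M @ ws))))"
      by (subst sum.swap) (intro sum.cong[OF refl] sum.swap)
    also have "\<dots> = (\<Sum>u2\<in>ilists r. \<Sum>ws\<in>ilists (?a - Suc r).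
        ?Om u2 ws * (\<Sum>s\<in>R. xc s * W (xl s @ (u2 @ M @ ws))))"
    proof (intro sum.cong[OF refl])
      fix u2 ws
      let ?H = "\<lambda>u1. W (u1 @ (u2 @ M @ ws))"
      have H: "alternating ?H" using alternating_context[OF W, of "[]" "u2 @ M @ ws"] by simp
      have "(\<Sum>u1\<in>ilists ?m. ?mv u1 * (?Om u2 ws * ?H u1)) =
          ?Om u2 ws * (\<Sum>u1\<in>ilists ?m. ?H u1 * ?mv u1)"
        unfolding sum_distrib_left[of "?Om u2 ws"] by (intro sum.cong[OF refl]) (simp only: mult_ac)
      also have "(\<Sum>u1\<in>ilists ?m. ?H u1 * ?mv u1) =
          (\<Sum>I\<in>?I. X P I * (\<Sum>u1\<in>ilists ?m. ?H u1 * (1 / fact ?m * wedge u1 I)))"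
        by (rule sum_scaled_swap)
      also have "\<dots> = (\<Sum>I\<in>?I. X P I * (\<Sum>u1\<in>ilists ?m. 1 / fact ?m * wedge u1 I * ?H u1))"
        by (simp add: mult_ac)
      also have "\<dots> = (\<Sum>I\<in>?I. X P I * ?H (sorted_list_of_set I))"
        by (intro sum.cong[OF refl] arg_cong[where f = "(*) _"] antisymmetrize H) auto
      also have "\<dots> = (\<Sum>s\<in>R. xc s * ?H (xl s))"
        by (rule sum_expansion[OF H finite_lessThan xl X_exp])
      finally show "(\<Sum>u1\<in>ilists ?m. ?mv u1 * (?Om u2 ws * ?H u1)) =
          ?Om u2 ws * (\<Sum>s\<in>R. xc s * ?H (xl s))" .
    qed
    also have "\<dots> = (\<Sum>u2\<in>ilists r. \<Sum>ws\<in>ilists (?a - Suc r). \<Sum>e<n.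
        (1 / fact ?a * wedge (u2 @ e # ws) ?N) * (?u e * (\<Sum>s\<in>R. xc s * W (xl s @ u2 @ M @ ws))))"
      unfolding sum_distrib_left[of _ _ "{..<n}"] sum_distrib_right[of _ "{..<n}"]
      by (simp only: mult_ac)
    also have "\<dots> = (\<Sum>es\<in>ilists ?a.
        (1 / fact ?a * wedge (take r es @ es ! r # drop (Suc r) es) ?N) * ?K r es)"
      by (rule sum_index_lists_split[OF r])
    also have "\<dots> = (\<Sum>es\<in>ilists ?a. (1 / fact ?a * wedge es ?N) * ?K r es)"
      using r by (intro sum.cong refl) (simp add: index_lists_def id_take_nth_drop[symmetric])
    finally show ?thesis .
  qed
  let ?C = "\<lambda>es. \<Sum>s\<in>R. xc s * contraction ?u (\<lambda>zs. W (xl s @ M @ zs)) es"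
  have ctr: "alternating (contraction ?u (\<lambda>zs. W (xl s @ M @ zs)))" for s
    using alternating_contraction[OF alternating_context[OF W, of "xl s @ M" "[]"]] by simp
  have C: "alternating ?C"
    unfolding alternating_def sum_negf[symmetric] mult_minus_right[symmetric]
    by (intro allI sum.cong[OF refl] arg_cong[where f = "(*) _"] alternatingD[OF ctr])
  have sg: "?sg (?m + r) = ?sg ?m * ?sg r" for r
    by (simp add: minus_one_powi distrib_right del: of_nat_diff)
  have "(\<Sum>r<?a. ?sg (?m + r) *
     (\<Sum>us\<in>ilists (?m + r). \<Sum>ws\<in>ilists (k - Suc (?m + r)).
       T1_coeff k \<alpha> X (?sh us @ y # ?sh ws) P * W (us @ M @ ws))) =
    ?sg ?m * (\<Sum>r<?a. ?sg r * (\<Sum>es\<in>ilists ?a. (1 / fact ?a * wedge es ?N) * ?K r es))"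
    unfolding sum_distrib_left[of "?sg ?m"] mult.assoc[symmetric] sg[symmetric]
    by (intro sum.cong[OF refl] arg_cong[where f = "(*) _"] slot[unfolded mult.assoc[symmetric]]) simp
  also have "(\<Sum>r<?a. ?sg r * (\<Sum>es\<in>ilists ?a. (1 / fact ?a * wedge es ?N) * ?K r es)) =
      (\<Sum>es\<in>ilists ?a. (1 / fact ?a * wedge es ?N) * (\<Sum>r<?a. ?sg r * ?K r es))"
    by (rule sum_scaled_swap)
  also have "\<dots> = (\<Sum>es\<in>ilists ?a. (1 / fact ?a * wedge es ?N) * ?C es)"
  proof (intro sum.cong[OF refl] arg_cong[where f = "(*) _"])
    fix es assume "es \<in> ilists ?a"
    then have a: "?a = length es" by (simp add: index_lists_def)
    have "(\<Sum>r<?a. ?sg r * ?K r es) = (\<Sum>r<?a. (?sg r * ?u (es ! r)) *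
        (\<Sum>s\<in>R. xc s * W (xl s @ take r es @ M @ drop (Suc r) es)))"
      by (simp add: mult.assoc)
    also have "\<dots> = (\<Sum>s\<in>R. xc s * (\<Sum>r<?a. (?sg r * ?u (es ! r)) * W (xl s @ take r es @ M @ drop (Suc r) es)))"
      by (rule sum_scaled_swap)
    also have "\<dots> = ?C es"
    proof (intro sum.cong[OF refl] arg_cong[where f = "(*) _"])
      fix s
      have "alternating (\<lambda>zs. W (xl s @ zs))" using alternating_context[OF W, of "xl s" "[]"] by simp
      from sum_insert_block[OF this, where u = ?u and M = M and xs = es]
      show "(\<Sum>r<?a. (?sg r * ?u (es ! r)) * W (xl s @ take r es @ M @ drop (Suc r) es)) =
          contraction ?u (\<lambda>zs. W (xl s @ M @ zs)) es"
        unfolding a M by (simp add: mult.assoc)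
    qed
    finally show "(\<Sum>r<?a. ?sg r * ?K r es) = ?C es" .
  qed
  also have "\<dots> = ?C (ys S \<alpha>)"
    unfolding ys_def by (rule antisymmetrize[OF C finite_lessThan idx_subset(2) codim_eq[OF ab(1), symmetric]])
  finally show ?thesis .
qed

lemma sum_pre_lie_coeff_contraction:
  assumes P: "\<And>i. i \<in> normal_idx S \<alpha> \<Longrightarrow> P i = 0"
  shows "(\<Sum>is\<in>ilists (k + l - 1). product_coeff (map (shifted P) is) P * W is) =
    (\<Sum>s\<in>R. \<Sum>t\<in>Q. xc s *
       (contraction (\<lambda>e. partial e (yc t) P) (\<lambda>zs. W (yl t @ ys S \<beta> @ zs @ ys S \<alpha>)) (xl s) +
        (-1) powi (int (k - codim S \<alpha>) * (int l - 1)) *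
        contraction (\<lambda>e. partial e (yc t) P) (\<lambda>zs. W (xl s @ yl t @ ys S \<beta> @ zs)) (ys S \<alpha>)))"
proof -
  let ?m = "k - codim S \<alpha>" and ?a = "codim S \<alpha>"
  let ?sg = "\<lambda>i. (-1 :: complex) powi (int i * (int l - 1))"
  let ?B = "\<lambda>i t. \<Sum>us\<in>ilists i. \<Sum>ws\<in>ilists (k - Suc i).
       T1_coeff k \<alpha> X (map (shifted P) us @ yc t # map (shifted P) ws) P * W (us @ (yl t @ ys S \<beta>) @ ws)"
  let ?C1 = "\<lambda>t s. contraction (\<lambda>e. partial e (yc t) P) (\<lambda>zs. W ((yl t @ ys S \<beta>) @ zs @ ys S \<alpha>)) (xl s)"
  let ?C2 = "\<lambda>t s. contraction (\<lambda>e. partial e (yc t) P) (\<lambda>zs. W (xl s @ (yl t @ ys S \<beta>) @ zs)) (ys S \<alpha>)"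
  have len: "length (yl t @ ys S \<beta>) = l" if "t \<in> Q" for t
    using yl[OF that] length_ys[OF ab(2)] kl(2) by (simp add: index_lists_def)
  have split: "(\<Sum>i<?m + a. h i) = (\<Sum>i<?m. h i) + (\<Sum>r<a. h (?m + r))" for h :: "nat \<Rightarrow> complex" and a
    by (induction a) (auto simp: add.assoc)
  have "(\<Sum>is\<in>ilists (k + l - 1). product_coeff (map (shifted P) is) P * W is) =
      (\<Sum>i<k. ?sg i * (\<Sum>t\<in>Q. ?B i t))"
    unfolding sum_pre_lie_coeff
  proof (intro sum.cong[OF refl] arg_cong[where f = "(*) _"])
    fix i
    show "(\<Sum>us\<in>ilists i. \<Sum>ws\<in>ilists (k - Suc i). \<Sum>t\<in>Q.
       T1_coeff k \<alpha> X (map (shifted P) us @ yc t # map (shifted P) ws) P * W (us @ yl t @ ys S \<beta> @ ws)) =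
      (\<Sum>t\<in>Q. ?B i t)"
      unfolding append_assoc
      by (subst (2) sum.swap) (intro sum.cong[OF refl] sum.swap)
  qed
  also have "\<dots> = (\<Sum>t\<in>Q. \<Sum>i<k. ?sg i * ?B i t)"
    unfolding sum_distrib_left by (rule sum.swap)
  also have "\<dots> = (\<Sum>t\<in>Q. (\<Sum>s\<in>R. xc s * ?C1 t s) + ?sg ?m * (\<Sum>s\<in>R. xc s * ?C2 t s))"
  proof (rule sum.cong[OF refl])
    fix t assume t: "t \<in> Q"
    have "(\<Sum>i<k. ?sg i * ?B i t) = (\<Sum>i<?m + ?a. ?sg i * ?B i t)" using kl(1) by simp
    also have "\<dots> = (\<Sum>i<?m. ?sg i * ?B i t) + (\<Sum>r<?a. ?sg (?m + r) * ?B (?m + r) t)" by (rule split)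
    also have "(\<Sum>i<?m. ?sg i * ?B i t) = (\<Sum>s\<in>R. xc s * ?C1 t s)"
      by (rule field_slots[OF len[OF t]])
    also have "(\<Sum>r<?a. ?sg (?m + r) * ?B (?m + r) t) = ?sg ?m * (\<Sum>s\<in>R. xc s * ?C2 t s)"
      by (rule cocycle_slots[OF len[OF t] yc[OF t] P])
    finally show "(\<Sum>i<k. ?sg i * ?B i t) = (\<Sum>s\<in>R. xc s * ?C1 t s) + ?sg ?m * (\<Sum>s\<in>R. xc s * ?C2 t s)" .
  qed
  also have "\<dots> = (\<Sum>t\<in>Q. \<Sum>s\<in>R. xc s * (?C1 t s + ?sg ?m * ?C2 t s))"
    by (simp add: sum_distrib_left sum.distrib distrib_left mult.left_commute)
  also have "\<dots> = (\<Sum>s\<in>R. \<Sum>t\<in>Q. xc s * (?C1 t s + ?sg ?m * ?C2 t s))" by (rule sum.swap)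
  finally show ?thesis unfolding append_assoc .
qed

end

end

end

section \<open>The two summands\<close>

lemma finite_list_pairs:
  assumes "finite F" "finite N"
  shows "finite {(xs, zs). set xs \<subseteq> F \<and> set zs \<subseteq> N \<and> length xs + length zs + c = (k::nat)}"
  by (rule finite_subset[OF _ finite_cartesian_product[OF
        finite_lists_length_le[OF assms(1), of k] finite_lists_length_le[OF assms(2), of k]]]) auto

text \<open>
  This reduction of the index set and the next one serve the two sums of the theorem: the terms that survive have
  no index in \<open>N\<close> at all, or exactly one.
\<close>

lemma sum_pairs_nil:
  fixes f :: "nat list \<Rightarrow> nat list \<Rightarrow> complex"
  assumes fin: "finite F" "finite N" and f: "\<And>xs zs. zs \<noteq> [] \<Longrightarrow> set xs \<subseteq> F \<Longrightarrow> set zs \<subseteq> N \<Longrightarrow> f xs zs = 0"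
  shows "(\<Sum>(xs, zs)\<in>{(xs, zs). set xs \<subseteq> F \<and> set zs \<subseteq> N \<and> length xs + length zs + c = k}. f xs zs) =
    (\<Sum>xs | set xs \<subseteq> F \<and> length xs + c = k. f xs [])"
proof -
  let ?R = "{(xs, zs). set xs \<subseteq> F \<and> set zs \<subseteq> N \<and> length xs + length zs + c = k}"
  have finR: "finite ?R" by (rule finite_list_pairs[OF fin])
  have "(\<Sum>(xs, zs)\<in>?R. f xs zs) = (\<Sum>(xs, zs)\<in>{x \<in> ?R. snd x = []}. f xs zs)"
    using finR
  proof (intro sum.mono_neutral_right ballI)
    fix x assume "x \<in> ?R - {x \<in> ?R. snd x = []}"
    then show "(case x of (xs, zs) \<Rightarrow> f xs zs) = 0" using f[of "snd x" "fst x"] by (auto simp: case_prod_unfold)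
  qed auto
  also have "\<dots> = (\<Sum>xs | set xs \<subseteq> F \<and> length xs + c = k. f xs [])"
    by (rule sum.reindex_bij_witness[where i = "\<lambda>xs. (xs, [])" and j = fst]) auto
  finally show ?thesis .
qed

lemma sum_pairs_single:
  fixes f :: "nat list \<Rightarrow> nat list \<Rightarrow> complex"
  assumes fin: "finite F" "finite N"
    and f: "\<And>xs zs. set xs \<subseteq> F \<Longrightarrow> set zs \<subseteq> N \<Longrightarrow> \<nexists>q. zs = [q] \<Longrightarrow> f xs zs = 0"
  shows "(\<Sum>(xs, zs)\<in>{(xs, zs). set xs \<subseteq> F \<and> set zs \<subseteq> N \<and> length xs + length zs + c = k}. f xs zs) =
    (\<Sum>xs | set xs \<subseteq> F \<and> length xs + 1 + c = k. \<Sum>q\<in>N. f xs [q])"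
proof -
  let ?R = "{(xs, zs). set xs \<subseteq> F \<and> set zs \<subseteq> N \<and> length xs + length zs + c = k}"
  have finR: "finite ?R" by (rule finite_list_pairs[OF fin])
  have "(\<Sum>(xs, zs)\<in>?R. f xs zs) = (\<Sum>(xs, zs)\<in>{x \<in> ?R. \<exists>q. snd x = [q]}. f xs zs)"
    using finR
  proof (intro sum.mono_neutral_right ballI)
    fix x assume "x \<in> ?R - {x \<in> ?R. \<exists>q. snd x = [q]}"
    then show "(case x of (xs, zs) \<Rightarrow> f xs zs) = 0" using f[of "fst x" "snd x"] by (auto simp: case_prod_unfold)
  qed auto
  also have "\<dots> = (\<Sum>(xs, q)\<in>{xs. set xs \<subseteq> F \<and> length xs + 1 + c = k} \<times> N. f xs [q])"
    by (rule sum.reindex_bij_witness[where i = "\<lambda>(xs, q). (xs, [q])" and j = "\<lambda>(xs, zs). (xs, hd zs)"]) auto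
  finally show ?thesis by (simp add: sum.cartesian_product)
qed

context section_pair
begin

lemma L_map_pre_lie:
  assumes "\<gamma> \<in> carrier G"
  shows "L_map S (k + l - 1) product \<gamma> p T =
    (if \<gamma> = \<alpha> \<otimes>\<^bsub>G\<^esub> \<beta> \<and> normal_idx S \<gamma> \<subseteq> T then
       \<Sum>is\<in>ilists (k + l - 1).
         product_coeff (map (shifted (to_fix S \<gamma> p)) is) (to_fix S \<gamma> p) * wedge is T
     else 0)"
proof -
  have "L1 S product (map (shifted (to_fix S \<gamma> p)) is) \<gamma> q =
      (if \<gamma> = \<alpha> \<otimes>\<^bsub>G\<^esub> \<beta> then product_coeff (map (shifted (to_fix S \<gamma> p)) is) q else 0)"
    if "is \<in> ilists (k + l - 1)" for "is" q
  proof -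
    have "set (map (shifted (to_fix S \<gamma> p)) is) \<subseteq> A" "length (map (shifted (to_fix S \<gamma> p)) is) = k + l - 1"
      using that set_map_shifted[of "is" "{..<n}"] by (auto simp: index_lists_def)
    from L1_pre_lie[OF this(2,1)] show ?thesis by (simp add: monom_U_apply)
  qed
  then show ?thesis
    unfolding L_map_def L3_def L2_eq by (auto intro!: sum.cong sum.neutral)
qed

text \<open>
  Below the degrees \<open>l(\<alpha>)\<close> and \<open>l(\<beta>)\<close> the fields vanish, but the truncated subtraction would misplace
  the arguments, so these degrees are treated apart.
\<close>

lemma pre_lie_coeff_degenerate:
  assumes "k < codim S \<alpha> \<or> l < codim S \<beta>" and fs: "length fs = k + l - 1" "set fs \<subseteq> A"
  shows "product_coeff fs p = 0"
proof -
  have "T1_coeff k \<alpha> X (take (i - 1) fs @ T1_coeff l \<beta> Y (take l (drop (i - 1) fs)) #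
       map (act_fun S \<beta>) (drop (i - 1 + l) fs)) p = 0" if i: "1 \<le> i" "i \<le> k" for i
  proof (cases "k < codim S \<alpha>")
    case True
    then show ?thesis by (rule T1_coeff_small[OF X(1)])
  next
    case False
    then have "T1_coeff l \<beta> Y (take l (drop (i - 1) fs)) = (\<lambda>p. 0)"
      using assms(1) T1_coeff_small[OF Y(1)] by blast
    then show ?thesis
      using i fs(1)
      by (intro T1_coeff_zero_argument[OF X(1) ab(1) outer_arguments[OF fs i], of "i - 1"])
         (auto simp: nth_append)
  qed
  then show ?thesis by (simp add: pre_lie_coeff_def)
qed

lemma sum_pre_lie_degenerate:
  assumes "k < codim S \<alpha> \<or> l < codim S \<beta>"
  shows "(\<Sum>is\<in>ilists (k + l - 1). product_coeff (map (shifted P) is) P * W is) = 0"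
proof (intro sum.neutral ballI)
  fix "is" assume "is \<in> ilists (k + l - 1)"
  then have "product_coeff (map (shifted P) is) P = 0"
    using set_map_shifted[of "is" "{..<n}"]
    by (intro pre_lie_coeff_degenerate[OF assms]) (auto simp: index_lists_def)
  then show "product_coeff (map (shifted P) is) P * W is = 0" by simp
qed

lemma L_map_overlap:
  assumes "\<gamma> \<in> carrier G" and c: "c \<in> normal_idx S \<alpha>" "c \<in> normal_idx S \<beta>"
  shows "L_map S (k + l - 1) product \<gamma> p T = 0"
proof -
  let ?P = "to_fix S \<gamma> p" and ?m = "l - codim S \<beta>"
  let ?Q = "{J. J \<subseteq> {..<n} \<and> card J = ?m}"
  \<comment> \<open>A field is expanded by its own components, indexed by the sets of directions.\<close>
  have "(\<Sum>is\<in>ilists (k + l - 1). product_coeff (map (shifted ?P) is) ?P * wedge is T) = 0"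
  proof (cases "k < codim S \<alpha> \<or> l < codim S \<beta>")
    case True
    then show ?thesis by (rule sum_pre_lie_degenerate)
  next
    case False
    have finQ: "finite ?Q" by simp
    have finJ: "finite J" if "J \<in> ?Q" for J using that finite_subset[of J "{..<n}"] by auto
    show ?thesis
    proof (rule sum_pre_lie_coeff_overlap[where Q = ?Q and yc = "\<lambda>J q. Y q J" and yl = sorted_list_of_set, OF alternating_wedge finQ])
      fix q J assume J: "J \<subseteq> {..<n}" "card J = ?m"
      have "(\<Sum>I\<in>?Q. Y q I * wedge (sorted_list_of_set I) J) = (\<Sum>I\<in>?Q. if I = J then Y q J else 0)"
        using finJ by (intro sum.cong refl) (auto simp: wedge_sorted_eq)
      then show "Y q J = (\<Sum>I\<in>?Q. Y q I * wedge (sorted_list_of_set I) J)"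
        using J by simp
    next
      fix J assume J: "J \<in> ?Q"
      then show "sorted_list_of_set J \<in> ilists ?m"
        using finJ[OF J] by (simp add: index_lists_def)
    qed (use False c sectionsD[OF Y(1)] in auto)
  qed
  then show ?thesis unfolding L_map_pre_lie[OF assms(1)] by (simp only: if_cancel)
qed

context
  fixes P :: point and T :: "nat set"
begin

abbreviation F where "F \<equiv> fix_idx S \<alpha> \<inter> fix_idx S \<beta>"

text \<open>
  A direction of \<open>X\<close> in \<open>N\<^sup>\<beta>\<close> either differentiates \<open>y\<close>, which is constant along it, or remains in the wedge
  product, where \<open>\<Lambda>\<^sub>\<beta>\<close> contains it. A direction of \<open>Y\<close> in \<open>N\<^sup>\<alpha>\<close> is repeated by \<open>\<Lambda>\<^sub>\<alpha>\<close>.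
\<close>

lemma field_summand_zero:
  assumes "set is \<subseteq> F" "set ps \<subseteq> normal_idx S \<beta>" "set js \<subseteq> F" "set qs \<subseteq> normal_idx S \<alpha>"
    and y: "y \<in> polys (fix_idx S \<beta>)" and "ps \<noteq> [] \<or> qs \<noteq> []"
  shows "contraction (\<lambda>e. partial e y P) (\<lambda>zs. wedge ((js @ qs) @ ys S \<beta> @ zs @ ys S \<alpha>) T) (is @ ps) = 0"
  unfolding contraction_eq_sum
proof (intro sum.neutral ballI)
  fix i assume i: "i \<in> {..<length (is @ ps)}"
  let ?zs = "take i (is @ ps) @ drop (Suc i) (is @ ps)"
  have "partial ((is @ ps) ! i) y P = 0 \<or> wedge ((js @ qs) @ ys S \<beta> @ ?zs @ ys S \<alpha>) T = 0"
  proof (cases "qs = []")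
    case True
    then obtain x where x: "x \<in> set ps" using assms(6) by (metis hd_in_set)
    show ?thesis
    proof (cases "i < length is")
      case True
      then have "x \<in> set ?zs" using x by simp
      then have "\<not> distinct ((js @ qs) @ ys S \<beta> @ ?zs @ ys S \<alpha>)"
        using x assms(2) set_ys(1)[of \<beta>] by auto
      then show ?thesis using wedge_nonzeroD(2) by blast
    next
      case False
      then have "(is @ ps) ! i \<in> set ps" using i by (simp add: nth_append)
      then have "(is @ ps) ! i \<notin> fix_idx S \<beta>" using assms(2) idx_disjoint(1)[of \<beta>] by blast
      then show ?thesis using partial_not_in[OF y] by blast
    qed
  next
    case False
    then obtain x where "x \<in> set qs" by (metis hd_in_set)
    then have "\<not> distinct ((js @ qs) @ ys S \<beta> @ ?zs @ ys S \<alpha>)"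
      using assms(4) set_ys(1)[of \<alpha>] by auto
    then show ?thesis using wedge_nonzeroD(2) by blast
  qed
  then show "(- 1) ^ i * partial ((is @ ps) ! i) y P * wedge ((js @ qs) @ ys S \<beta> @ ?zs @ ys S \<alpha>) T = 0"
    by auto
qed

lemma field_summand:
  assumes len: "length is + codim S \<alpha> = k" "length js + codim S \<beta> = l"
  shows "contraction (\<lambda>e. partial e y P) (\<lambda>zs. wedge (js @ ys S \<beta> @ zs @ ys S \<alpha>) T) is =
    (\<Sum>z = 1..k - codim S \<alpha>. sign1 k l (codim S \<alpha>) (codim S \<beta>) z * partial (is ! (z - 1)) y P *
       wedge (take (z - 1) is @ drop z is @ js @ ys S \<alpha> @ ys S \<beta>) T)"
proof -
  let ?a = "codim S \<alpha>" and ?b = "codim S \<beta>"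
  have m: "k - ?a = length is" using len(1) by simp
  have "(-1) ^ i * partial (is ! i) y P * wedge (js @ ys S \<beta> @ (take i is @ drop (Suc i) is) @ ys S \<alpha>) T =
      sign1 k l ?a ?b (Suc i) * partial (is ! i) y P *
       wedge (take i is @ drop (Suc i) is @ js @ ys S \<alpha> @ ys S \<beta>) T" if i: "i < length is" for i
  proof -
    let ?zs = "take i is @ drop (Suc i) is"
    obtain m' where m': "length is = Suc m'" using i by (cases "length is") auto
    have zs: "length ?zs = m'" using i m' by simp
    have "wedge (js @ ys S \<beta> @ ?zs @ ys S \<alpha>) T =
        (-1) ^ (l * m') * wedge (?zs @ (js @ ys S \<beta>) @ ys S \<alpha>) T"
      using alternating_move_block[OF alternating_wedge, of "[]" "js @ ys S \<beta>" ?zs "ys S \<alpha>" T]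
        zs len(2) length_ys[OF ab(2)] by simp
    also have "wedge (?zs @ (js @ ys S \<beta>) @ ys S \<alpha>) T =
        (-1) ^ (?b * ?a) * wedge (?zs @ js @ ys S \<alpha> @ ys S \<beta>) T"
      using alternating_move_block[OF alternating_wedge, of "?zs @ js" "ys S \<beta>" "ys S \<alpha>" "[]" T]
        length_ys[OF ab(1)] length_ys[OF ab(2)] by simp
    finally have w: "wedge (js @ ys S \<beta> @ ?zs @ ys S \<alpha>) T =
        (-1) ^ (l * m') * ((-1) ^ (?b * ?a) * wedge (?zs @ js @ ys S \<alpha> @ ys S \<beta>) T)" .
    have k: "k = Suc m' + ?a" using len(1) m' by simp
    have "(-1) ^ i * ((-1) ^ (l * m') * (-1) ^ (?b * ?a)) = sign1 k l ?a ?b (Suc i)"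
      unfolding sign1_def minus_one_powi minus_one_power_iff k by auto
    then show ?thesis unfolding w by (simp add: mult_ac)
  qed
  then have "contraction (\<lambda>e. partial e y P) (\<lambda>zs. wedge (js @ ys S \<beta> @ zs @ ys S \<alpha>) T) is =
    (\<Sum>i<length is. sign1 k l ?a ?b (Suc i) * partial (is ! i) y P *
       wedge (take i is @ drop (Suc i) is @ js @ ys S \<alpha> @ ys S \<beta>) T)"
    unfolding contraction_eq_sum by (intro sum.cong[OF refl]) simp_all
  then show ?thesis
    unfolding m by (simp add: sum.atLeast1_atMost_eq)
qed

context
  assumes disjoint: "normal_idx S \<alpha> \<inter> normal_idx S \<beta> = {}"
    and T: "normal_idx S \<alpha> \<union> normal_idx S \<beta> \<subseteq> T"
begin

text \<open>
  The component at \<open>T\<close> needs all directions of \<open>N\<^sup>\<alpha>\<close>, and the one that was spent on the derivative can only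
  be supplied by \<open>Y\<close>. Any further direction of \<open>Y\<close> in \<open>N\<^sup>\<alpha>\<close> would be repeated.
\<close>

lemma cocycle_wedge_nonzero:
  assumes "set is \<subseteq> F" "set ps \<subseteq> normal_idx S \<beta>" "set js \<subseteq> F" "set qs \<subseteq> normal_idx S \<alpha>"
    and r: "r < codim S \<alpha>"
    and nz: "wedge ((is @ ps) @ (js @ qs) @ ys S \<beta> @ (take r (ys S \<alpha>) @ drop (Suc r) (ys S \<alpha>))) T \<noteq> 0"
  shows "ps = []" "qs = [ys S \<alpha> ! r]"
proof -
  let ?Z = "take r (ys S \<alpha>) @ drop (Suc r) (ys S \<alpha>)" and ?q = "ys S \<alpha> ! r"
  have len: "r < length (ys S \<alpha>)" using r length_ys[OF ab(1)] by simp
  have yq: "ys S \<alpha> = take r (ys S \<alpha>) @ ?q # drop (Suc r) (ys S \<alpha>)"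
    by (rule id_take_nth_drop[OF len])
  have sZ: "set (ys S \<alpha>) = insert ?q (set ?Z)" by (subst yq) auto
  have qZ: "?q \<notin> set ?Z"
  proof -
    have "distinct (take r (ys S \<alpha>) @ ?q # drop (Suc r) (ys S \<alpha>))"
      using set_ys(2)[of \<alpha>] yq by simp
    then show ?thesis by auto
  qed
  have dist: "distinct ((is @ ps) @ (js @ qs) @ ys S \<beta> @ ?Z)"
    and set: "set ((is @ ps) @ (js @ qs) @ ys S \<beta> @ ?Z) = T"
    using wedge_nonzeroD[OF nz] by auto
  have "set ps \<inter> set (ys S \<beta>) = {}" using dist by auto
  then show "ps = []" using Int_absorb2[OF assms(2)] by (simp add: set_ys)
  have qN: "?q \<in> normal_idx S \<alpha>" using weight_ys(3)[OF ab(1) r] .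
  then have "?q \<in> set ((is @ ps) @ (js @ qs) @ ys S \<beta> @ ?Z)" using T unfolding set by blast
  moreover have "?q \<notin> F" "?q \<notin> normal_idx S \<beta>"
    using qN idx_disjoint(1)[of \<alpha>] disjoint by blast+
  ultimately have "?q \<in> set qs"
    using assms(1,2,3) qZ set_ys(1)[of \<beta>] by auto
  moreover have "set qs \<subseteq> {?q}"
  proof -
    have "set qs \<inter> set ?Z = {}" using dist by auto
    moreover have "set qs \<subseteq> insert ?q (set ?Z)" using assms(4) sZ by (simp add: set_ys)
    ultimately show ?thesis by blast
  qed
  ultimately have "set qs = {?q}" by blast
  moreover from this obtain z zs where "qs = z # zs" by (cases qs) auto
  moreover have "distinct qs" using dist by simp
  ultimately show "qs = [?q]" by (cases zs) auto
qed

lemma cocycle_summand_zero: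
  assumes "set is \<subseteq> F" "set ps \<subseteq> normal_idx S \<beta>" "set js \<subseteq> F" "set qs \<subseteq> normal_idx S \<alpha>"
    and "ps \<noteq> [] \<or> (\<nexists>q. qs = [q])"
  shows "contraction u (\<lambda>zs. wedge ((is @ ps) @ (js @ qs) @ ys S \<beta> @ zs) T) (ys S \<alpha>) = 0"
  unfolding contraction_eq_sum length_ys[OF ab(1)]
  using cocycle_wedge_nonzero[OF assms(1-4)] assms(5) by (intro sum.neutral) force

text \<open>
  The direction \<open>q\<close> supplied by \<open>Y\<close> is moved to the position that it had in \<open>\<Lambda>\<^sub>\<alpha>\<close>; this cancels the sign of
  the contraction. Moving \<open>\<Lambda>\<^sub>\<beta>\<close> past the other \<open>l(\<alpha>) - 1\<close> directions gives the second summand of the exponent.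
\<close>

lemma cocycle_summand:
  assumes "set is \<subseteq> F" "set js \<subseteq> F" and q: "q \<in> normal_idx S \<alpha>"
    and len: "length is + codim S \<alpha> = k" "length js + 1 + codim S \<beta> = l"
  shows "(-1) powi (int (k - codim S \<alpha>) * (int l - 1)) *
      contraction u (\<lambda>zs. wedge (is @ (js @ [q]) @ ys S \<beta> @ zs) T) (ys S \<alpha>) =
    sign2 k l (codim S \<alpha>) (codim S \<beta>) * u q * wedge (is @ js @ ys S \<alpha> @ ys S \<beta>) T"
proof -
  let ?a = "codim S \<alpha>" and ?b = "codim S \<beta>"
  obtain r where r: "r < ?a" "ys S \<alpha> ! r = q"
    using q set_ys(1)[of \<alpha>] length_ys[OF ab(1)] by (metis in_set_conv_nth)
  let ?Z = "\<lambda>r. take r (ys S \<alpha>) @ drop (Suc r) (ys S \<alpha>)"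
  have zero: "wedge (is @ (js @ [q]) @ ys S \<beta> @ ?Z i) T = 0" if "i < ?a" "i \<noteq> r" for i
  proof (rule ccontr)
    assume "wedge (is @ (js @ [q]) @ ys S \<beta> @ ?Z i) T \<noteq> 0"
    then have "ys S \<alpha> ! i = q"
      using cocycle_wedge_nonzero(2)[of "is" "[]" js "[q]" i] assms that by simp
    then show False
      using that r nth_eq_iff_index_eq[OF set_ys(2)[of \<alpha>], of i r] length_ys[OF ab(1)] by metis
  qed
  have "contraction u (\<lambda>zs. wedge (is @ (js @ [q]) @ ys S \<beta> @ zs) T) (ys S \<alpha>) =
      (\<Sum>i<?a. if i = r then (-1) ^ r * u q * wedge (is @ (js @ [q]) @ ys S \<beta> @ ?Z r) T else 0)"
    unfolding contraction_eq_sum length_ys[OF ab(1)]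
    using zero r(2) by (intro sum.cong refl) auto
  also have "\<dots> = (-1) ^ r * u q * wedge (is @ (js @ [q]) @ ys S \<beta> @ ?Z r) T"
    using r(1) by simp
  also have "wedge (is @ (js @ [q]) @ ys S \<beta> @ ?Z r) T =
      (-1) ^ (?b * (?a - 1)) * wedge (is @ (js @ [q]) @ ?Z r @ ys S \<beta>) T"
    using alternating_move_block[OF alternating_wedge, of "is @ (js @ [q])" "ys S \<beta>" "?Z r" "[]" T]
      r(1) length_ys[OF ab(1)] length_ys[OF ab(2)] by simp
  also have "wedge (is @ (js @ [q]) @ ?Z r @ ys S \<beta>) T = (-1) ^ r * wedge (is @ js @ ys S \<alpha> @ ys S \<beta>) T"
  proof -
    have y: "take r (ys S \<alpha>) @ q # drop (Suc r) (ys S \<alpha>) @ ys S \<beta> = ys S \<alpha> @ ys S \<beta>"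
      using id_take_nth_drop[of r "ys S \<alpha>"] r length_ys[OF ab(1)]
      by (metis append.assoc append_Cons)
    show ?thesis
      using alternating_move[OF alternating_wedge, of "is @ js" q "take r (ys S \<alpha>)" "drop (Suc r) (ys S \<alpha>) @ ys S \<beta>" T,
          unfolded append_assoc y] r(1) length_ys[OF ab(1)] by simp
  qed
  finally have eq: "contraction u (\<lambda>zs. wedge (is @ (js @ [q]) @ ys S \<beta> @ zs) T) (ys S \<alpha>) =
      (-1) ^ r * u q * ((-1) ^ (?b * (?a - 1)) * ((-1) ^ r * wedge (is @ js @ ys S \<alpha> @ ys S \<beta>) T))" .
  obtain a' where a': "?a = Suc a'" using r(1) by (cases ?a) auto
  have k: "k = length is + Suc a'" using len(1) a' by simp
  have sgn: "(-1) powi (int (k - ?a) * (int l - 1)) * ((-1) ^ r * ((-1) ^ (?b * (?a - 1)) * (-1) ^ r)) =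
      sign2 k l ?a ?b"
    unfolding sign2_def a' minus_one_powi minus_one_power_iff k by auto
  show ?thesis unfolding eq sgn[symmetric] by (simp only: mult_ac)
qed

end

end

section \<open>The bracket formula\<close>

lemma L_map_disjoint:
  fixes cX cY :: "nat list \<Rightarrow> nat list \<Rightarrow> pfun"
  defines "g \<equiv> \<alpha> \<otimes>\<^bsub>G\<^esub> \<beta>"
  assumes disjoint: "normal_idx S \<alpha> \<inter> normal_idx S \<beta> = {}"
    and cY: "\<And>js qs. cY js qs \<in> polys (fix_idx S \<beta>)"
    and X_exp: "\<And>p T. X p T = (\<Sum>(is, ps) \<in> {(is, ps). set is \<subseteq> fix_idx S g \<and>
             set ps \<subseteq> normal_idx S \<beta> \<and> length is + length ps + codim S \<alpha> = k}.
             cX is ps p * wedge (is @ ps) T)"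
    and Y_exp: "\<And>p T. Y p T = (\<Sum>(js, qs) \<in> {(js, qs). set js \<subseteq> fix_idx S g \<and>
             set qs \<subseteq> normal_idx S \<alpha> \<and> length js + length qs + codim S \<beta> = l}.
             cY js qs p * wedge (js @ qs) T)"
  shows "L_map S (k + l - 1) product g p T =
             (\<Sum>is | set is \<subseteq> fix_idx S g \<and> length is + codim S \<alpha> = k.
              \<Sum>js | set js \<subseteq> fix_idx S g \<and> length js + codim S \<beta> = l.
              \<Sum>z = 1..k - codim S \<alpha>.
                sign1 k l (codim S \<alpha>) (codim S \<beta>) z *
                cX is [] (to_fix S g p) * partial (is ! (z - 1)) (cY js []) (to_fix S g p) *
                wedge (take (z - 1) is @ drop z is @ js @ ys S \<alpha> @ ys S \<beta>) T)
           + (\<Sum>is | set is \<subseteq> fix_idx S g \<and> length is + codim S \<alpha> = k.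
              \<Sum>js | set js \<subseteq> fix_idx S g \<and> length js + 1 + codim S \<beta> = l.
              \<Sum>q \<in> normal_idx S \<alpha>.
                sign2 k l (codim S \<alpha>) (codim S \<beta>) *
                cX is [] (to_fix S g p) * partial q (cY js [q]) (to_fix S g p) *
                wedge (is @ js @ ys S \<alpha> @ ys S \<beta>) T)" (is "?L = ?R1 + ?R2")
proof -
  let ?a = "codim S \<alpha>" and ?b = "codim S \<beta>" and ?P = "to_fix S g p"
  let ?S = "\<Sum>is\<in>ilists (k + l - 1).
         product_coeff (map (shifted ?P) is) ?P * wedge is T"
  have g: "g \<in> carrier G" using ab by (simp add: g_def)
  have normal_g: "normal_idx S g = normal_idx S \<alpha> \<union> normal_idx S \<beta>"
    and fix_g: "fix_idx S g = fix_idx S \<alpha> \<inter> fix_idx S \<beta>"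
    unfolding g_def using normal_idx_mult[OF ab disjoint] fix_idx_mult[OF ab disjoint] by auto
  have L: "?L = (if normal_idx S g \<subseteq> T then ?S else 0)"
    unfolding L_map_pre_lie[OF g] by (simp add: g_def)
  \<comment> \<open>Outside of the degrees where the fields can be nonzero, and for components that the projection
    discards, both sides vanish.\<close>
  consider "k < ?a \<or> l < ?b" | "?a \<le> k" "?b \<le> l" "\<not> normal_idx S g \<subseteq> T"
    | "?a \<le> k" "?b \<le> l" "normal_idx S g \<subseteq> T" by linarith
  then show ?thesis
  proof cases
    case 1
    then have "?L = 0" unfolding L using sum_pre_lie_degenerate by simp
    moreover have "?R1 = 0" "?R2 = 0" using 1 by (auto intro!: sum.neutral)
    ultimately show ?thesis by simp
  next
    case 2
    have "wedge (xs @ ys S \<alpha> @ ys S \<beta>) T = 0" for xs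
      using 2(3) wedge_nonzeroD(3)[of "xs @ ys S \<alpha> @ ys S \<beta>" T] unfolding normal_g by (auto simp: set_ys)
    from this[of "_ @ _ @ _"] this[of "_ @ _"] have "?R1 = 0" "?R2 = 0" by (auto intro!: sum.neutral)
    then show ?thesis using 2(3) unfolding L by simp
  next
    case 3
    let ?R = "{(is, ps). set is \<subseteq> fix_idx S g \<and> set ps \<subseteq> normal_idx S \<beta> \<and> length is + length ps + ?a = k}"
    let ?Q = "{(js, qs). set js \<subseteq> fix_idx S g \<and> set qs \<subseteq> normal_idx S \<alpha> \<and> length js + length qs + ?b = l}"
    let ?du = "\<lambda>js qs e. partial e (cY js qs) ?P"
    let ?sg = "(-1 :: complex) powi (int (k - ?a) * (int l - 1))"
    define C1 where "C1 = (\<lambda>is ps js qs.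
      contraction (?du js qs) (\<lambda>zs. wedge ((js @ qs) @ ys S \<beta> @ zs @ ys S \<alpha>) T) (is @ ps))"
    define C2 where "C2 = (\<lambda>is ps js qs.
      contraction (?du js qs) (\<lambda>zs. wedge ((is @ ps) @ (js @ qs) @ ys S \<beta> @ zs) T) (ys S \<alpha>))"
    have P0: "?P i = 0" if "i \<in> normal_idx S \<alpha>" for i
      using that normal_g by (simp add: to_fix_def)
    have fin: "finite (fix_idx S g)" "finite (normal_idx S \<alpha>)" "finite (normal_idx S \<beta>)" by simp_all
    have sub: "fix_idx S g \<subseteq> {..<n}" "normal_idx S \<alpha> \<subseteq> {..<n}" "normal_idx S \<beta> \<subseteq> {..<n}"
      using idx_subset by auto
    have finR: "finite ?R" by (rule finite_list_pairs[OF fin(1,3)])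
    have finQ: "finite ?Q" by (rule finite_list_pairs[OF fin(1,2)])
    have "?S = (\<Sum>s\<in>?R. \<Sum>t\<in>?Q. cX (fst s) (snd s) ?P *
       (contraction (?du (fst t) (snd t)) (\<lambda>zs. wedge ((fst t @ snd t) @ ys S \<beta> @ zs @ ys S \<alpha>) T) (fst s @ snd s) +
        ?sg * contraction (?du (fst t) (snd t)) (\<lambda>zs. wedge ((fst s @ snd s) @ (fst t @ snd t) @ ys S \<beta> @ zs) T) (ys S \<alpha>)))"
    proof (rule sum_pre_lie_coeff_contraction[where Q = ?Q and R = ?R and yc = "\<lambda>t. cY (fst t) (snd t)"
          and yl = "\<lambda>t. fst t @ snd t" and xc = "\<lambda>s. cX (fst s) (snd s) ?P" and xl = "\<lambda>s. fst s @ snd s",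
          OF alternating_wedge finQ _ _ _ 3(1,2) finR])
      show "cY (fst t) (snd t) \<in> A" for t using polys_mono[OF cY idx_subset(1)] .
      show "fst t @ snd t \<in> ilists (l - ?b)" if "t \<in> ?Q" for t
        using that sub by (auto simp: index_lists_def)
      show "fst t @ snd t \<in> ilists (k - ?a)" if "t \<in> ?R" for t
        using that sub by (auto simp: index_lists_def)
      show "Y q J = (\<Sum>t\<in>?Q. cY (fst t) (snd t) q * wedge (fst t @ snd t) J)" for q J
        using Y_exp[of q J] by (simp add: case_prod_unfold)
      show "X ?P I = (\<Sum>s\<in>?R. cX (fst s) (snd s) ?P * wedge (fst s @ snd s) I)" for I
        using X_exp[of ?P I] by (simp add: case_prod_unfold)
    qed (rule P0)
    also have "\<dots> = (\<Sum>(is, ps)\<in>?R. cX is ps ?P * (\<Sum>(js, qs)\<in>?Q. C1 is ps js qs)) +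
        (\<Sum>(is, ps)\<in>?R. cX is ps ?P * (\<Sum>(js, qs)\<in>?Q. ?sg * C2 is ps js qs))"
      unfolding C1_def C2_def
      by (simp only: case_prod_unfold sum_distrib_left distrib_left sum.distrib)
    also have "(\<Sum>(is, ps)\<in>?R. cX is ps ?P * (\<Sum>(js, qs)\<in>?Q. C1 is ps js qs)) =
        (\<Sum>is | set is \<subseteq> fix_idx S g \<and> length is + ?a = k. cX is [] ?P * (\<Sum>(js, qs)\<in>?Q. C1 is [] js qs))"
    proof (rule sum_pairs_nil[OF fin(1,3)])
      fix "is" ps :: "nat list" assume "ps \<noteq> []" "set is \<subseteq> fix_idx S g" "set ps \<subseteq> normal_idx S \<beta>"
      then have "C1 is ps js qs = 0" if "(js, qs) \<in> ?Q" for js qs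
        using that cY unfolding C1_def fix_g by (intro field_summand_zero) auto
      then show "cX is ps ?P * (\<Sum>(js, qs)\<in>?Q. C1 is ps js qs) = 0" by (auto intro!: sum.neutral)
    qed
    also have "\<dots> = ?R1"
    proof (rule sum.cong[OF refl])
      fix "is" assume "is \<in> {is. set is \<subseteq> fix_idx S g \<and> length is + ?a = k}"
      then have lis: "set is \<subseteq> fix_idx S g" "length is + ?a = k" by auto
      have "(\<Sum>(js, qs)\<in>?Q. C1 is [] js qs) =
          (\<Sum>js | set js \<subseteq> fix_idx S g \<and> length js + ?b = l. C1 is [] js [])"
        using lis cY unfolding C1_def fix_g
        by (intro sum_pairs_nil fin field_summand_zero) auto
      also have "\<dots> = (\<Sum>js | set js \<subseteq> fix_idx S g \<and> length js + ?b = l. \<Sum>z = 1..k - ?a.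
          sign1 k l ?a ?b z * partial (is ! (z - 1)) (cY js []) ?P *
          wedge (take (z - 1) is @ drop z is @ js @ ys S \<alpha> @ ys S \<beta>) T)"
        unfolding C1_def using field_summand[OF lis(2)] by (intro sum.cong[OF refl]) simp
      finally show "cX is [] ?P * (\<Sum>(js, qs)\<in>?Q. C1 is [] js qs) =
          (\<Sum>js | set js \<subseteq> fix_idx S g \<and> length js + ?b = l. \<Sum>z = 1..k - ?a.
          sign1 k l ?a ?b z * cX is [] ?P * partial (is ! (z - 1)) (cY js []) ?P *
          wedge (take (z - 1) is @ drop z is @ js @ ys S \<alpha> @ ys S \<beta>) T)"
        by (simp add: sum_distrib_left mult_ac)
    qed
    also have "(\<Sum>(is, ps)\<in>?R. cX is ps ?P * (\<Sum>(js, qs)\<in>?Q. ?sg * C2 is ps js qs)) =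
        (\<Sum>is | set is \<subseteq> fix_idx S g \<and> length is + ?a = k. cX is [] ?P * (\<Sum>(js, qs)\<in>?Q. ?sg * C2 is [] js qs))"
    proof (rule sum_pairs_nil[OF fin(1,3)])
      fix "is" ps :: "nat list" assume "ps \<noteq> []" "set is \<subseteq> fix_idx S g" "set ps \<subseteq> normal_idx S \<beta>"
      then have "C2 is ps js qs = 0" if "(js, qs) \<in> ?Q" for js qs
        using that 3(3) unfolding C2_def fix_g normal_g by (intro cocycle_summand_zero[OF disjoint]) auto
      then show "cX is ps ?P * (\<Sum>(js, qs)\<in>?Q. ?sg * C2 is ps js qs) = 0" by (auto intro!: sum.neutral)
    qed
    also have "\<dots> = ?R2"
    proof (rule sum.cong[OF refl])
      fix "is" assume "is \<in> {is. set is \<subseteq> fix_idx S g \<and> length is + ?a = k}"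
      then have lis: "set is \<subseteq> fix_idx S g" "length is + ?a = k" by auto
      have "(\<Sum>(js, qs)\<in>?Q. ?sg * C2 is [] js qs) =
          (\<Sum>js | set js \<subseteq> fix_idx S g \<and> length js + 1 + ?b = l. \<Sum>q\<in>normal_idx S \<alpha>. ?sg * C2 is [] js [q])"
      proof (rule sum_pairs_single[OF fin(1,2)])
        fix js qs assume "set js \<subseteq> fix_idx S g" "set qs \<subseteq> normal_idx S \<alpha>" "\<nexists>q. qs = [q]"
        then have "C2 is [] js qs = 0"
          using lis 3(3) unfolding C2_def fix_g normal_g by (intro cocycle_summand_zero[OF disjoint]) auto
        then show "?sg * C2 is [] js qs = 0" by simp
      qed
      also have "\<dots> = (\<Sum>js | set js \<subseteq> fix_idx S g \<and> length js + 1 + ?b = l. \<Sum>q\<in>normal_idx S \<alpha>.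
          sign2 k l ?a ?b * partial q (cY js [q]) ?P * wedge (is @ js @ ys S \<alpha> @ ys S \<beta>) T)"
      proof (rule sum.cong[OF refl], rule sum.cong[OF refl])
        fix js q assume "js \<in> {js. set js \<subseteq> fix_idx S g \<and> length js + 1 + ?b = l}" "q \<in> normal_idx S \<alpha>"
        then show "?sg * C2 is [] js [q] =
            sign2 k l ?a ?b * partial q (cY js [q]) ?P * wedge (is @ js @ ys S \<alpha> @ ys S \<beta>) T"
          using cocycle_summand[OF disjoint, of T "is" js q "?du js [q]"] lis 3(3)
          unfolding C2_def fix_g normal_g by simp
      qed
      finally show "cX is [] ?P * (\<Sum>(js, qs)\<in>?Q. ?sg * C2 is [] js qs) =
          (\<Sum>js | set js \<subseteq> fix_idx S g \<and> length js + 1 + ?b = l. \<Sum>q\<in>normal_idx S \<alpha>.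
          sign2 k l ?a ?b * cX is [] ?P * partial q (cY js [q]) ?P * wedge (is @ js @ ys S \<alpha> @ ys S \<beta>) T)"
        by (simp add: sum_distrib_left mult_ac)
    qed
    finally show ?thesis unfolding L using 3(3) by simp
  qed
qed

end

theorem theorem4p10:
  fixes S :: "('g, 'v::real_vector) lin_action"
    and \<alpha> \<beta> g :: 'g and k l :: nat and X Y :: mvfield
  assumes "abelian_lin_action S"
    and "\<alpha> \<in> carrier (grp S)" and "\<beta> \<in> carrier (grp S)"
    and "X \<in> sections S \<alpha> k" and "invariant S (tensor_Lambda S \<alpha> X)"
    and "Y \<in> sections S \<beta> l" and "invariant S (tensor_Lambda S \<beta> Y)"
    and "g = \<alpha> \<otimes>\<^bsub>grp S\<^esub> \<beta>"
  shows
    "(sum_space (fix_sub S \<alpha>) (fix_sub S \<beta>) \<noteq> UNIV \<longrightarrow>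
       (\<forall>\<gamma> \<in> carrier (grp S). \<forall>p T.
          L_map S (k + l - 1) (pre_lie k l (T_map S k \<alpha> X) (T_map S l \<beta> Y)) \<gamma> p T = 0))
     \<and>
     (sum_space (fix_sub S \<alpha>) (fix_sub S \<beta>) = UNIV \<longrightarrow>
       direct_sum UNIV (fix_sub S g) (sum_space (normal_sub S \<alpha>) (normal_sub S \<beta>)) \<and>
       direct_sum (normal_sub S g) (normal_sub S \<alpha>) (normal_sub S \<beta>) \<and>
       direct_sum (fix_sub S \<alpha>) (fix_sub S g) (normal_sub S \<beta>) \<and>
       direct_sum (fix_sub S \<beta>) (fix_sub S g) (normal_sub S \<alpha>) \<and>
       codim S g = codim S \<alpha> + codim S \<beta> \<and>
       (\<forall>cX cY :: nat list \<Rightarrow> nat list \<Rightarrow> pfun.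
          (\<forall>is ps. cX is ps \<in> polys (fix_idx S \<alpha>)) \<and>
          (\<forall>js qs. cY js qs \<in> polys (fix_idx S \<beta>)) \<and>
          (\<forall>p T. X p T = (\<Sum>(is, ps) \<in> {(is, ps). set is \<subseteq> fix_idx S g \<and>
             set ps \<subseteq> normal_idx S \<beta> \<and> length is + length ps + codim S \<alpha> = k}.
             cX is ps p * wedge (is @ ps) T)) \<and>
          (\<forall>p T. Y p T = (\<Sum>(js, qs) \<in> {(js, qs). set js \<subseteq> fix_idx S g \<and>
             set qs \<subseteq> normal_idx S \<alpha> \<and> length js + length qs + codim S \<beta> = l}.
             cY js qs p * wedge (js @ qs) T))
          \<longrightarrow>
          (\<forall>p T. L_map S (k + l - 1) (pre_lie k l (T_map S k \<alpha> X) (T_map S l \<beta> Y)) g p T =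
             (\<Sum>is | set is \<subseteq> fix_idx S g \<and> length is + codim S \<alpha> = k.
              \<Sum>js | set js \<subseteq> fix_idx S g \<and> length js + codim S \<beta> = l.
              \<Sum>z = 1..k - codim S \<alpha>.
                sign1 k l (codim S \<alpha>) (codim S \<beta>) z *
                cX is [] (to_fix S g p) * partial (is ! (z - 1)) (cY js []) (to_fix S g p) *
                wedge (take (z - 1) is @ drop z is @ js @ ys S \<alpha> @ ys S \<beta>) T)
           + (\<Sum>is | set is \<subseteq> fix_idx S g \<and> length is + codim S \<alpha> = k.
              \<Sum>js | set js \<subseteq> fix_idx S g \<and> length js + 1 + codim S \<beta> = l.
              \<Sum>q \<in> normal_idx S \<alpha>.
                sign2 k l (codim S \<alpha>) (codim S \<beta>) *
                cX is [] (to_fix S g p) * partial q (cY js [q]) (to_fix S g p) *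
                wedge (is @ js @ ys S \<alpha> @ ys S \<beta>) T))))"
proof -
  interpret abelian_lin_action S by fact
  have ab: "\<alpha> \<in> carrier (grp S)" "\<beta> \<in> carrier (grp S)" by fact+
  interpret section_pair S \<alpha> \<beta> k l X Y
    by unfold_locales fact+
  have g: "g = \<alpha> \<otimes>\<^bsub>grp S\<^esub> \<beta>" by fact
  have gG: "g \<in> carrier (grp S)" unfolding g using ab by simp
  show ?thesis
  proof (intro conjI impI)
    assume "sum_space (fix_sub S \<alpha>) (fix_sub S \<beta>) \<noteq> UNIV"
    then obtain c where "c \<in> normal_idx S \<alpha>" "c \<in> normal_idx S \<beta>"
      using sum_fix_sub_eq_UNIV_iff[OF ab] by blast
    then show "\<forall>\<gamma> \<in> carrier (grp S). \<forall>p T.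
        L_map S (k + l - 1) (pre_lie k l (T_map S k \<alpha> X) (T_map S l \<beta> Y)) \<gamma> p T = 0"
      using L_map_overlap by blast
  next
    assume "sum_space (fix_sub S \<alpha>) (fix_sub S \<beta>) = UNIV"
    then have disjoint: "normal_idx S \<alpha> \<inter> normal_idx S \<beta> = {}"
      using sum_fix_sub_eq_UNIV_iff[OF ab] by blast
    then have disjoint': "normal_idx S \<beta> \<inter> normal_idx S \<alpha> = {}" by blast
    have g': "g = \<beta> \<otimes>\<^bsub>grp S\<^esub> \<alpha>" unfolding g by (rule m_comm[OF ab])
    show normal: "direct_sum (normal_sub S g) (normal_sub S \<alpha>) (normal_sub S \<beta>)"
      unfolding g by (rule direct_sum_normal[OF ab disjoint])
    show "direct_sum UNIV (fix_sub S g) (sum_space (normal_sub S \<alpha>) (normal_sub S \<beta>))"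
      using direct_sum_fix_normal[OF gG] normal unfolding direct_sum_def by simp
    show "direct_sum (fix_sub S \<alpha>) (fix_sub S g) (normal_sub S \<beta>)"
      unfolding g by (rule direct_sum_fix[OF ab disjoint])
    show "direct_sum (fix_sub S \<beta>) (fix_sub S g) (normal_sub S \<alpha>)"
      unfolding g' by (rule direct_sum_fix[OF ab(2,1) disjoint'])
    show "codim S g = codim S \<alpha> + codim S \<beta>"
      unfolding g by (rule codim_mult[OF ab disjoint])
    \<comment> \<open>What is left is the formula for the coefficients.\<close>
  qed (unfold g, intro allI impI, elim conjE, rule L_map_disjoint,
    (use sum_fix_sub_eq_UNIV_iff[OF ab] in blast)+)
qed

end
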